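(* Let $\Bbbk$ be an algebraically closed field of characteristic zero, let $A=\Bbbk[x,y,z]$ be graded by $\deg x=a$, $\deg y=b$, $\deg z=c$ with $1\le a\le b\le c$, let $\Omega\in A$ be an irreducible homogeneous element of degree $a+b+c$, and let $Q=Q(P_\Omega)$ be the Poisson fraction field of $P_\Omega=A_\Omega/(\Omega)$. Then: (1) If $\Omega$ does not have an isolated singularity, then $Q$ is isomorphic, as a Poisson field, to either $K_{Weyl}$ or $K_q$ for some $q\in\Bbbk^\times$. (2) If $\Omega$ has an isolated singularity, then $Q$ is isomorphic, as a Poisson field, to $S_{\zeta,\lambda}$ for some $\zeta,\lambda\in\Bbbk$ with $\zeta\neq0$ and $\lambda^3\ne-3^3\zeta^3$. Moreover, for the irreducible potentials in the following lists (which occur for the indicated weights) the type of $Q$ is as follows. (i) $Q\cong S_{\zeta,\lambda'}$ for some $\zeta,\lambda'$ as in (2) when $\Omega$ is: $x^3+y^3+z^3+3\lambda xyz$ with $\lambda^3\ne-1$, weights $(1,1,1)$; $z^2+xy^3+\lambda x^2y^2+x^3y$ with $\lambda\neq\pm2$, weights $(1,1,2)$; $z^2+y^3+\lambda x^2y^2+x^4y$ with $\lambda\ne\pm2$, weights $(1,2,3)$. (ii) $Q\cong K_q$ for some $q\in\Bbbk^\times$ when $\Omega$ is: $x^3+x^2z+y^2z$, weights $(1,1,1)$; $z^2+x^2y^2+x^3y$, $z^2+xy^3\pm2x^2y^2+x^3y$ or $xyz+x^4+y^4$, weights $(1,1,2)$; $xyz+x^{k+2}+y^{k+2}$, weights $a=b$,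 $c=ka$, $k\geq3$; $z^2+y^3+x^2y^2$, $z^2+y^3\pm2x^2y^2+x^4y$, $z^2+x^2y^2+x^4y$ or $xyz+x^6+y^3$, weights $(1,2,3)$; $z^2+x^2y^2+x^{2+\frac{2b}a}$, weights $a<b$, $c=a+b$, $a\nmid b$, $a\mid 2b$; $z^2+x^2y^2+x^{2+\frac ba}y$, weights $a<b$, $c=a+b$, $a\mid b$, $b\neq2a$; $xyz+x^{\frac{a+b+c}{a}}+y^{\frac{a+b+c}{b}}$, weights $a<b<c\neq a+b$, $a\mid b+c$, $b\mid a+c$. (iii) $Q\cong K_{Weyl}$ when $\Omega$ is: $x^3+y^2z$, weights $(1,1,1)$; $z^2+x^3y$, $x^2z+y^4$ or $x^2z+xy^3+y^4$, weights $(1,1,2)$; $x^2z+xy^{k+1}+y^{k+2}$ or $x^2z+y^{k+2}$, weights $a=b$, $c=ka$, $k\ge3$; $z^2+y^3$, $z^2+x^4y$, $x^3z+y^3+x^2y^2$ or $x^3z+y^3$, weights $(1,2,3)$; $z^2+x^{2+\frac{2b}a}$, weights $a<b$, $c=a+b$, $a\nmid b$, $a\mid2b$; $z^2+x^{2+\frac ba}y$, weights $a<b$, $c=a+b$, $a\mid b$, $b\ne2a$; $x^{\frac b{\gcd(a,b)}}+y^{\frac a{\gcd(a,b)}}$, weights $a<b<c=\frac{ab}{\gcd(a,b)}-a-b$, $a\nmid b$, $c\ne a+b$; $x^{1+\frac ba}z+y^{\frac{a+b+c}b}$ or $x^{1+\frac ba}z+x^{\frac ba}y^{\frac{a+c}{b}}+y^{\frac{a+b+c}b}$,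 weights $a<b<c\neq a+b$, $a\mid b$, $b\mid a+c$.
   Context: $A_\Omega$ denotes $A=\Bbbk[x,y,z]$ with the Poisson bracket $\{f,g\}=\det\frac{\partial(f,g,\Omega)}{\partial(x,y,z)}$ (so $\{x,y\}=\Omega_z$, $\{y,z\}=\Omega_x$, $\{z,x\}=\Omega_y$). $\Omega$ is Poisson central, so $P_\Omega=A_\Omega/(\Omega)$ is a Poisson algebra; when it is a domain, its bracket extends uniquely to its fraction field $Q(P_\Omega)$. $\Omega$ has an isolated singularity if $\Omega_x,\Omega_y,\Omega_z$ vanish simultaneously only at the origin. $K_{Weyl}$ is the Poisson field $\Bbbk(x,y)$ with $\{x,y\}=1$. For $q\in\Bbbk^\times$, $K_q$ is the Poisson field $\Bbbk(x,y)$ with $\{x,y\}=qxy$. For $\zeta,\lambda\in\Bbbk$ with $\zeta\ne0$, $\lambda^3\neq-3^3\zeta^3$, let $\Omega_{\zeta,\lambda}=\zeta(x^3+y^3+z^3)+\lambda xyz$ and let $S_{\zeta,\lambda}$ be the Poisson fraction field of $A_{\Omega_{\zeta,\lambda}}/(\Omega_{\zeta,\lambda})$. *)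

theory Defs
  imports
    "HOL-Computational_Algebra.Polynomial"
    "HOL-Algebra.Module"
    "HOL-Algebra.QuotRing"
begin

section \<open>Poisson algebras\<close>

text \<open>
  The scalars are the elements of a type \<open>'k\<close>, which will be a field as a type class.
\<close>

record ('k, 'a) poisson = "('k, 'a) module" +
  bracket :: "'a \<Rightarrow> 'a \<Rightarrow> 'a" (\<open>\<lbrace>_,/ _\<rbrace>\<index>\<close>)

definition poisson_iso ::
    "('k, 'a, 'm) poisson_scheme \<Rightarrow> ('k, 'b, 'n) poisson_scheme \<Rightarrow> ('a \<Rightarrow> 'b) set" where
  "poisson_iso P Q = {h \<in> ring_iso P Q.
     (\<forall>s. \<forall>u\<in>carrier P. h (s \<odot>\<^bsub>P\<^esub> u) = s \<odot>\<^bsub>Q\<^esub> h u) \<and>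
     (\<forall>u\<in>carrier P. \<forall>v\<in>carrier P. h \<lbrace>u, v\<rbrace>\<^bsub>P\<^esub> = \<lbrace>h u, h v\<rbrace>\<^bsub>Q\<^esub>)}"

definition is_poisson_iso ::
    "('k, 'a, 'm) poisson_scheme \<Rightarrow> ('k, 'b, 'n) poisson_scheme \<Rightarrow> bool" (infixr \<open>\<simeq>\<^sub>P\<close> 60) where
  "P \<simeq>\<^sub>P Q \<longleftrightarrow> poisson_iso P Q \<noteq> {}"

text \<open>
  The quotient by a Poisson ideal. As for multiplication in \<^const>\<open>FactRing\<close>, the operations
  are computed on all representatives; for a Poisson ideal the union is over equal cosets.
\<close>

definition poisson_quot ::
    "('k, 'a, 'm) poisson_scheme \<Rightarrow> 'a set \<Rightarrow> ('k, 'a set) poisson" where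
  "poisson_quot P I =
     \<lparr>carrier = carrier (P Quot I), mult = mult (P Quot I), one = one (P Quot I),
      zero = zero (P Quot I), add = add (P Quot I),
      smult = (\<lambda>s U. \<Union>u\<in>U. I +>\<^bsub>P\<^esub> (s \<odot>\<^bsub>P\<^esub> u)),
      bracket = (\<lambda>U V. \<Union>u\<in>U. \<Union>v\<in>V. I +>\<^bsub>P\<^esub> \<lbrace>u, v\<rbrace>\<^bsub>P\<^esub>)\<rparr>"


section \<open>The Poisson fraction field of a Poisson domain\<close>

definition frac_rel :: "('a, 'm) ring_scheme \<Rightarrow> (('a \<times> 'a) \<times> ('a \<times> 'a)) set" where
  "frac_rel R = {((p, q), (r, s)).
     p \<in> carrier R \<and> q \<in> carrier R - {\<zero>\<^bsub>R\<^esub>} \<and> r \<in> carrier R \<and> s \<in> carrier R - {\<zero>\<^bsub>R\<^esub>} \<and>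
     p \<otimes>\<^bsub>R\<^esub> s = r \<otimes>\<^bsub>R\<^esub> q}"

definition frac :: "('a, 'm) ring_scheme \<Rightarrow> 'a \<Rightarrow> 'a \<Rightarrow> ('a \<times> 'a) set" where
  "frac R p q = frac_rel R `` {(p, q)}"

text \<open>
  The bracket is the unique extension to fractions, given by the quotient rule in both arguments:
  \[ \{p/q, r/s\} = \frac{qs\{p,r\} - qr\{p,s\} - ps\{q,r\} + pr\{q,s\}}{q^2 s^2}. \]
\<close>

definition poisson_frac :: "('k, 'a, 'm) poisson_scheme \<Rightarrow> ('k, ('a \<times> 'a) set) poisson" where
  "poisson_frac P =
     \<lparr>carrier = (carrier P \<times> (carrier P - {\<zero>\<^bsub>P\<^esub>})) // frac_rel P,
      mult = (\<lambda>U V. \<Union>(p, q)\<in>U. \<Union>(r, s)\<in>V. frac P (p \<otimes>\<^bsub>P\<^esub> r) (q \<otimes>\<^bsub>P\<^esub> s)),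
      one = frac P \<one>\<^bsub>P\<^esub> \<one>\<^bsub>P\<^esub>,
      zero = frac P \<zero>\<^bsub>P\<^esub> \<one>\<^bsub>P\<^esub>,
      add = (\<lambda>U V. \<Union>(p, q)\<in>U. \<Union>(r, s)\<in>V.
               frac P (p \<otimes>\<^bsub>P\<^esub> s \<oplus>\<^bsub>P\<^esub> r \<otimes>\<^bsub>P\<^esub> q) (q \<otimes>\<^bsub>P\<^esub> s)),
      smult = (\<lambda>t U. \<Union>(p, q)\<in>U. frac P (t \<odot>\<^bsub>P\<^esub> p) q),
      bracket = (\<lambda>U V. \<Union>(p, q)\<in>U. \<Union>(r, s)\<in>V.
               frac P
                 (q \<otimes>\<^bsub>P\<^esub> s \<otimes>\<^bsub>P\<^esub> \<lbrace>p, r\<rbrace>\<^bsub>P\<^esub> \<ominus>\<^bsub>P\<^esub> q \<otimes>\<^bsub>P\<^esub> r \<otimes>\<^bsub>P\<^esub> \<lbrace>p, s\<rbrace>\<^bsub>P\<^esub>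
                   \<ominus>\<^bsub>P\<^esub> p \<otimes>\<^bsub>P\<^esub> s \<otimes>\<^bsub>P\<^esub> \<lbrace>q, r\<rbrace>\<^bsub>P\<^esub> \<oplus>\<^bsub>P\<^esub> p \<otimes>\<^bsub>P\<^esub> r \<otimes>\<^bsub>P\<^esub> \<lbrace>q, s\<rbrace>\<^bsub>P\<^esub>)
                 (q \<otimes>\<^bsub>P\<^esub> q \<otimes>\<^bsub>P\<^esub> (s \<otimes>\<^bsub>P\<^esub> s)))\<rparr>"


section \<open>Polynomials in three variables\<close>

text \<open>
  \<open>k[x,y,z]\<close> is the iterated polynomial ring \<open>k[x][y][z]\<close>: the outermost variable is \<open>z\<close>, and the
  coefficient of \<open>x\<^sup>i y\<^sup>j z\<^sup>l\<close> in \<open>f\<close> is \<open>coeff (coeff (coeff f l) j) i\<close>.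
\<close>

type_synonym 'k poly3 = "'k poly poly poly"

abbreviation Const :: "'k::comm_ring_1 \<Rightarrow> 'k poly3" where "Const r \<equiv> [:[:[:r:]:]:]"
abbreviation X :: "'k::comm_ring_1 poly3" where "X \<equiv> [:[:[:0, 1:]:]:]"
abbreviation Y :: "'k::comm_ring_1 poly3" where "Y \<equiv> [:[:0, 1:]:]"
abbreviation Z :: "'k::comm_ring_1 poly3" where "Z \<equiv> [:0, 1:]"

definition dX :: "'k::field poly3 \<Rightarrow> 'k poly3" where "dX = map_poly (map_poly pderiv)"
definition dY :: "'k::field poly3 \<Rightarrow> 'k poly3" where "dY = map_poly pderiv"
definition dZ :: "'k::field poly3 \<Rightarrow> 'k poly3" where "dZ = pderiv"

definition eval3 :: "'k::field poly3 \<Rightarrow> 'k \<Rightarrow> 'k \<Rightarrow> 'k \<Rightarrow> 'k" where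
  "eval3 f u v w = poly (poly (poly f [:[:w:]:]) [:v:]) u"

definition whomogeneous :: "nat \<Rightarrow> nat \<Rightarrow> nat \<Rightarrow> nat \<Rightarrow> 'k::field poly3 \<Rightarrow> bool" where
  "whomogeneous a b c d f \<longleftrightarrow>
     (\<forall>i j l. coeff (coeff (coeff f l) j) i \<noteq> 0 \<longrightarrow> a * i + b * j + c * l = d)"

definition isolated_singularity :: "'k::field poly3 \<Rightarrow> bool" where
  "isolated_singularity Om \<longleftrightarrow>
     {(u, v, w). eval3 (dX Om) u v w = 0 \<and> eval3 (dY Om) u v w = 0 \<and> eval3 (dZ Om) u v w = 0}
       = {(0, 0, 0)}"

text \<open>The bracket is the Jacobian determinant of \<open>(f, g, \<Omega>)\<close>, expanded along the row of \<open>f\<close>.\<close>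

definition poisson_A :: "'k::field poly3 \<Rightarrow> ('k, 'k poly3) poisson" where
  "poisson_A Om =
     \<lparr>carrier = UNIV, mult = (*), one = 1, zero = 0, add = (+),
      smult = (\<lambda>r f. Const r * f),
      bracket = (\<lambda>f g. dX f * (dY g * dZ Om - dZ g * dY Om)
                     - dY f * (dX g * dZ Om - dZ g * dX Om)
                     + dZ f * (dX g * dY Om - dY g * dX Om))\<rparr>"

definition poisson_P :: "'k::field poly3 \<Rightarrow> ('k, 'k poly3 set) poisson" where
  "poisson_P Om = poisson_quot (poisson_A Om) (PIdl\<^bsub>poisson_A Om\<^esub> Om)"

definition poisson_Q :: "'k::field poly3 \<Rightarrow> ('k, ('k poly3 set \<times> 'k poly3 set) set) poisson" where
  "poisson_Q Om = poisson_frac (poisson_P Om)"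

definition poisson_S :: "'k::field \<Rightarrow> 'k \<Rightarrow> ('k, ('k poly3 set \<times> 'k poly3 set) set) poisson" where
  "poisson_S \<zeta> l = poisson_Q (Const \<zeta> * (X ^ 3 + Y ^ 3 + Z ^ 3) + Const l * X * Y * Z)"


section \<open>The Poisson fields on the rational functions in two variables\<close>

text \<open>
  \<open>k[x,y]\<close> is \<open>k[x][y]\<close>. The Poisson bracket on it with \<open>{x, y} = h\<close> is
  \<open>{f, g} = h (f\<^sub>x g\<^sub>y - f\<^sub>y g\<^sub>x)\<close>, where \<open>\<partial>/\<partial>x\<close> is \<open>map_poly pderiv\<close> and \<open>\<partial>/\<partial>y\<close> is \<open>pderiv\<close>.
\<close>

definition poisson_plane :: "'k::field poly poly \<Rightarrow> ('k, 'k poly poly) poisson" where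
  "poisson_plane h =
     \<lparr>carrier = UNIV, mult = (*), one = 1, zero = 0, add = (+),
      smult = (\<lambda>r f. [:[:r:]:] * f),
      bracket = (\<lambda>f g. h * (map_poly pderiv f * pderiv g - pderiv f * map_poly pderiv g))\<rparr>"

definition K_Weyl :: "('k::field, ('k poly poly \<times> 'k poly poly) set) poisson" where
  "K_Weyl = poisson_frac (poisson_plane 1)"

definition K_skew :: "'k::field \<Rightarrow> ('k, ('k poly poly \<times> 'k poly poly) set) poisson" where
  "K_skew q = poisson_frac (poisson_plane ([:[:q:]:] * [:[:0, 1:]:] * [:0, 1:]))"


section \<open>The lists of potentials\<close>

text \<open>
  The first three arguments are the weights of \<open>x\<close>, \<open>y\<close>, \<open>z\<close>. All the divisions that occur in
  exponents are exact under the stated conditions.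
\<close>

inductive S_list :: "nat \<Rightarrow> nat \<Rightarrow> nat \<Rightarrow> 'k::field poly3 \<Rightarrow> bool" where
  "r ^ 3 \<noteq> -1 \<Longrightarrow> S_list 1 1 1 (X ^ 3 + Y ^ 3 + Z ^ 3 + Const (3 * r) * X * Y * Z)"
| "r \<noteq> 2 \<Longrightarrow> r \<noteq> -2 \<Longrightarrow>
     S_list 1 1 2 (Z ^ 2 + X * Y ^ 3 + Const r * X ^ 2 * Y ^ 2 + X ^ 3 * Y)"
| "r \<noteq> 2 \<Longrightarrow> r \<noteq> -2 \<Longrightarrow>
     S_list 1 2 3 (Z ^ 2 + Y ^ 3 + Const r * X ^ 2 * Y ^ 2 + X ^ 4 * Y)"

inductive K_skew_list :: "nat \<Rightarrow> nat \<Rightarrow> nat \<Rightarrow> 'k::field poly3 \<Rightarrow> bool" where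
  "K_skew_list 1 1 1 (X ^ 3 + X ^ 2 * Z + Y ^ 2 * Z)"
| "K_skew_list 1 1 2 (Z ^ 2 + X ^ 2 * Y ^ 2 + X ^ 3 * Y)"
| "r = 2 \<or> r = -2 \<Longrightarrow>
     K_skew_list 1 1 2 (Z ^ 2 + X * Y ^ 3 + Const r * X ^ 2 * Y ^ 2 + X ^ 3 * Y)"
| "K_skew_list 1 1 2 (X * Y * Z + X ^ 4 + Y ^ 4)"
| "1 \<le> a \<Longrightarrow> 3 \<le> k \<Longrightarrow> K_skew_list a a (k * a) (X * Y * Z + X ^ (k + 2) + Y ^ (k + 2))"
| "K_skew_list 1 2 3 (Z ^ 2 + Y ^ 3 + X ^ 2 * Y ^ 2)"
| "r = 2 \<or> r = -2 \<Longrightarrow>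
     K_skew_list 1 2 3 (Z ^ 2 + Y ^ 3 + Const r * X ^ 2 * Y ^ 2 + X ^ 4 * Y)"
| "K_skew_list 1 2 3 (Z ^ 2 + X ^ 2 * Y ^ 2 + X ^ 4 * Y)"
| "K_skew_list 1 2 3 (X * Y * Z + X ^ 6 + Y ^ 3)"
| "1 \<le> a \<Longrightarrow> a < b \<Longrightarrow> c = a + b \<Longrightarrow> \<not> a dvd b \<Longrightarrow> a dvd 2 * b \<Longrightarrow>
     K_skew_list a b c (Z ^ 2 + X ^ 2 * Y ^ 2 + X ^ (2 + (2 * b) div a))"
| "1 \<le> a \<Longrightarrow> a < b \<Longrightarrow> c = a + b \<Longrightarrow> a dvd b \<Longrightarrow> b \<noteq> 2 * a \<Longrightarrow>
     K_skew_list a b c (Z ^ 2 + X ^ 2 * Y ^ 2 + X ^ (2 + b div a) * Y)"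
| "1 \<le> a \<Longrightarrow> a < b \<Longrightarrow> b < c \<Longrightarrow> c \<noteq> a + b \<Longrightarrow> a dvd b + c \<Longrightarrow> b dvd a + c \<Longrightarrow>
     K_skew_list a b c (X * Y * Z + X ^ ((a + b + c) div a) + Y ^ ((a + b + c) div b))"

inductive K_Weyl_list :: "nat \<Rightarrow> nat \<Rightarrow> nat \<Rightarrow> 'k::field poly3 \<Rightarrow> bool" where
  "K_Weyl_list 1 1 1 (X ^ 3 + Y ^ 2 * Z)"
| "K_Weyl_list 1 1 2 (Z ^ 2 + X ^ 3 * Y)"
| "K_Weyl_list 1 1 2 (X ^ 2 * Z + Y ^ 4)"
| "K_Weyl_list 1 1 2 (X ^ 2 * Z + X * Y ^ 3 + Y ^ 4)"
| "1 \<le> a \<Longrightarrow> 3 \<le> k \<Longrightarrow> K_Weyl_list a a (k * a) (X ^ 2 * Z + X * Y ^ (k + 1) + Y ^ (k + 2))"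
| "1 \<le> a \<Longrightarrow> 3 \<le> k \<Longrightarrow> K_Weyl_list a a (k * a) (X ^ 2 * Z + Y ^ (k + 2))"
| "K_Weyl_list 1 2 3 (Z ^ 2 + Y ^ 3)"
| "K_Weyl_list 1 2 3 (Z ^ 2 + X ^ 4 * Y)"
| "K_Weyl_list 1 2 3 (X ^ 3 * Z + Y ^ 3 + X ^ 2 * Y ^ 2)"
| "K_Weyl_list 1 2 3 (X ^ 3 * Z + Y ^ 3)"
| "1 \<le> a \<Longrightarrow> a < b \<Longrightarrow> c = a + b \<Longrightarrow> \<not> a dvd b \<Longrightarrow> a dvd 2 * b \<Longrightarrow>
     K_Weyl_list a b c (Z ^ 2 + X ^ (2 + (2 * b) div a))"
| "1 \<le> a \<Longrightarrow> a < b \<Longrightarrow> c = a + b \<Longrightarrow> a dvd b \<Longrightarrow> b \<noteq> 2 * a \<Longrightarrow>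
     K_Weyl_list a b c (Z ^ 2 + X ^ (2 + b div a) * Y)"
| "1 \<le> a \<Longrightarrow> a < b \<Longrightarrow> b < c \<Longrightarrow> a + b + c = (a * b) div gcd a b \<Longrightarrow> \<not> a dvd b \<Longrightarrow> c \<noteq> a + b \<Longrightarrow>
     K_Weyl_list a b c (X ^ (b div gcd a b) + Y ^ (a div gcd a b))"
| "1 \<le> a \<Longrightarrow> a < b \<Longrightarrow> b < c \<Longrightarrow> c \<noteq> a + b \<Longrightarrow> a dvd b \<Longrightarrow> b dvd a + c \<Longrightarrow>
     K_Weyl_list a b c (X ^ (1 + b div a) * Z + Y ^ ((a + b + c) div b))"
| "1 \<le> a \<Longrightarrow> a < b \<Longrightarrow> b < c \<Longrightarrow> c \<noteq> a + b \<Longrightarrow> a dvd b \<Longrightarrow> b dvd a + c \<Longrightarrow>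
     K_Weyl_list a b c
       (X ^ (1 + b div a) * Z + X ^ (b div a) * Y ^ ((a + c) div b) + Y ^ ((a + b + c) div b))"

end

theory Submission
  imports Defs "HOL-Computational_Algebra.Polynomial_Factorial" "HOL-Computational_Algebra.Field_as_Ring"
begin

text \<open>
  A polynomial map \<open>\<theta>\<close> with Jacobian determinant \<open>m\<close> that sends \<open>\<Omega>\<close> to \<open>m\<Omega>'\<close> is compatible with the
  brackets, and it induces an isomorphism of Poisson fields as soon as the images of the coordinates
  generate the target; injectivity is automatic, since coordinates with nonzero bracket are
  algebraically independent. If \<open>\<Omega>\<close> is linear in \<open>z\<close>, eliminating \<open>z\<close> leaves the \<open>xy\<close>-plane with bracket
  \<open>\<Omega>\<^sub>z\<close>; otherwise one completes the square, projects from a singular point, or parametrizes. The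
  rational surfaces thus become planes with simple brackets. In the isolated cases the surface is a
  double cover of Weierstrass type, and an inflection point of it leads to the Hesse form.
\<close>

section \<open>Poisson domains presented by polynomial rings\<close>

text \<open>The degree a + b + c is what keeps the case list short. If b < c, then \<Omega> has
  degree at most 2 in z. If it is even linear in z, the coefficient of z has weight a + b, so,
  unless it vanishes, the bracket left on the xy-plane is a binary quadratic form (a = b) or
  x(\<alpha>y + \<beta>x^n) (a < b). Two independent factors, taken as new coordinates, give the
  bracket of K_q; a power of a single coordinate gives the Weyl bracket. Elliptic curves can occur
  only for weights proportional to (1,1,1), (1,1,2) or (1,2,3), because every other weight forces a
  singular axis. An element of Q is a class of pairs of cosets, and each operation is a union over
  representatives. Computations are therefore moved to polynomials, where equality of fractions is
  divisibility by one modulus, and an isomorphism of fields is produced from a substitution of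
  polynomials. What remains for each substitution is to check the brackets of the coordinates and to
  recover the target variables by rational operations from their images.\<close>

text \<open>
  The modulus \<open>g\<close> is either zero or a prime element, so the coordinate planes (\<open>g = 0\<close>) and the
  surfaces \<open>\<Omega> = 0\<close> (\<open>g = \<Omega>\<close>) are handled alike, computing in a type class instead of a carrier.
\<close>

locale poisson_presentation =
  fixes P :: "('k::field, 'a, 'm) poisson_scheme" (structure)
    and proj :: "'b::comm_ring_1 \<Rightarrow> 'a"
    and g :: 'b
    and br :: "'b \<Rightarrow> 'b \<Rightarrow> 'b"
    and cc :: "'k \<Rightarrow> 'b"
  assumes carrier: "carrier P = range proj"
    and add: "proj u \<oplus> proj v = proj (u + v)"
    and mult: "proj u \<otimes> proj v = proj (u * v)"
    and one: "\<one> = proj 1"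
    and zero: "\<zero> = proj 0"
    and smult: "s \<odot> proj u = proj (cc s * u)"
    and bracket: "\<lbrace>proj u, proj v\<rbrace> = proj (br u v)"
    and eq: "proj u = proj v \<longleftrightarrow> g dvd u - v"
    and prime: "g dvd u * v \<Longrightarrow> g dvd u \<or> g dvd v"
    and proper: "\<not> g dvd 1"
    and cc_add: "cc (r + s) = cc r + cc s"
    and cc_mult: "cc (r * s) = cc r * cc s"
    and cc_one: "cc 1 = 1"
    and br_add: "br (u + v) w = br u w + br v w"
    and br_mult: "br (u * v) w = u * br v w + v * br u w"
    and br_swap: "br u v = - br v u"
    and br_self: "br u u = 0"
    and br_const: "br (cc s) u = 0"
    and br_modulus: "g dvd br g u"
begin

lemma br_add2: "br w (u + v) = br w u + br w v"
  using br_add br_swap by (metis minus_add_distrib)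

lemma br_zero [simp]: "br 0 w = 0" "br w 0 = 0"
proof -
  show *: "br 0 w = 0" for w
    using br_add[of 0 0 w] by simp
  show "br w 0 = 0"
    using br_swap[of w 0] * by simp
qed

lemma br_uminus: "br (- u) w = - br u w" "br w (- u) = - br w u"
  using br_add[of "- u" u w] br_add2[of w "- u" u] by (simp_all add: eq_neg_iff_add_eq_0)

lemma br_diff: "br (u - v) w = br u w - br v w" "br w (u - v) = br w u - br w v"
  using br_add[of u "- v" w] br_add2[of w u "- v"] by (simp_all add: br_uminus)

lemma dvd_br: "g dvd u \<Longrightarrow> g dvd br u v"
  using br_mult br_modulus by (auto elim!: dvdE)

lemma cc_zero: "cc 0 = 0"
  using cc_add[of 0 0] by simp

lemma not_dvd_cc: "s \<noteq> 0 \<Longrightarrow> \<not> g dvd cc s"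
proof
  assume "s \<noteq> 0" "g dvd cc s"
  then have "g dvd cc s * cc (inverse s)" by simp
  also have "cc s * cc (inverse s) = 1"
    using \<open>s \<noteq> 0\<close> by (simp flip: cc_mult add: cc_one)
  finally show False using proper by simp
qed

lemma dvd_cc_mult_iff: "s \<noteq> 0 \<Longrightarrow> g dvd cc s * u \<longleftrightarrow> g dvd u"
  using prime not_dvd_cc by (metis dvd_mult)

lemma proj_eq_zero: "proj u = \<zero> \<longleftrightarrow> g dvd u"
  by (simp add: zero eq)

lemma is_abelian_group: "abelian_group P"
proof (rule abelian_groupI)
  fix x assume "x \<in> carrier P"
  then obtain u where "x = proj u" by (auto simp: carrier)
  then have "proj (- u) \<oplus> x = \<zero>" by (simp add: add zero)
  then show "\<exists>y\<in>carrier P. y \<oplus> x = \<zero>" by (auto simp: carrier)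
qed (auto simp: carrier add zero algebra_simps)

lemma minus: "proj u \<ominus> proj v = proj (u - v)"
proof -
  interpret abelian_group P by (rule is_abelian_group)
  have "\<ominus> proj v = proj (- v)"
    by (rule minus_equality) (auto simp: carrier add zero)
  then show ?thesis by (simp add: a_minus_def add)
qed

definition fr :: "'b \<Rightarrow> 'b \<Rightarrow> ('a \<times> 'a) set" where
  "fr u v = frac P (proj u) (proj v)"

lemma mem_fr_iff:
  assumes "\<not> g dvd v"
  shows "(p, q) \<in> fr u v \<longleftrightarrow>
    (\<exists>r s. p = proj r \<and> q = proj s \<and> \<not> g dvd s \<and> g dvd u * s - r * v)"
proof
  assume "(p, q) \<in> fr u v"
  then show "\<exists>r s. p = proj r \<and> q = proj s \<and> \<not> g dvd s \<and> g dvd u * s - r * v"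
    unfolding fr_def frac_def frac_rel_def carrier
    by clarsimp (metis eq mult proj_eq_zero)
next
  assume "\<exists>r s. p = proj r \<and> q = proj s \<and> \<not> g dvd s \<and> g dvd u * s - r * v"
  then show "(p, q) \<in> fr u v"
    using assms by (auto simp: fr_def frac_def frac_rel_def carrier proj_eq_zero mult eq simp del: ex_simps)
qed

text \<open>Transitivity of cross-multiplication: the wanted difference first appears multiplied by
  \<open>v\<close>, and \<open>v\<close> cancels by primality of the modulus.\<close>

lemma fr_subset:
  assumes "\<not> g dvd v" "\<not> g dvd t" "g dvd u * t - s * v"
  shows "fr u v \<subseteq> fr s t"
proof clarify
  fix p q assume "(p, q) \<in> fr u v"
  then obtain a b where *: "p = proj a" "q = proj b" "\<not> g dvd b" "g dvd u * b - a * v"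
    using assms mem_fr_iff by blast
  have "v * (s * b - a * t) = t * (u * b - a * v) - b * (u * t - s * v)"
    by (simp add: algebra_simps)
  then have "g dvd v * (s * b - a * t)"
    using * assms by (metis dvd_diff dvd_mult)
  then have "g dvd s * b - a * t"
    using prime assms by blast
  then show "(p, q) \<in> fr s t"
    using * assms mem_fr_iff by blast
qed

lemma fr_eq_iff:
  assumes "\<not> g dvd v" "\<not> g dvd t"
  shows "fr u v = fr s t \<longleftrightarrow> g dvd u * t - s * v"
proof
  assume "fr u v = fr s t"
  moreover have "(proj u, proj v) \<in> fr u v"
    unfolding mem_fr_iff[OF assms(1)] using assms by fastforce
  ultimately obtain r q where *: "g dvd r - u" "g dvd q - v" "g dvd s * q - r * t"
    using assms mem_fr_iff by (metis eq minus_diff_eq dvd_minus_iff)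
  have "u * t - s * v = s * (q - v) - t * (r - u) - (s * q - r * t)"
    by (simp add: algebra_simps)
  then show "g dvd u * t - s * v"
    using * by (metis dvd_diff dvd_mult)
next
  assume "g dvd u * t - s * v"
  moreover from this have "g dvd s * v - u * t"
    by (metis minus_diff_eq dvd_minus_iff)
  ultimately show "fr u v = fr s t"
    using fr_subset assms by blast
qed

text \<open>The multipliers \<open>a\<close> and \<open>b\<close> act as a certificate of membership
  in the ideal of \<open>g\<close>, so that each equality of fractions below becomes one polynomial
  identity.\<close>

lemma fr_eqI:
  assumes "\<not> g dvd v" "\<not> g dvd t" "u * t - s * v = a * d + b * e" "g dvd d" "g dvd e"
  shows "fr u v = fr s t"
  unfolding fr_eq_iff[OF assms(1,2)] assms(3) using assms(4,5) by simp

lemma mem_fr: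
  assumes "\<not> g dvd v" "(p, q) \<in> fr u v"
  obtains r s where "p = proj r" "q = proj s" "\<not> g dvd s" "g dvd u * s - r * v"
  using assms mem_fr_iff by blast

lemma fr_nonempty: "\<not> g dvd v \<Longrightarrow> fr u v \<noteq> {}"
  using mem_fr_iff[of v "proj u" "proj v" u] by (metis diff_self dvd_0_right empty_iff)

lemma not_dvd_mult: "\<not> g dvd u \<Longrightarrow> \<not> g dvd v \<Longrightarrow> \<not> g dvd u * v"
  using prime by blast

lemma carrier_poisson_frac: "carrier (poisson_frac P) = {fr u v | u v. \<not> g dvd v}"
proof -
  have "carrier P - {\<zero>} = {proj v | v. \<not> g dvd v}"
    by (auto simp: carrier proj_eq_zero)
  then have "carrier P \<times> (carrier P - {\<zero>}) = {(proj u, proj v) | u v. \<not> g dvd v}"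
    by (auto simp: carrier)
  then show ?thesis
    by (auto simp: poisson_frac_def quotient_def fr_def frac_def)
qed

text \<open>Here well-definedness enters: the union over all representatives collapses to a single
  class once the value is independent of the representative, and the index set is inhabited.\<close>

lemma Union_fr:
  assumes "\<not> g dvd v" "\<And>r s. \<not> g dvd s \<Longrightarrow> g dvd u * s - r * v \<Longrightarrow> f (proj r) (proj s) = W"
  shows "(\<Union>(p, q)\<in>fr u v. f p q) = W"
proof -
  have "(case x of (p, q) \<Rightarrow> f p q) = W" if "x \<in> fr u v" for x
    using that assms by (cases x) (auto elim!: mem_fr[OF assms(1)])
  then show ?thesis
    using fr_nonempty[OF assms(1), of u] by auto
qed

lemma mult_fr:
  assumes "\<not> g dvd v" "\<not> g dvd t"
  shows "fr u v \<otimes>\<^bsub>poisson_frac P\<^esub> fr s t = fr (u * s) (v * t)"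
  unfolding poisson_frac_def
proof (simp, rule Union_fr[OF assms(1)], rule Union_fr[OF assms(2)])
  fix r q r' q'
  assume *: "\<not> g dvd q" "g dvd u * q - r * v" "\<not> g dvd q'" "g dvd s * q' - r' * t"
  show "frac P (proj r \<otimes> proj r') (proj q \<otimes> proj q') = fr (u * s) (v * t)"
    unfolding mult fr_def[symmetric]
    by (rule fr_eqI[where a = "- (s * q')" and b = "- (r * v)", OF _ _ _ *(2,4)])
      (use * assms not_dvd_mult in \<open>auto simp: algebra_simps\<close>)
qed

lemma add_fr:
  assumes "\<not> g dvd v" "\<not> g dvd t"
  shows "fr u v \<oplus>\<^bsub>poisson_frac P\<^esub> fr s t = fr (u * t + s * v) (v * t)"
  unfolding poisson_frac_def
proof (simp, rule Union_fr[OF assms(1)], rule Union_fr[OF assms(2)])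
  fix r q r' q'
  assume *: "\<not> g dvd q" "g dvd u * q - r * v" "\<not> g dvd q'" "g dvd s * q' - r' * t"
  show "frac P (proj r \<otimes> proj q' \<oplus> proj r' \<otimes> proj q) (proj q \<otimes> proj q') = fr (u * t + s * v) (v * t)"
    unfolding mult add fr_def[symmetric]
    by (rule fr_eqI[where a = "- (t * q')" and b = "- (v * q)", OF _ _ _ *(2,4)])
      (use * assms not_dvd_mult in \<open>auto simp: algebra_simps\<close>)
qed

lemma smult_fr:
  assumes "\<not> g dvd v"
  shows "c \<odot>\<^bsub>poisson_frac P\<^esub> fr u v = fr (cc c * u) v"
  unfolding poisson_frac_def
proof (simp, rule Union_fr[OF assms(1)])
  fix r q
  assume *: "\<not> g dvd q" "g dvd u * q - r * v"
  show "frac P (c \<odot> proj r) (proj q) = fr (cc c * u) v"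
    unfolding smult fr_def[symmetric]
    by (rule fr_eqI[where a = "- cc c" and b = 0, OF _ _ _ *(2,2)])
      (use * assms not_dvd_mult in \<open>auto simp: algebra_simps\<close>)
qed

definition frbr :: "'b \<Rightarrow> 'b \<Rightarrow> 'b \<Rightarrow> 'b \<Rightarrow> 'b" where
  "frbr u v s t = v * t * br u s - v * s * br u t - u * t * br v s + u * s * br v t"

lemma frbr_swap: "frbr u v s t = - frbr s t u v"
  unfolding frbr_def using br_swap[of u] br_swap[of v] by (simp add: algebra_simps)

text \<open>
  Multiplying the derivation numerator \<open>v{u,w} - u{v,w}\<close> of \<open>u/v\<close> by \<open>q\<^sup>2\<close> and reducing modulo
  \<open>uq = rv\<close> and its image under \<open>{\<cdot>,w}\<close> gives \<open>v\<^sup>2\<close> times that of \<open>r/q\<close>.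
\<close>

lemma frbr_cong:
  assumes "\<not> g dvd v" "\<not> g dvd q" "g dvd u * q - r * v" "\<not> g dvd t"
  shows "fr (frbr r q s t) (q * q * (t * t)) = fr (frbr u v s t) (v * v * (t * t))"
proof -
  define D where "D a b w = b * br a w - a * br b w" for a b w
  have D: "g dvd D u v w * (q * q) - D r q w * (v * v)" for w
  proof -
    have "g dvd br (u * q - r * v) w"
      using assms dvd_br by blast
    then have E: "g dvd u * br q w + q * br u w - r * br v w - v * br r w"
      by (simp add: br_diff br_mult algebra_simps)
    have "D u v w * (q * q) - D r q w * (v * v) =
      v * q * (u * br q w + q * br u w - r * br v w - v * br r w)
      + (- (q * br v w) - v * br q w) * (u * q - r * v)"
      by (simp add: D_def algebra_simps)
    then show ?thesis
      using E assms by simp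
  qed
  have N: "frbr a b s t = t * D a b s - s * D a b t" for a b
    by (simp add: frbr_def D_def algebra_simps)
  show ?thesis
    unfolding N
    by (rule fr_eqI[where a = "- (t * t) * t" and b = "(t * t) * s", OF _ _ _ D[of s] D[of t]])
      (use assms in \<open>auto simp: algebra_simps intro!: not_dvd_mult dest!: prime\<close>)
qed

text \<open>Representatives are changed one argument at a time. \<open>frbr_cong\<close> treats the
  first argument; the second is brought into first position by antisymmetry and moved back
  afterwards.\<close>

lemma bracket_fr:
  assumes "\<not> g dvd v" "\<not> g dvd t"
  shows "\<lbrace>fr u v, fr s t\<rbrace>\<^bsub>poisson_frac P\<^esub> = fr (frbr u v s t) (v * v * (t * t))"
  unfolding poisson_frac_def
proof (simp, rule Union_fr[OF assms(1)], rule Union_fr[OF assms(2)])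
  fix r q r' q'
  assume *: "\<not> g dvd q" "g dvd u * q - r * v" "\<not> g dvd q'" "g dvd s * q' - r' * t"
  have neg: "fr (- a) b = fr (- c) d"
    if "fr a b = fr c d" "\<not> g dvd b" "\<not> g dvd d" for a b c d
  proof -
    have "g dvd a * d - c * b" using that fr_eq_iff by blast
    moreover have "- a * d - - c * b = - (a * d - c * b)" by simp
    ultimately show ?thesis
      using fr_eq_iff[of b d] that by (metis dvd_minus_iff)
  qed
  have "fr (frbr r q r' q') (q * q * (q' * q')) = fr (frbr u v r' q') (v * v * (q' * q'))"
    using frbr_cong * assms by blast
  also have "\<dots> = fr (- frbr r' q' u v) (q' * q' * (v * v))"
    by (metis frbr_swap mult.commute)
  also have "\<dots> = fr (- frbr s t u v) (t * t * (v * v))"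
    using frbr_cong[of t q' s r' v u] * assms by (intro neg) (auto dest!: prime)
  also have "\<dots> = fr (frbr u v s t) (v * v * (t * t))"
    by (metis frbr_swap mult.commute)
  finally show "frac P (proj q \<otimes> proj q' \<otimes> \<lbrace>proj r, proj r'\<rbrace> \<ominus> proj q \<otimes> proj r' \<otimes> \<lbrace>proj r, proj q'\<rbrace>
      \<ominus> proj r \<otimes> proj q' \<otimes> \<lbrace>proj q, proj r'\<rbrace> \<oplus> proj r \<otimes> proj r' \<otimes> \<lbrace>proj q, proj q'\<rbrace>)
      (proj q \<otimes> proj q \<otimes> (proj q' \<otimes> proj q')) = fr (frbr u v s t) (v * v * (t * t))"
    by (simp add: mult add minus bracket fr_def frbr_def)
qed

lemma one_poisson_frac: "\<one>\<^bsub>poisson_frac P\<^esub> = fr 1 1"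
  by (simp add: poisson_frac_def fr_def one)

lemma frac_closed:
  assumes "x \<in> carrier (poisson_frac P)" "y \<in> carrier (poisson_frac P)"
  shows "x \<otimes>\<^bsub>poisson_frac P\<^esub> y \<in> carrier (poisson_frac P)"
    "x \<oplus>\<^bsub>poisson_frac P\<^esub> y \<in> carrier (poisson_frac P)"
    "s \<odot>\<^bsub>poisson_frac P\<^esub> x \<in> carrier (poisson_frac P)"
    "\<lbrace>x, y\<rbrace>\<^bsub>poisson_frac P\<^esub> \<in> carrier (poisson_frac P)"
    "\<one>\<^bsub>poisson_frac P\<^esub> \<in> carrier (poisson_frac P)"
proof -
  obtain u v where x: "x = fr u v" "\<not> g dvd v"
    using assms by (auto simp: carrier_poisson_frac)
  obtain r t where y: "y = fr r t" "\<not> g dvd t"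
    using assms by (auto simp: carrier_poisson_frac)
  show "x \<otimes>\<^bsub>poisson_frac P\<^esub> y \<in> carrier (poisson_frac P)"
    "x \<oplus>\<^bsub>poisson_frac P\<^esub> y \<in> carrier (poisson_frac P)"
    "s \<odot>\<^bsub>poisson_frac P\<^esub> x \<in> carrier (poisson_frac P)"
    "\<lbrace>x, y\<rbrace>\<^bsub>poisson_frac P\<^esub> \<in> carrier (poisson_frac P)"
    "\<one>\<^bsub>poisson_frac P\<^esub> \<in> carrier (poisson_frac P)"
    unfolding x(1) y(1) carrier_poisson_frac mult_fr[OF x(2) y(2)] add_fr[OF x(2) y(2)]
      smult_fr[OF x(2)] bracket_fr[OF x(2) y(2)] one_poisson_frac
    using x(2) y(2) proper not_dvd_mult by blast+
qed

end

section \<open>Isomorphisms of Poisson fraction fields\<close>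

lemma is_poisson_iso_refl: "P \<simeq>\<^sub>P P"
proof -
  have "id \<in> poisson_iso P P"
    by (auto simp: poisson_iso_def ring_iso_def ring_hom_def)
  then show ?thesis by (auto simp: is_poisson_iso_def)
qed

lemma is_poisson_iso_trans:
  assumes "P \<simeq>\<^sub>P Q" "Q \<simeq>\<^sub>P R"
  shows "P \<simeq>\<^sub>P R"
proof -
  obtain f h where fh: "f \<in> poisson_iso P Q" "h \<in> poisson_iso Q R"
    using assms by (auto simp: is_poisson_iso_def)
  have "f u \<in> carrier Q" if "u \<in> carrier P" for u
    using fh that by (auto simp: poisson_iso_def ring_iso_def ring_hom_def)
  then have "h \<circ> f \<in> poisson_iso P R"
    using fh ring_iso_set_trans[of f P Q h R] by (auto simp: poisson_iso_def)
  then show ?thesis by (auto simp: is_poisson_iso_def)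
qed

text \<open>The record \<open>R\<close> carries no axioms, so the closure that identifies the
  preimage of a product with the product of the preimages has to come from the fraction
  field.\<close>

lemma (in poisson_presentation) poisson_frac_iso_sym:
  assumes "poisson_frac P \<simeq>\<^sub>P R"
  shows "R \<simeq>\<^sub>P poisson_frac P"
proof -
  let ?F = "poisson_frac P"
  obtain f where f: "f \<in> poisson_iso ?F R"
    using assms by (auto simp: is_poisson_iso_def)
  then have bij: "bij_betw f (carrier ?F) (carrier R)" and hom: "f \<in> ring_hom ?F R"
    by (auto simp: poisson_iso_def ring_iso_def)
  define h where "h = inv_into (carrier ?F) f"
  have h: "h y \<in> carrier ?F" "f (h y) = y" if "y \<in> carrier R" for y
    using bij that unfolding h_def
    by (auto simp: bij_betw_def inv_into_into f_inv_into_f)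
  have hI: "h y = x" if "f x = y" "x \<in> carrier ?F" for x y
    using that bij unfolding h_def by (auto simp: bij_betw_def inv_into_f_f)
  have "h \<in> ring_hom R ?F"
  proof (rule ring_hom_memI)
    show "h x \<in> carrier ?F" if "x \<in> carrier R" for x
      using h that by blast
    show "h (x \<otimes>\<^bsub>R\<^esub> y) = h x \<otimes>\<^bsub>?F\<^esub> h y" if "x \<in> carrier R" "y \<in> carrier R" for x y
      using h[OF that(1)] h[OF that(2)] hom by (intro hI frac_closed) (simp_all add: ring_hom_mult)
    show "h (x \<oplus>\<^bsub>R\<^esub> y) = h x \<oplus>\<^bsub>?F\<^esub> h y" if "x \<in> carrier R" "y \<in> carrier R" for x y
      using h[OF that(1)] h[OF that(2)] hom by (intro hI frac_closed) (simp_all add: ring_hom_add)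
    show "h \<one>\<^bsub>R\<^esub> = \<one>\<^bsub>?F\<^esub>"
      using hom proper by (intro hI ring_hom_one) (auto simp: one_poisson_frac carrier_poisson_frac)
  qed
  moreover have "bij_betw h (carrier R) (carrier ?F)"
    unfolding h_def by (rule bij_betw_inv_into[OF bij])
  moreover have "h (s \<odot>\<^bsub>R\<^esub> u) = s \<odot>\<^bsub>?F\<^esub> h u" if "u \<in> carrier R" for s u
    using f h[OF that] by (intro hI frac_closed[of _ "h u"]) (simp_all add: poisson_iso_def)
  moreover have "h \<lbrace>u, v\<rbrace>\<^bsub>R\<^esub> = \<lbrace>h u, h v\<rbrace>\<^bsub>?F\<^esub>" if "u \<in> carrier R" "v \<in> carrier R" for u v
    using f h[OF that(1)] h[OF that(2)]
    by (intro hI frac_closed) (simp_all add: poisson_iso_def)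
  ultimately have "h \<in> poisson_iso R ?F"
    by (auto simp: poisson_iso_def ring_iso_def)
  then show ?thesis by (auto simp: is_poisson_iso_def)
qed

text \<open>Compatibility with the brackets is asked only modulo \<open>g'\<close>, which is all
  that a substitution into a surface satisfies. \<open>h_kernel\<close> makes the induced map on
  fractions well defined and injective; \<open>h_dominant\<close>, by which every target element is
  a fraction of images, makes it surjective.\<close>

locale poisson_embedding =
  A: poisson_presentation P \<pi> g br cc + B: poisson_presentation P' \<pi>' g' br' cc'
  for P :: "('k::field, 'a, 'm) poisson_scheme" and \<pi> :: "'b::comm_ring_1 \<Rightarrow> 'a" and g br cc
    and P' :: "('k, 'c, 'n) poisson_scheme" and \<pi>' :: "'d::comm_ring_1 \<Rightarrow> 'c" and g' br' cc' +
  fixes h :: "'b \<Rightarrow> 'd"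
  assumes h_add: "h (u + v) = h u + h v"
    and h_mult: "h (u * v) = h u * h v"
    and h_cc: "h (cc s) = cc' s"
    and h_br: "g' dvd br' (h u) (h v) - h (br u v)"
    and h_kernel: "g' dvd h u \<longleftrightarrow> g dvd u"
    and h_dominant: "\<exists>p q. \<not> g' dvd h q \<and> g' dvd b * h q - h p"
begin

lemma h_one: "h 1 = 1"
  using h_cc[of 1] by (simp add: A.cc_one B.cc_one)

lemma h_uminus: "h (- u) = - h u"
  using h_add[of u "- u"] h_add[of 0 0] by (simp add: eq_neg_iff_add_eq_0 add.commute)

lemma h_diff: "h (u - v) = h u - h v"
  using h_add[of u "- v"] by (simp add: h_uminus)

lemma h_dvd_diff: "g' dvd h u * h v - h s * h t \<longleftrightarrow> g dvd u * v - s * t"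
  by (metis h_diff h_kernel h_mult)

lemma fr_h_eq_iff:
  "\<not> g dvd v \<Longrightarrow> \<not> g dvd t \<Longrightarrow> B.fr (h u) (h v) = B.fr (h s) (h t) \<longleftrightarrow> A.fr u v = A.fr s t"
  by (simp add: A.fr_eq_iff B.fr_eq_iff h_kernel h_dvd_diff)

definition fmap :: "('a \<times> 'a) set \<Rightarrow> ('c \<times> 'c) set" where
  "fmap U = (SOME W. \<exists>u v. \<not> g dvd v \<and> U = A.fr u v \<and> W = B.fr (h u) (h v))"

lemma fmap_fr: "\<not> g dvd v \<Longrightarrow> fmap (A.fr u v) = B.fr (h u) (h v)"
  unfolding fmap_def
  by (rule some_equality) (blast, metis fr_h_eq_iff)

lemma frbr_h:
  "\<not> g dvd v \<Longrightarrow> \<not> g dvd t \<Longrightarrow>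
    B.fr (h (A.frbr u v s t)) (h (v * v * (t * t))) =
    B.fr (B.frbr (h u) (h v) (h s) (h t)) (h v * h v * (h t * h t))"
proof -
  assume *: "\<not> g dvd v" "\<not> g dvd t"
  have "g' dvd h v * h t * (br' (h u) (h s) - h (br u s)) - h v * h s * (br' (h u) (h t) - h (br u t))
      - h u * h t * (br' (h v) (h s) - h (br v s)) + h u * h s * (br' (h v) (h t) - h (br v t))"
    by (intro dvd_add dvd_diff dvd_mult h_br)
  also have "\<dots> = B.frbr (h u) (h v) (h s) (h t) - h (A.frbr u v s t)"
    by (simp add: A.frbr_def B.frbr_def h_add h_mult h_diff algebra_simps)
  finally have d: "g' dvd B.frbr (h u) (h v) (h s) (h t) - h (A.frbr u v s t)" .
  show ?thesis
    unfolding h_mult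
    by (rule B.fr_eqI[where a = "- (h v * h v * (h t * h t))" and b = 0, OF _ _ _ d d])
      (use * in \<open>auto simp: algebra_simps h_kernel dest!: B.prime\<close>)
qed

theorem poisson_frac_iso: "poisson_frac P \<simeq>\<^sub>P poisson_frac P'"
proof -
  have "bij_betw fmap (carrier (poisson_frac P)) (carrier (poisson_frac P'))"
    unfolding bij_betw_def
  proof
    show "inj_on fmap (carrier (poisson_frac P))"
      unfolding inj_on_def A.carrier_poisson_frac using fmap_fr fr_h_eq_iff by fastforce
    show "fmap ` carrier (poisson_frac P) = carrier (poisson_frac P')"
    proof
      show "fmap ` carrier (poisson_frac P) \<subseteq> carrier (poisson_frac P')"
        unfolding A.carrier_poisson_frac B.carrier_poisson_frac using fmap_fr h_kernel by blast
      show "carrier (poisson_frac P') \<subseteq> fmap ` carrier (poisson_frac P)"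
      proof
        fix x assume "x \<in> carrier (poisson_frac P')"
        then obtain b c where x: "x = B.fr b c" "\<not> g' dvd c"
          by (auto simp: B.carrier_poisson_frac)
        \<comment> \<open>If b = h(p)/h(q) and c = h(p')/h(q'), then b/c is the image of pq'/(p'q);
          h(p') is nonzero since c is.\<close>
        obtain p q p' q' where *: "\<not> g' dvd h q" "g' dvd b * h q - h p"
          "\<not> g' dvd h q'" "g' dvd c * h q' - h p'"
          using h_dominant by metis
        have p': "\<not> g' dvd h p'"
        proof
          assume "g' dvd h p'"
          then have "g' dvd c * h q'" using * by (metis diff_add_cancel dvd_add)
          then show False using B.not_dvd_mult x * by blast
        qed
        have "x = fmap (A.fr (p * q') (p' * q))"
          unfolding x(1)
        proof (subst fmap_fr)
          show "\<not> g dvd p' * q"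
            using p' * by (metis B.not_dvd_mult h_kernel h_mult)
          show "B.fr b c = B.fr (h (p * q')) (h (p' * q))"
            unfolding h_mult
            by (rule B.fr_eqI[where a = "h p'" and b = "- (h p)", OF _ _ _ *(2,4)])
              (use p' * x in \<open>auto simp: algebra_simps dest!: B.prime\<close>)
        qed
        moreover have "A.fr (p * q') (p' * q) \<in> carrier (poisson_frac P)"
          using p' * unfolding A.carrier_poisson_frac
          by (auto simp: h_kernel intro!: exI dest!: A.prime)
        ultimately show "x \<in> fmap ` carrier (poisson_frac P)" by blast
      qed
    qed
  qed
  moreover have "fmap \<in> ring_hom (poisson_frac P) (poisson_frac P')"
    using A.proper
    by (intro ring_hom_memI; unfold A.carrier_poisson_frac A.one_poisson_frac B.one_poisson_frac)
      (clarsimp simp: fmap_fr h_kernel A.mult_fr A.add_fr B.mult_fr B.add_fr A.not_dvd_mult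
        h_mult h_add h_one | use B.carrier_poisson_frac h_kernel in blast)+
  moreover have "fmap (s \<odot>\<^bsub>poisson_frac P\<^esub> u) = s \<odot>\<^bsub>poisson_frac P'\<^esub> fmap u"
    if "u \<in> carrier (poisson_frac P)" for s u
    using that by (auto simp: A.carrier_poisson_frac fmap_fr A.smult_fr B.smult_fr h_kernel h_mult h_cc)
  moreover have "fmap \<lbrace>u, v\<rbrace>\<^bsub>poisson_frac P\<^esub> = \<lbrace>fmap u, fmap v\<rbrace>\<^bsub>poisson_frac P'\<^esub>"
    if "u \<in> carrier (poisson_frac P)" "v \<in> carrier (poisson_frac P)" for u v
    using that by (auto simp: A.carrier_poisson_frac fmap_fr A.bracket_fr B.bracket_fr h_kernel
        A.not_dvd_mult frbr_h)
  ultimately have "fmap \<in> poisson_iso (poisson_frac P) (poisson_frac P')"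
    by (auto simp: poisson_iso_def ring_iso_def)
  then show ?thesis by (auto simp: is_poisson_iso_def)
qed

end

section \<open>Substitution homomorphisms\<close>

definition ring_map :: "('a::comm_ring_1 \<Rightarrow> 'b::comm_ring_1) \<Rightarrow> bool" where
  "ring_map f \<longleftrightarrow> (\<forall>u v. f (u + v) = f u + f v) \<and> (\<forall>u v. f (u * v) = f u * f v) \<and> f 1 = 1"

lemma ring_map_add: "ring_map f \<Longrightarrow> f (u + v) = f u + f v"
  and ring_map_mult: "ring_map f \<Longrightarrow> f (u * v) = f u * f v"
  and ring_map_one: "ring_map f \<Longrightarrow> f 1 = 1"
  by (auto simp: ring_map_def)

lemma ring_map_zero: "ring_map f \<Longrightarrow> f 0 = 0"
  using ring_map_add[of f 0 0] by simp

lemma ring_map_uminus: "ring_map f \<Longrightarrow> f (- u) = - f u"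
  using ring_map_add[of f "- u" u] by (simp add: ring_map_zero eq_neg_iff_add_eq_0)

lemma ring_map_diff: "ring_map f \<Longrightarrow> f (u - v) = f u - f v"
  using ring_map_add[of f u "- v"] by (simp add: ring_map_uminus)

lemma ring_map_power: "ring_map f \<Longrightarrow> f (u ^ n) = f u ^ n"
  by (induction n) (simp_all add: ring_map_one ring_map_mult)

lemma ring_map_of_nat: "ring_map f \<Longrightarrow> f (of_nat n) = of_nat n"
  by (induction n) (simp_all add: ring_map_one ring_map_add ring_map_zero)

lemma ring_map_numeral: "ring_map f \<Longrightarrow> f (numeral n) = numeral n"
  using ring_map_of_nat[of f "numeral n"] by simp

lemma ring_map_dvd: "ring_map f \<Longrightarrow> u dvd v \<Longrightarrow> f u dvd f v"
  by (auto simp: ring_map_mult elim!: dvdE)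

lemmas ring_map_simps = ring_map_add ring_map_mult ring_map_one ring_map_zero ring_map_uminus
  ring_map_diff ring_map_power ring_map_of_nat ring_map_numeral

lemma ring_map_comp: "ring_map f \<Longrightarrow> ring_map h \<Longrightarrow> ring_map (\<lambda>u. h (f u))"
  by (simp add: ring_map_def)

lemma ring_map_id: "ring_map (\<lambda>u. u)"
  by (simp add: ring_map_def)

definition subst_hom :: "('a::comm_ring_1 \<Rightarrow> 'b::comm_ring_1) \<Rightarrow> 'b \<Rightarrow> 'a poly \<Rightarrow> 'b" where
  "subst_hom f p u = poly (map_poly f u) p"

lemma map_poly_add': "ring_map f \<Longrightarrow> map_poly f (u + v) = map_poly f u + map_poly f v"
  by (rule poly_eqI) (simp add: coeff_map_poly ring_map_simps)

lemma map_poly_smult': "ring_map f \<Longrightarrow> map_poly f (Polynomial.smult a u) = Polynomial.smult (f a) (map_poly f u)"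
  by (rule poly_eqI) (simp add: coeff_map_poly ring_map_simps)

lemma map_poly_pCons': "ring_map f \<Longrightarrow> map_poly f (pCons a u) = pCons (f a) (map_poly f u)"
  by (rule poly_eqI) (simp add: coeff_map_poly ring_map_simps coeff_pCons split: nat.splits)

lemma map_poly_mult': "ring_map f \<Longrightarrow> map_poly f (u * v) = map_poly f u * map_poly f v"
  by (induction u) (simp_all add: map_poly_add' map_poly_smult' map_poly_pCons' ring_map_zero)

lemma ring_map_map_poly: "ring_map f \<Longrightarrow> ring_map (map_poly f)"
  unfolding ring_map_def[of "map_poly f"]
  by (simp add: map_poly_add' map_poly_mult' one_pCons map_poly_pCons' ring_map_one)

lemma ring_map_subst_hom: "ring_map f \<Longrightarrow> ring_map (subst_hom f p)"
  using ring_map_map_poly[of f] by (simp add: ring_map_def subst_hom_def)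

lemma subst_hom_pCons: "ring_map f \<Longrightarrow> subst_hom f p (pCons a u) = f a + p * subst_hom f p u"
  by (simp add: subst_hom_def map_poly_pCons')

definition ev2 :: "('k::field \<Rightarrow> 'b::comm_ring_1) \<Rightarrow> 'b \<Rightarrow> 'b \<Rightarrow> 'k poly poly \<Rightarrow> 'b" where
  "ev2 c p q = subst_hom (subst_hom c p) q"

definition ev3 :: "('k::field \<Rightarrow> 'b::comm_ring_1) \<Rightarrow> 'b \<Rightarrow> 'b \<Rightarrow> 'b \<Rightarrow> 'k poly3 \<Rightarrow> 'b" where
  "ev3 c p q r = subst_hom (ev2 c p q) r"

text \<open>Opaque names keep the simplifier from multiplying out the iterated coefficient lists.\<close>

definition cst :: "'k::field \<Rightarrow> 'k poly3" where "cst r = Const r"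
definition vx :: "'k::field poly3" where "vx = [:[:[:0, 1:]:]:]"
definition vy :: "'k::field poly3" where "vy = [:[:0, 1:]:]"
definition vz :: "'k::field poly3" where "vz = [:0, 1:]"
definition pcst :: "'k::field \<Rightarrow> 'k poly poly" where "pcst r = [:[:r:]:]"
definition px :: "'k::field poly poly" where "px = [:[:0, 1:]:]"
definition py :: "'k::field poly poly" where "py = [:0, 1:]"

lemma ring_map_cst: "ring_map cst"
  by (simp add: ring_map_def cst_def one_pCons)

lemma ring_map_pcst: "ring_map pcst"
  by (simp add: ring_map_def pcst_def one_pCons)

lemmas cst_simps = ring_map_simps[OF ring_map_cst]
lemmas pcst_simps = ring_map_simps[OF ring_map_pcst]

lemma ring_map_ev2: "ring_map c \<Longrightarrow> ring_map (ev2 c p q)"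
  by (simp add: ev2_def ring_map_subst_hom)

lemma ring_map_ev3: "ring_map c \<Longrightarrow> ring_map (ev3 c p q r)"
  by (simp add: ev3_def ring_map_subst_hom ring_map_ev2)

lemma ev2_gens:
  assumes "ring_map c"
  shows "ev2 c p q (pcst s) = c s" "ev2 c p q px = p" "ev2 c p q py = q"
  using assms
  by (simp_all add: ev2_def pcst_def px_def py_def subst_hom_pCons ring_map_subst_hom ring_map_simps
      ring_map_zero[OF ring_map_subst_hom] ring_map_one[OF ring_map_subst_hom])

lemma ev3_pCons: "ring_map c \<Longrightarrow> ev3 c p q r (pCons a u) = ev2 c p q a + r * ev3 c p q r u"
  by (simp add: ev3_def subst_hom_pCons ring_map_ev2)

lemma ev3_const: "ring_map c \<Longrightarrow> ev3 c p q r [:a:] = ev2 c p q a"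
  by (simp add: ev3_pCons ring_map_zero[OF ring_map_ev3])

lemma ev3_gens:
  assumes "ring_map c"
  shows "ev3 c p q r (cst s) = c s" "ev3 c p q r vx = p" "ev3 c p q r vy = q" "ev3 c p q r vz = r"
proof -
  have "cst s = [:pcst s:]" "vx = [:px:]" "vy = [:py:]"
    by (simp_all add: cst_def pcst_def vx_def px_def vy_def py_def)
  then show "ev3 c p q r (cst s) = c s" "ev3 c p q r vx = p" "ev3 c p q r vy = q"
    using ev3_const[OF assms] ev2_gens[OF assms] by metis+
  show "ev3 c p q r vz = r"
    using assms by (simp add: vz_def ev3_pCons ring_map_simps[OF ring_map_ev2]
      ring_map_simps[OF ring_map_ev3])
qed

lemmas ev3_simps = ring_map_simps[OF ring_map_ev3] ev3_gens
lemmas ev2_simps = ring_map_simps[OF ring_map_ev2] ev2_gens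

lemma poly2_induct [case_names const x y add mult]:
  assumes c: "\<And>s. Q (pcst s)" and x: "Q px" and y: "Q py"
    and a: "\<And>u v. Q u \<Longrightarrow> Q v \<Longrightarrow> Q (u + v)" and m: "\<And>u v. Q u \<Longrightarrow> Q v \<Longrightarrow> Q (u * v)"
  shows "Q f"
proof -
  have 1: "Q [:u:]" for u
  proof (induction u)
    case 0
    then show ?case using c[of 0] by (simp add: pcst_def)
  next
    case (pCons s u)
    have "[:pCons s u:] = pcst s + px * [:u:]" by (simp add: pcst_def px_def)
    then show ?case using pCons a m c x by metis
  qed
  show ?thesis
  proof (induction f)
    case 0
    then show ?case using 1[of 0] by simp
  next
    case (pCons s u)
    have "pCons s u = [:s:] + py * u" by (simp add: py_def)
    then show ?case using pCons a m 1 y by metis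
  qed
qed

lemma poly3_induct [case_names const x y z add mult]:
  assumes c: "\<And>s. Q (cst s)" and x: "Q vx" and y: "Q vy" and z: "Q vz"
    and a: "\<And>u v. Q u \<Longrightarrow> Q v \<Longrightarrow> Q (u + v)" and m: "\<And>u v. Q u \<Longrightarrow> Q v \<Longrightarrow> Q (u * v)"
  shows "Q f"
proof -
  have 1: "Q [:u:]" for u
  proof (induction u rule: poly2_induct)
    case (const s)
    then show ?case using c[of s] by (simp add: pcst_def cst_def)
  next
    case x
    then show ?case using assms(2) by (simp add: px_def vx_def)
  next
    case y
    then show ?case using assms(3) by (simp add: py_def vy_def)
  next
    case (add u v)
    then show ?case using a[of "[:u:]" "[:v:]"] by simp
  next
    case (mult u v)
    then show ?case using m[of "[:u:]" "[:v:]"] by (simp add: mult.commute)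
  qed
  show ?thesis
  proof (induction f)
    case 0
    then show ?case using 1[of 0] by simp
  next
    case (pCons s u)
    have "pCons s u = [:s:] + vz * u" by (simp add: vz_def)
    then show ?case using pCons a m 1 z by metis
  qed
qed

lemma ring_map_eq3:
  assumes "ring_map f" "ring_map h" "\<And>s. f (cst s) = h (cst s)" "f vx = h vx" "f vy = h vy" "f vz = h vz"
  shows "f u = h u"
  by (induction u rule: poly3_induct) (simp_all add: assms ring_map_simps)

lemma ev3_comp:
  assumes "ring_map c" "ring_map h" "\<And>s. h (c s) = d s"
  shows "h (ev3 c p q r u) = ev3 d (h p) (h q) (h r) u"
proof -
  have d: "ring_map d"
    using assms by (auto simp: ring_map_def simp flip: assms(3))
  show ?thesis
    by (rule ring_map_eq3[OF ring_map_comp[OF ring_map_ev3 assms(2)] ring_map_ev3])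
      (simp_all add: assms d ev3_gens)
qed

lemma ev3_id: "ev3 cst vx vy vz u = u"
  by (rule ring_map_eq3) (simp_all add: ring_map_ev3 ring_map_cst ring_map_id ev3_gens)

lemma eval3_eq: "eval3 f u v w = ev3 (\<lambda>s. s) u v w f"
proof (rule ring_map_eq3[where f = "\<lambda>f. eval3 f u v w"])
  show "ring_map (\<lambda>f. eval3 f u v w)"
    by (simp add: ring_map_def eval3_def)
qed (unfold ev3_gens[OF ring_map_id], simp_all add: ring_map_ev3 ring_map_id eval3_def cst_def vx_def vy_def vz_def)


section \<open>Irreducible polynomials are prime\<close>

text \<open>
  The library's instance of unique factorization for polynomials asks for normalization and gcd
  operations on the coefficients, which a field need not carry; a copy of the field gets trivial ones.
\<close>

typedef (overloaded) 'k scalar = "UNIV :: 'k::field set"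
  morphisms of_scalar to_scalar by simp

lemmas scalar_simps = to_scalar_inverse[OF UNIV_I] of_scalar_inverse of_scalar_inject

instantiation scalar :: (field) field
begin
definition "0 = to_scalar 0"
definition "1 = to_scalar 1"
definition "u + v = to_scalar (of_scalar u + of_scalar v)"
definition "u - v = to_scalar (of_scalar u - of_scalar v)"
definition "- u = to_scalar (- of_scalar u)"
definition "u * v = to_scalar (of_scalar u * of_scalar v)"
definition inverse_scalar :: "'a scalar \<Rightarrow> 'a scalar" where
  "inverse_scalar u = to_scalar (inverse (of_scalar u))"
definition divide_scalar :: "'a scalar \<Rightarrow> 'a scalar \<Rightarrow> 'a scalar" where
  "divide_scalar u v = to_scalar (of_scalar u / of_scalar v)"
instance
  by standard
    (simp_all add: zero_scalar_def one_scalar_def plus_scalar_def minus_scalar_def uminus_scalar_def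
      times_scalar_def inverse_scalar_def divide_scalar_def scalar_simps field_simps
      flip: of_scalar_inject)
end

instantiation scalar :: (field)
  "{unique_euclidean_ring, normalization_euclidean_semiring, normalization_semidom_multiplicative}"
begin
definition [simp]: "normalize_scalar = (normalize_field :: 'a scalar \<Rightarrow> _)"
definition [simp]: "unit_factor_scalar = (unit_factor_field :: 'a scalar \<Rightarrow> _)"
definition [simp]: "modulo_scalar = (mod_field :: 'a scalar \<Rightarrow> _)"
definition [simp]: "euclidean_size_scalar = (euclidean_size_field :: 'a scalar \<Rightarrow> _)"
definition [simp]: "division_segment (x :: 'a scalar) = 1"
instance
  by standard
    (simp_all add: dvd_field_iff field_split_simps split: if_splits)
end

instantiation scalar :: (field) euclidean_ring_gcd
begin
definition gcd_scalar :: "'a scalar \<Rightarrow> 'a scalar \<Rightarrow> 'a scalar" where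
  "gcd_scalar = Euclidean_Algorithm.gcd"
definition lcm_scalar :: "'a scalar \<Rightarrow> 'a scalar \<Rightarrow> 'a scalar" where
  "lcm_scalar = Euclidean_Algorithm.lcm"
definition Gcd_scalar :: "'a scalar set \<Rightarrow> 'a scalar" where
  "Gcd_scalar = Euclidean_Algorithm.Gcd"
definition Lcm_scalar :: "'a scalar set \<Rightarrow> 'a scalar" where
  "Lcm_scalar = Euclidean_Algorithm.Lcm"
instance
  by standard (simp_all add: gcd_scalar_def lcm_scalar_def Gcd_scalar_def Lcm_scalar_def)
end

instance scalar :: (field) semiring_gcd_mult_normalize ..

lemma map_poly_inverse:
  assumes "ring_map f" "ring_map h" "\<And>u. h (f u) = u"
  shows "map_poly h (map_poly f p) = p"
  by (rule poly_eqI) (simp add: coeff_map_poly assms ring_map_simps)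

lemma irreducible_ring_iso:
  assumes "ring_map f" "ring_map h" "\<And>u. h (f u) = u" "\<And>u. f (h u) = u" "irreducible p"
  shows "irreducible (f p)"
proof (rule irreducibleI)
  have unit: "u dvd 1 \<Longrightarrow> f u dvd 1" for u
    using ring_map_dvd[OF assms(1), of u 1] by (simp add: ring_map_one assms)
  show "f p \<noteq> 0"
    using assms by (metis irreducible_def ring_map_zero)
  show "\<not> f p dvd 1"
    using assms ring_map_dvd[OF assms(2), of "f p" 1] by (auto simp: ring_map_one irreducible_def)
  fix a b assume "f p = a * b"
  then have "p = h a * h b" using assms by (metis ring_map_mult)
  then have "h a dvd 1 \<or> h b dvd 1" using assms by (auto simp: irreducible_def)
  then show "a dvd 1 \<or> b dvd 1" using unit assms by metis
qed

lemma prime_elem_ring_iso: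
  assumes "ring_map f" "ring_map h" "\<And>u. h (f u) = u" "\<And>u. f (h u) = u" "prime_elem p"
  shows "prime_elem (f p)"
proof -
  have dvd: "f p dvd u \<longleftrightarrow> p dvd h u" for u
    using ring_map_dvd[OF assms(1), of p "h u"] ring_map_dvd[OF assms(2), of "f p" u] assms by auto
  have "f p \<noteq> 0" using assms by (metis prime_elem_def ring_map_zero)
  then show ?thesis
    using assms(5) by (auto simp: prime_elem_def dvd ring_map_simps[OF assms(2)])
qed

lemma irreducible_imp_prime_poly3:
  fixes p :: "'k::field poly3"
  assumes "irreducible p"
  shows "prime_elem p"
proof -
  define f :: "'k \<Rightarrow> 'k scalar" where "f = to_scalar"
  define h :: "'k scalar \<Rightarrow> 'k" where "h = of_scalar"
  have hf: "h (f u) = u" "f (h v) = v" for u v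
    by (simp_all add: f_def h_def scalar_simps)
  have f: "ring_map f"
    by (simp add: ring_map_def f_def plus_scalar_def times_scalar_def one_scalar_def scalar_simps)
  have h: "ring_map h"
    by (simp add: ring_map_def h_def plus_scalar_def times_scalar_def one_scalar_def scalar_simps)
  let ?f = "map_poly (map_poly (map_poly f))" and ?h = "map_poly (map_poly (map_poly h))"
  have F: "ring_map ?f" "ring_map ?h"
    by (intro ring_map_map_poly f h)+
  have HF: "?h (?f u) = u" "?f (?h v) = v" for u v
    by (rule map_poly_inverse | rule ring_map_map_poly | rule f h hf)+
  have "irreducible (?f p)"
    using irreducible_ring_iso[OF F HF assms] .
  then have "prime_elem (?f p)"
    by (rule irreducible_imp_prime_elem)
  from prime_elem_ring_iso[OF F(2,1) HF(2,1) this] show ?thesis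
    by (simp only: HF)
qed


section \<open>Derivations and the Jacobian bracket\<close>

definition is_deriv :: "('a::comm_ring_1 \<Rightarrow> 'a) \<Rightarrow> bool" where
  "is_deriv d \<longleftrightarrow> (\<forall>u v. d (u + v) = d u + d v) \<and> (\<forall>u v. d (u * v) = u * d v + v * d u)"

lemma is_deriv_add: "is_deriv d \<Longrightarrow> d (u + v) = d u + d v"
  and is_deriv_mult: "is_deriv d \<Longrightarrow> d (u * v) = u * d v + v * d u"
  by (auto simp: is_deriv_def)

lemma is_deriv_zero: "is_deriv d \<Longrightarrow> d 0 = 0"
  using is_deriv_add[of d 0 0] by simp

lemma is_deriv_one: "is_deriv d \<Longrightarrow> d 1 = 0"
  using is_deriv_mult[of d 1 1] by simp

lemma is_deriv_uminus: "is_deriv d \<Longrightarrow> d (- u) = - d u"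
  using is_deriv_add[of d "- u" u] by (simp add: is_deriv_zero eq_neg_iff_add_eq_0)

lemma is_deriv_diff: "is_deriv d \<Longrightarrow> d (u - v) = d u - d v"
  using is_deriv_add[of d u "- v"] by (simp add: is_deriv_uminus)

lemma is_deriv_power: "is_deriv d \<Longrightarrow> d (u ^ n) = of_nat n * u ^ (n - 1) * d u"
proof (induction n)
  case (Suc n)
  have "d (u ^ Suc n) = u * d (u ^ n) + u ^ n * d u"
    using Suc.prems by (simp add: is_deriv_mult)
  also have "u * d (u ^ n) = of_nat n * u ^ n * d u"
    using Suc by (cases n) (simp_all add: is_deriv_one mult_ac)
  finally show ?case by (simp add: algebra_simps)
qed (simp add: is_deriv_one)

lemma is_deriv_of_nat: "is_deriv d \<Longrightarrow> d (of_nat n) = 0"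
  by (induction n) (simp_all add: is_deriv_zero is_deriv_add is_deriv_one)

lemma is_deriv_numeral: "is_deriv d \<Longrightarrow> d (numeral n) = 0"
  using is_deriv_of_nat[of d "numeral n"] by simp

lemmas is_deriv_simps = is_deriv_add is_deriv_mult is_deriv_zero is_deriv_one is_deriv_uminus
  is_deriv_diff is_deriv_power is_deriv_of_nat is_deriv_numeral

lemma is_deriv_pderiv: "is_deriv (pderiv :: 'a::idom poly \<Rightarrow> _)"
  by (simp add: is_deriv_def pderiv_add pderiv_mult)

lemma is_deriv_map_poly:
  assumes "is_deriv d"
  shows "is_deriv (map_poly d)"
proof -
  have coeff: "coeff (map_poly d u) n = d (coeff u n)" for u n
    using assms by (simp add: coeff_map_poly is_deriv_zero)
  have add: "map_poly d (u + v) = map_poly d u + map_poly d v" for u v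
    using assms by (intro poly_eqI) (simp add: coeff is_deriv_add)
  have smult: "map_poly d (Polynomial.smult a u) = Polynomial.smult a (map_poly d u) + Polynomial.smult (d a) u" for a u
    using assms by (intro poly_eqI) (simp add: coeff is_deriv_mult mult.commute)
  have pC: "map_poly d (pCons a u) = pCons (d a) (map_poly d u)" for a u
    by (rule poly_eqI) (simp add: coeff coeff_pCons split: nat.splits)
  have "map_poly d (u * v) = u * map_poly d v + v * map_poly d u" for u v
  proof (induction u)
    case (pCons a u)
    then show ?case
      using assms by (simp add: add smult pC is_deriv_zero algebra_simps)
  qed (use assms in \<open>simp add: map_poly_0\<close>)
  then show ?thesis by (simp add: is_deriv_def add)
qed

lemma is_deriv_partial: "is_deriv (dX :: 'k::field poly3 \<Rightarrow> _)" "is_deriv (dY :: 'k poly3 \<Rightarrow> _)"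
    "is_deriv (dZ :: 'k poly3 \<Rightarrow> _)"
  by (simp_all add: dX_def dY_def dZ_def is_deriv_pderiv is_deriv_map_poly)

definition pdx :: "'k::field poly poly \<Rightarrow> 'k poly poly" where "pdx = map_poly pderiv"
definition pdy :: "'k::field poly poly \<Rightarrow> 'k poly poly" where "pdy = pderiv"

lemma is_deriv_partial2: "is_deriv (pdx :: 'k::field poly poly \<Rightarrow> _)" "is_deriv (pdy :: 'k poly poly \<Rightarrow> _)"
  by (simp_all add: pdx_def pdy_def is_deriv_pderiv is_deriv_map_poly)

lemma partial_gens [simp]:
  "dX (cst s) = 0" "dX vx = 1" "dX vy = 0" "dX vz = 0"
  "dY (cst s) = 0" "dY vx = 0" "dY vy = 1" "dY vz = 0"
  "dZ (cst s) = 0" "dZ vx = 0" "dZ vy = 0" "dZ vz = 1"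
  by (simp_all add: dX_def dY_def dZ_def cst_def vx_def vy_def vz_def map_poly_pCons pderiv_pCons one_pCons)

lemma partial2_gens [simp]:
  "pdx (pcst s) = 0" "pdx px = 1" "pdx py = 0"
  "pdy (pcst s) = 0" "pdy px = 0" "pdy py = 1"
  by (simp_all add: pdx_def pdy_def pcst_def px_def py_def map_poly_pCons pderiv_pCons one_pCons)

lemmas partial_simps =
  is_deriv_simps[OF is_deriv_partial(1)] is_deriv_simps[OF is_deriv_partial(2)]
  is_deriv_simps[OF is_deriv_partial(3)]
lemmas partial2_simps = is_deriv_simps[OF is_deriv_partial2(1)] is_deriv_simps[OF is_deriv_partial2(2)]

definition jac :: "'k::field poly3 \<Rightarrow> 'k poly3 \<Rightarrow> 'k poly3 \<Rightarrow> 'k poly3" where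
  "jac f g h = dX f * (dY g * dZ h - dZ g * dY h) - dY f * (dX g * dZ h - dZ g * dX h)
     + dZ f * (dX g * dY h - dY g * dX h)"

text \<open>Both sides are derivations along the substitution, so agreement on generators suffices.
  The derivation \<open>d\<close> is kept arbitrary because it stands for a partial derivative as
  well as for a bracket with a fixed element.\<close>

lemma chain_rule:
  assumes d: "is_deriv d" and c: "ring_map c" "\<And>s. d (c s) = 0"
  shows "d (ev3 c p q r f) =
    ev3 c p q r (dX f) * d p + ev3 c p q r (dY f) * d q + ev3 c p q r (dZ f) * d r"
  by (induction f rule: poly3_induct)
    (simp_all add: ev3_simps c is_deriv_simps[OF d] partial_simps algebra_simps)

lemma chain_rule2:
  assumes d: "is_deriv d" and c: "ring_map c" "\<And>s. d (c s) = 0"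
  shows "d (ev2 c p q f) = ev2 c p q (pdx f) * d p + ev2 c p q (pdy f) * d q"
  by (induction f rule: poly2_induct)
    (simp_all add: ev2_simps c is_deriv_simps[OF d] partial2_simps algebra_simps)

text \<open>By the chain rule the gradient of the composite is a combination of the gradients of
  \<open>p\<close>, \<open>q\<close>, \<open>r\<close>; in the determinant two of the three terms
  have a repeated row.\<close>

lemma jac_ev3:
  "jac p q (ev3 cst p q r h) = ev3 cst p q r (dZ h) * jac p q r"
  "jac q r (ev3 cst p q r h) = ev3 cst p q r (dX h) * jac p q r"
  "jac r p (ev3 cst p q r h) = ev3 cst p q r (dY h) * jac p q r"
  unfolding jac_def chain_rule[OF is_deriv_partial(1) ring_map_cst partial_gens(1)]
    chain_rule[OF is_deriv_partial(2) ring_map_cst partial_gens(5)]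
    chain_rule[OF is_deriv_partial(3) ring_map_cst partial_gens(9)]
  by (simp_all add: algebra_simps)

lemma jac_rules:
  "jac (u + v) f h = jac u f h + jac v f h"
  "jac (u * v) f h = u * jac v f h + v * jac u f h"
  "jac u f h = - jac f u h"
  "jac f f h = 0" "jac (cst s) f h = 0" "jac h f h = 0"
  by (simp_all add: jac_def partial_simps algebra_simps)

lemma jac_vars: "jac vx vy f = dZ f" "jac vy vz f = dX f" "jac vz vx f = dY f"
  by (simp_all add: jac_def)

lemma jac_mult3: "jac f g (m * h) = m * jac f g h + h * jac f g m"
  by (simp add: jac_def partial_simps algebra_simps)


section \<open>Presentations of the surfaces and of the planes\<close>

definition coset :: "'a::comm_ring_1 \<Rightarrow> 'a \<Rightarrow> 'a set" where
  "coset m f = {h. m dvd h - f}"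

lemma coset_eq_iff: "coset m f = coset m g \<longleftrightarrow> m dvd f - g"
proof
  assume "coset m f = coset m g"
  moreover have "f \<in> coset m f" by (simp add: coset_def)
  ultimately show "m dvd f - g" by (auto simp: coset_def)
next
  assume *: "m dvd f - g"
  have "m dvd h - f \<longleftrightarrow> m dvd h - g" for h
    using dvd_add_right_iff[OF *, of "h - f"] by (simp add: algebra_simps)
  then show "coset m f = coset m g" by (auto simp: coset_def)
qed

lemma coset_PIdl: "(PIdl\<^bsub>poisson_A Om\<^esub> Om) +>\<^bsub>poisson_A Om\<^esub> f = coset Om f"
proof -
  have "(PIdl\<^bsub>poisson_A Om\<^esub> Om) +>\<^bsub>poisson_A Om\<^esub> f = {x * Om + f | x. True}"
    by (auto simp: cgenideal_def poisson_A_def a_r_coset_def')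
  also have "\<dots> = coset Om f"
    unfolding coset_def by (auto simp: dvd_def algebra_simps)
  finally show ?thesis .
qed

lemma UN_const2:
  assumes "A \<noteq> {}" "B \<noteq> {}" "\<And>a b. a \<in> A \<Longrightarrow> b \<in> B \<Longrightarrow> f a b = W"
  shows "(\<Union>a\<in>A. \<Union>b\<in>B. f a b) = W"
  using assms by (auto simp: ex_in_conv[symmetric])

lemma coset_nonempty: "coset m f \<noteq> {}"
  unfolding coset_def by (metis (mono_tags) diff_self dvd_0_right empty_iff mem_Collect_eq)

lemma presentation_surface:
  fixes Om :: "'k::field poly3"
  assumes "prime_elem Om"
  shows "poisson_presentation (poisson_P Om) (coset Om) Om (\<lambda>f g. jac f g Om) cst"
proof -
  let ?A = "poisson_A Om" and ?I = "PIdl\<^bsub>poisson_A Om\<^esub> Om"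
  \<comment> \<open>\<Omega> is a Casimir, since a Jacobian with \<Omega> twice vanishes. Changing a
    representative by a multiple of \<Omega> therefore changes the bracket by a multiple of
    \<Omega>.\<close>
  have jac_dvd: "Om dvd u - u' \<Longrightarrow> Om dvd v - v' \<Longrightarrow> Om dvd jac u v Om - jac u' v' Om" for u u' v v'
  proof -
    assume "Om dvd u - u'" "Om dvd v - v'"
    then obtain s t where "u = u' + Om * s" "v = v' + Om * t"
      by (metis add.commute diff_add_cancel dvdE)
    note uv = this
    have 1: "jac f (Om * t) Om = Om * jac f t Om" for f t
      using jac_rules(2)[of Om t f Om] jac_rules(3)[of f] by (simp add: jac_rules(6))
    have 2: "jac f (g + h) Om = jac f g Om + jac f h Om" for f g h
      using jac_rules(1)[of g h f Om] jac_rules(3)[of f] by simp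
    have "jac u v Om - jac u' v' Om = Om * (jac s v' Om + jac u' t Om + Om * jac s t Om)"
      by (simp only: uv jac_rules(1,2,6) 1 2) (simp add: distrib_left)
    then show "Om dvd jac u v Om - jac u' v' Om" by simp
  qed
  have carrier: "carrier (poisson_P Om) = range (coset Om)"
    by (auto simp: poisson_P_def poisson_quot_def FactRing_def A_RCOSETS_def' coset_PIdl)
      (auto simp: poisson_A_def)
  have add: "add (poisson_P Om) (coset Om u) (coset Om v) = coset Om (u + v)" for u v
  proof -
    have "add (poisson_P Om) (coset Om u) (coset Om v) = {a + b | a b. a \<in> coset Om u \<and> b \<in> coset Om v}"
      by (auto simp: poisson_P_def poisson_quot_def FactRing_def set_add_def' poisson_A_def)
    also have "\<dots> = coset Om (u + v)"
    proof (safe)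
      fix a b assume "a \<in> coset Om u" "b \<in> coset Om v"
      then show "a + b \<in> coset Om (u + v)"
        unfolding coset_def by (simp add: add_diff_add)
    next
      fix x assume "x \<in> coset Om (u + v)"
      then have "x - v \<in> coset Om u" "v \<in> coset Om v"
        by (simp_all add: coset_def algebra_simps)
      then show "\<exists>a b. x = a + b \<and> a \<in> coset Om u \<and> b \<in> coset Om v"
        by (metis diff_add_cancel)
    qed
    finally show ?thesis .
  qed
  have mult: "mult (poisson_P Om) (coset Om u) (coset Om v) = coset Om (u * v)" for u v
  proof -
    have "mult (poisson_P Om) (coset Om u) (coset Om v) =
      (\<Union>a\<in>coset Om u. \<Union>b\<in>coset Om v. coset Om (a * b))"
      unfolding poisson_P_def poisson_quot_def FactRing_def rcoset_mult_def coset_PIdl[symmetric]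
      by (simp add: poisson_A_def)
    also have "\<dots> = coset Om (u * v)"
    proof (rule UN_const2[OF coset_nonempty coset_nonempty])
      fix a b assume *: "a \<in> coset Om u" "b \<in> coset Om v"
      have "a * b - u * v = b * (a - u) + u * (b - v)" by (simp add: algebra_simps)
      then show "coset Om (a * b) = coset Om (u * v)"
        using * unfolding coset_eq_iff by (auto simp: coset_def)
    qed
    finally show ?thesis .
  qed
  have one: "one (poisson_P Om) = coset Om 1"
    unfolding poisson_P_def poisson_quot_def FactRing_def coset_PIdl[symmetric]
    by (simp add: poisson_A_def)
  have zero: "zero (poisson_P Om) = coset Om 0"
    unfolding poisson_P_def poisson_quot_def FactRing_def
    by (auto simp: poisson_A_def cgenideal_def coset_def dvd_def mult.commute)
  have smult: "smult (poisson_P Om) s (coset Om u) = coset Om (cst s * u)" for s u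
  proof -
    have "smult (poisson_P Om) s (coset Om u) = (\<Union>a\<in>coset Om u. coset Om (cst s * a))"
      unfolding poisson_P_def poisson_quot_def coset_PIdl[symmetric]
      by (simp add: poisson_A_def cst_def)
    also have "\<dots> = (\<Union>a\<in>coset Om u. \<Union>b\<in>{u}. coset Om (cst s * a))"
      by simp
    also have "\<dots> = coset Om (cst s * u)"
    proof (rule UN_const2[OF coset_nonempty])
      fix a assume "a \<in> coset Om u"
      then show "coset Om (cst s * a) = coset Om (cst s * u)"
        unfolding coset_eq_iff by (simp add: coset_def flip: right_diff_distrib)
    qed simp
    finally show ?thesis .
  qed
  have bracket: "bracket (poisson_P Om) (coset Om u) (coset Om v) = coset Om (jac u v Om)" for u v
  proof -
    have "bracket (poisson_P Om) (coset Om u) (coset Om v) =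
      (\<Union>a\<in>coset Om u. \<Union>b\<in>coset Om v. coset Om (jac a b Om))"
      unfolding poisson_P_def poisson_quot_def coset_PIdl[symmetric]
      by (simp add: poisson_A_def jac_def)
    also have "\<dots> = coset Om (jac u v Om)"
      by (rule UN_const2[OF coset_nonempty coset_nonempty])
        (unfold coset_eq_iff, simp add: jac_dvd coset_def)
    finally show ?thesis .
  qed
  show ?thesis
    apply (rule poisson_presentation.intro)
    apply (rule carrier)
    apply (rule add)
    apply (rule mult)
    apply (rule one)
    apply (rule zero)
    apply (rule smult)
    apply (rule bracket)
    apply (rule coset_eq_iff)
    subgoal using assms by (simp add: prime_elem_dvd_mult_iff)
    subgoal using assms by (simp add: prime_elem_not_unit)
    apply (simp_all only: cst_simps jac_rules(1,2,4,5,6) dvd_0_right)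
    apply (rule jac_rules(3))
    done
qed

definition pbr :: "'k::field poly poly \<Rightarrow> 'k poly poly \<Rightarrow> 'k poly poly \<Rightarrow> 'k poly poly" where
  "pbr h f g = h * (pdx f * pdy g - pdy f * pdx g)"

lemma poisson_plane_simps:
  "carrier (poisson_plane h) = UNIV" "mult (poisson_plane h) = (*)" "one (poisson_plane h) = 1"
  "zero (poisson_plane h) = 0" "add (poisson_plane h) = (+)"
  "smult (poisson_plane h) = (\<lambda>s u. pcst s * u)" "bracket (poisson_plane h) = pbr h"
  by (simp_all add: poisson_plane_def pbr_def pdx_def pdy_def pcst_def fun_eq_iff)

lemma pbr_rules:
  "pbr h (u + v) w = pbr h u w + pbr h v w"
  "pbr h (u * v) w = u * pbr h v w + v * pbr h u w"
  "pbr h u v = - pbr h v u"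
  "pbr h u u = 0" "pbr h (pcst s) u = 0" "pbr h 0 u = 0"
  by (simp_all add: pbr_def partial2_simps algebra_simps)

lemma presentation_plane:
  "poisson_presentation (poisson_plane h) (\<lambda>f. f) 0 (pbr h) pcst"
  by (rule poisson_presentation.intro)
    (simp_all add: poisson_plane_simps pcst_simps pbr_rules(1,2,4,5,6), rule pbr_rules(3))

section \<open>Birational polynomial maps\<close>

text \<open>This is the subfield generated by a subalgebra \<open>H\<close>, pulled back to
  representatives. That it contains every element is the surjectivity condition for an
  embedding.\<close>

definition fracs :: "'b::comm_ring_1 \<Rightarrow> 'b set \<Rightarrow> 'b set" where
  "fracs g H = {b. \<exists>p\<in>H. \<exists>q\<in>H. \<not> g dvd q \<and> g dvd b * q - p}"

locale poisson_subalgebra = poisson_presentation P proj g br cc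
  for P :: "('k::field, 'a, 'm) poisson_scheme" (structure)
    and proj :: "'b::comm_ring_1 \<Rightarrow> 'a" and g br cc +
  fixes H :: "'b set"
  assumes sub_cc: "cc s \<in> H"
    and sub_add: "u \<in> H \<Longrightarrow> v \<in> H \<Longrightarrow> u + v \<in> H"
    and sub_mult: "u \<in> H \<Longrightarrow> v \<in> H \<Longrightarrow> u * v \<in> H"
begin

lemma fracsI: "p \<in> H \<Longrightarrow> q \<in> H \<Longrightarrow> \<not> g dvd q \<Longrightarrow> b * q - p = s * d + t * e \<Longrightarrow>
    g dvd d \<Longrightarrow> g dvd e \<Longrightarrow> b \<in> fracs g H"
  unfolding fracs_def by force

lemma fracs_self: "b \<in> H \<Longrightarrow> b \<in> fracs g H"
  using sub_cc[of 1] proper by (intro fracsI[of b 1 b 0 0 0 0]) (simp_all add: cc_one)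

lemma fracs_cc: "cc s \<in> fracs g H"
  using fracs_self sub_cc by blast

lemma fracs_add: "b \<in> fracs g H \<Longrightarrow> c \<in> fracs g H \<Longrightarrow> b + c \<in> fracs g H"
proof -
  assume "b \<in> fracs g H" "c \<in> fracs g H"
  then obtain p q p' q' where *: "p \<in> H" "q \<in> H" "\<not> g dvd q" "g dvd b * q - p"
      "p' \<in> H" "q' \<in> H" "\<not> g dvd q'" "g dvd c * q' - p'"
    unfolding fracs_def by blast
  show ?thesis
    by (rule fracsI[of "p * q' + p' * q" "q * q'" _ q' "b * q - p" q "c * q' - p'"])
      (use * not_dvd_mult in \<open>auto intro: sub_add sub_mult simp: algebra_simps\<close>)
qed

lemma fracs_mult: "b \<in> fracs g H \<Longrightarrow> c \<in> fracs g H \<Longrightarrow> b * c \<in> fracs g H"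
proof -
  assume "b \<in> fracs g H" "c \<in> fracs g H"
  then obtain p q p' q' where *: "p \<in> H" "q \<in> H" "\<not> g dvd q" "g dvd b * q - p"
      "p' \<in> H" "q' \<in> H" "\<not> g dvd q'" "g dvd c * q' - p'"
    unfolding fracs_def by blast
  show ?thesis
    by (rule fracsI[of "p * p'" "q * q'" _ "c * q'" "b * q - p" p "c * q' - p'"])
      (use * not_dvd_mult in \<open>auto intro: sub_add sub_mult simp: algebra_simps\<close>)
qed

lemma fracs_uminus: "b \<in> fracs g H \<Longrightarrow> - b \<in> fracs g H"
proof -
  have "cc (- 1) = - 1"
    using cc_add[of "- 1" 1] by (simp add: cc_zero cc_one eq_neg_iff_add_eq_0)
  then show "b \<in> fracs g H \<Longrightarrow> - b \<in> fracs g H"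
    using fracs_mult[OF fracs_cc[of "- 1"], of b] by simp
qed

lemma fracs_diff: "b \<in> fracs g H \<Longrightarrow> c \<in> fracs g H \<Longrightarrow> b - c \<in> fracs g H"
  using fracs_add[of b "- c"] fracs_uminus by simp

lemma fracs_power: "b \<in> fracs g H \<Longrightarrow> b ^ n \<in> fracs g H"
  using fracs_cc[of 1] by (induction n) (simp_all add: cc_one fracs_mult)

lemma fracs_divide:
  assumes "d \<in> fracs g H" "e \<in> fracs g H" "\<not> g dvd d" "g dvd b * d - e"
  shows "b \<in> fracs g H"
proof -
  obtain p q p' q' where *: "p \<in> H" "q \<in> H" "\<not> g dvd q" "g dvd d * q - p"
      "p' \<in> H" "q' \<in> H" "\<not> g dvd q'" "g dvd e * q' - p'"
    using assms(1,2) unfolding fracs_def by blast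
  have p: "\<not> g dvd p"
  proof
    assume "g dvd p"
    then have "g dvd d * q" using *(4) by (metis diff_add_cancel dvd_add)
    then show False using prime assms * by blast
  qed
  have "g dvd q * q' * (b * d - e) + q * (e * q' - p')"
    using * assms by simp
  from fracsI[of "p' * q" "p * q'" b 1 _ "- (b * q')", OF _ _ _ _ this *(4)] show ?thesis
    using * p not_dvd_mult by (simp add: sub_mult algebra_simps)
qed

lemmas fracs_intros = fracs_cc fracs_add fracs_mult fracs_diff fracs_power

end

section \<open>Brackets and kernels of substitutions\<close>

context poisson_presentation
begin

lemma ring_map_cc: "ring_map cc"
  by (simp add: ring_map_def cc_add cc_mult cc_one)

lemma is_deriv_br: "is_deriv (\<lambda>u. br u w)"
  by (simp add: is_deriv_def br_add br_mult)

lemma subalgebra_range: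
  assumes "ring_map h" "\<And>s. h (c s) = cc s"
  shows "poisson_subalgebra P proj g br cc (range h)"
proof unfold_locales
  show "cc s \<in> range h" for s
    using assms(2)[of s] by (metis rangeI)
  show "u + v \<in> range h" "u * v \<in> range h" if "u \<in> range h" "v \<in> range h" for u v
    using that ring_map_add[OF assms(1)] ring_map_mult[OF assms(1)] by (auto simp: image_iff) metis+
qed

lemmas br_ev2 = chain_rule2[OF is_deriv_br ring_map_cc br_const]
lemmas br_ev3 = chain_rule[OF is_deriv_br ring_map_cc br_const]

lemma br_ev2_ev2: "br (ev2 cc p q f) (ev2 cc p q h) =
    (ev2 cc p q (pdx f) * ev2 cc p q (pdy h) - ev2 cc p q (pdy f) * ev2 cc p q (pdx h)) * br p q"
proof -
  have *: "br q p = - br p q" by (rule br_swap)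
  have "br p (ev2 cc p q h) = ev2 cc p q (pdy h) * br p q"
    "br q (ev2 cc p q h) = - ev2 cc p q (pdx h) * br p q"
    unfolding br_swap[of _ "ev2 cc p q h"] br_ev2 br_self * by simp_all
  then show ?thesis by (simp add: br_ev2 algebra_simps)
qed

lemma br_ev3_ev3: "br (ev3 cc p q r f) (ev3 cc p q r h) =
    (ev3 cc p q r (dX f) * ev3 cc p q r (dY h) - ev3 cc p q r (dY f) * ev3 cc p q r (dX h)) * br p q
  + (ev3 cc p q r (dY f) * ev3 cc p q r (dZ h) - ev3 cc p q r (dZ f) * ev3 cc p q r (dY h)) * br q r
  + (ev3 cc p q r (dZ f) * ev3 cc p q r (dX h) - ev3 cc p q r (dX f) * ev3 cc p q r (dZ h)) * br r p"
proof -
  have *: "br q p = - br p q" "br r q = - br q r" "br p r = - br r p"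
    by (rule br_swap)+
  have "br p (ev3 cc p q r h) = ev3 cc p q r (dY h) * br p q - ev3 cc p q r (dZ h) * br r p"
    "br q (ev3 cc p q r h) = ev3 cc p q r (dZ h) * br q r - ev3 cc p q r (dX h) * br p q"
    "br r (ev3 cc p q r h) = ev3 cc p q r (dX h) * br r p - ev3 cc p q r (dY h) * br q r"
    unfolding br_swap[of _ "ev3 cc p q r h"] br_ev3 br_self * by simp_all
  note A = this
  show ?thesis by (simp only: br_ev3 A) (simp add: algebra_simps)
qed

text \<open>A biderivation is determined by its values on the coordinates, so three congruences
  suffice for all pairs of polynomials.\<close>

lemma br_ev3_cong:
  assumes "g dvd br p q - ev3 cc p q r (dZ Om)" "g dvd br q r - ev3 cc p q r (dX Om)"
    "g dvd br r p - ev3 cc p q r (dY Om)"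
  shows "g dvd br (ev3 cc p q r f) (ev3 cc p q r h) - ev3 cc p q r (jac f h Om)"
proof -
  have "g dvd
    (ev3 cc p q r (dX f) * ev3 cc p q r (dY h) - ev3 cc p q r (dY f) * ev3 cc p q r (dX h))
      * (br p q - ev3 cc p q r (dZ Om))
  + (ev3 cc p q r (dY f) * ev3 cc p q r (dZ h) - ev3 cc p q r (dZ f) * ev3 cc p q r (dY h))
      * (br q r - ev3 cc p q r (dX Om))
  + (ev3 cc p q r (dZ f) * ev3 cc p q r (dX h) - ev3 cc p q r (dX f) * ev3 cc p q r (dZ h))
      * (br r p - ev3 cc p q r (dY Om))"
    using assms by (intro dvd_add dvd_mult) auto
  then show ?thesis
    by (simp add: br_ev3_ev3 jac_def ev3_simps[OF ring_map_cc] algebra_simps)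
qed

end

text \<open>Bracketing with \<open>q\<close> annihilates \<open>q\<close>, so on polynomials in
  \<open>p\<close> alone it is differentiation followed by multiplication with {p,q}. A relation
  thus passes to its derivative, of smaller degree, and in characteristic zero only a constant has
  derivative zero. Bracketing with \<open>p\<close> then treats the outer variable in the same
  way.\<close>

lemma algebraic_independence:
  fixes P :: "('k::field_char_0, 'a, 'm) poisson_scheme"
  assumes "poisson_presentation P \<pi> g br cc" "\<not> g dvd br p q" "g dvd ev2 cc p q f"
  shows "f = 0"
proof -
  interpret poisson_presentation P \<pi> g br cc by fact
  have const: "u = 0" if "g dvd ev2 cc p q [:u:]" for u
    using that
  proof (induction "degree u" arbitrary: u rule: less_induct)
    case less
    show ?case
    proof (cases "degree u = 0")
      case True
      then obtain s where u: "u = [:s:]" by (auto elim: degree_eq_zeroE)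
      then have "g dvd cc s"
        using less.prems ev2_gens(1)[OF ring_map_cc, of p q s] by (simp add: pcst_def)
      then show ?thesis using not_dvd_cc u by auto
    next
      case False
      have "br (ev2 cc p q [:u:]) q = ev2 cc p q [:pderiv u:] * br p q"
        by (simp add: br_ev2 br_self pdx_def pdy_def map_poly_pCons pderiv_pCons)
      then have "g dvd ev2 cc p q [:pderiv u:]"
        using dvd_br[OF less.prems, of q] prime assms by auto
      then have "pderiv u = 0"
        using less.hyps[of "pderiv u"] False by (simp add: degree_pderiv)
      then show ?thesis using False by (simp add: pderiv_eq_0_iff)
    qed
  qed
  show ?thesis
    using assms(3)
  proof (induction "degree f" arbitrary: f rule: less_induct)
    case less
    show ?case
    proof (cases "degree f = 0")
      case True
      then show ?thesis using less.prems const by (auto elim!: degree_eq_zeroE)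
    next
      case False
      have "br (ev2 cc p q f) p = - ev2 cc p q (pderiv f) * br p q"
        unfolding br_swap[of q p] br_ev2 br_self pdy_def by simp
      then have "g dvd ev2 cc p q (pderiv f)"
        using dvd_br[OF less.prems, of p] prime assms by auto
      then have "pderiv f = 0"
        using less.hyps[of "pderiv f"] False by (simp add: degree_pderiv)
      then show ?thesis using False by (simp add: pderiv_eq_0_iff)
    qed
  qed
qed

text \<open>Pseudo-division by an element of least degree in the ideal \<open>(f, \<Omega>)\<close>.\<close>

lemma elimination:
  fixes Om f :: "'a::idom poly"
  assumes "prime_elem Om" "degree Om > 0" "\<not> Om dvd f"
  obtains u v r where "r \<noteq> 0" "u * f + v * Om = [:r:]"
proof -
  define Q where "Q h \<longleftrightarrow> h \<noteq> 0 \<and> (\<exists>u v. h = u * f + v * Om)" for h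
  have "Q Om" unfolding Q_def using assms(2) by (metis add_0 degree_0 less_irrefl mult_1 mult_zero_left)
  then obtain h where h: "Q h" and min: "\<And>k. Q k \<Longrightarrow> degree h \<le> degree k"
    using ex_has_least_nat[of Q Om degree] by blast
  then obtain u v where uv: "h = u * f + v * Om" and h0: "h \<noteq> 0" by (auto simp: Q_def)
  have div: "\<exists>a q. a \<noteq> 0 \<and> Polynomial.smult a (u' * f + v' * Om) = h * q" for u' v'
  proof -
    define k where "k = u' * f + v' * Om"
    obtain a q where aq: "a \<noteq> 0" "Polynomial.smult a k = h * q + pseudo_mod k h"
      using pseudo_mod(1)[OF h0, of k] by blast
    have "pseudo_mod k h = ([:a:] * u' - q * u) * f + ([:a:] * v' - q * v) * Om"
    proof -
      have "pseudo_mod k h = [:a:] * k - h * q" using aq by (simp add: algebra_simps)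
      then show ?thesis by (simp add: k_def uv algebra_simps)
    qed
    then have "pseudo_mod k h \<noteq> 0 \<Longrightarrow> Q (pseudo_mod k h)"
      unfolding Q_def by blast
    then have "pseudo_mod k h = 0"
      using min[of "pseudo_mod k h"] pseudo_mod(2)[OF h0, of k] by (metis leD)
    then show ?thesis using aq by (auto simp: k_def)
  qed
  obtain a q where a: "a \<noteq> 0" "Polynomial.smult a Om = h * q"
    using div[of 0 1] by auto
  obtain b t where b: "b \<noteq> 0" "Polynomial.smult b f = h * t"
    using div[of 1 0] by auto
  \<comment> \<open>By minimality \<open>h\<close> divides, up to nonzero factors free of the
    variable, both \<open>f\<close> and \<open>Om\<close>. Since \<open>Om\<close> divides
    \<open>h * q\<close> but not \<open>h\<close>, it divides \<open>q\<close>; cancelling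
    \<open>Om\<close> shows that \<open>h\<close> divides the constant polynomial
    \<open>[:a:]\<close>.\<close>
  have "\<not> Om dvd h"
  proof
    assume "Om dvd h"
    then have "Om dvd [:b:] * f" using b by simp
    then have "Om dvd [:b:]"
      using assms prime_elem_dvd_mult_iff by blast
    then have "degree Om \<le> degree [:b:]"
      using b by (intro dvd_imp_degree_le) auto
    then show False using assms by simp
  qed
  moreover have "Om dvd h * q"
    using a(2) dvd_smult[of Om Om a] by simp
  ultimately obtain w where "q = Om * w"
    using assms(1) prime_elem_dvd_mult_iff by (metis dvdE)
  then have "Om * [:a:] = Om * (h * w)"
    using a by (simp add: algebra_simps)
  moreover have "Om \<noteq> 0" using assms(1) by (simp add: prime_elem_def)
  ultimately have "[:a:] = h * w" by (metis mult_left_cancel)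
  then have "degree h = 0"
    using a by (metis degree_mult_eq degree_pCons_0 add_is_0 mult_eq_0_iff pCons_eq_0_iff)
  then obtain r where "h = [:r:]" by (auto elim: degree_eq_zeroE)
  then show thesis using that[of r u v] h0 uv by auto
qed

text \<open>If \<open>f\<close> were in the kernel without being a multiple of \<Omega>, eliminating
  z from \<open>f\<close> and \<Omega> would give a nonzero polynomial in x and y that vanishes at
  \<open>p\<close>, \<open>q\<close>, against their independence.\<close>

lemma kernel_ev3:
  fixes P :: "('k::field_char_0, 'a, 'm) poisson_scheme"
  assumes "poisson_presentation P \<pi> g br cc" "\<not> g dvd br p q"
    and "prime_elem Om" "degree Om > 0" "g dvd ev3 cc p q r Om"
  shows "g dvd ev3 cc p q r f \<longleftrightarrow> Om dvd f"
proof
  interpret poisson_presentation P \<pi> g br cc by fact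
  note ev = ev3_simps[OF ring_map_cc]
  show "g dvd ev3 cc p q r f" if "Om dvd f"
    using that assms(5) by (auto simp: ev elim!: dvdE)
  assume *: "g dvd ev3 cc p q r f"
  show "Om dvd f"
  proof (rule ccontr)
    assume "\<not> Om dvd f"
    then obtain u v s where s: "s \<noteq> 0" "u * f + v * Om = [:s:]"
      using elimination assms by blast
    have "g dvd ev3 cc p q r (u * f + v * Om)"
      using * assms(5) by (simp add: ev)
    then have "g dvd ev2 cc p q s"
      by (simp add: s ev3_const ring_map_cc)
    then show False
      using algebraic_independence assms(1,2) s by blast
  qed
qed

lemma dvd_ev3_commute:
  assumes "poisson_presentation P \<pi> g br cc"
    and "\<not> g dvd ev3 cc p q r (dZ Om)" "g dvd br p q - ev3 cc p q r (dZ Om)"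
  shows "\<not> g dvd br p q"
  using assms by (metis diff_diff_eq2 add_diff_cancel_left' dvd_diff)

lemma surface_embedding:
  fixes Om :: "'k::field_char_0 poly3"
  assumes pres: "poisson_presentation P \<pi> g br cc"
    and Om: "prime_elem Om" "\<And>f. g dvd ev3 cc p q r f \<longleftrightarrow> Om dvd f"
    and br: "g dvd br p q - ev3 cc p q r (dZ Om)" "g dvd br q r - ev3 cc p q r (dX Om)"
    "g dvd br r p - ev3 cc p q r (dY Om)"
    and dom: "\<And>b. b \<in> fracs g (range (ev3 cc p q r))"
  shows "poisson_Q Om \<simeq>\<^sub>P poisson_frac P"
proof -
  interpret B: poisson_presentation P \<pi> g br cc by fact
  interpret A: poisson_presentation "poisson_P Om" "coset Om" Om "\<lambda>f h. jac f h Om" cst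
    by (rule presentation_surface[OF Om(1)])
  have "poisson_embedding (poisson_P Om) (coset Om) Om (\<lambda>f h. jac f h Om) cst P \<pi> g br cc (ev3 cc p q r)"
    by unfold_locales
      (use B.br_ev3_cong[OF br] dom Om in \<open>auto simp: ev3_simps B.ring_map_cc fracs_def\<close>)
  then show ?thesis
    unfolding poisson_Q_def by (rule poisson_embedding.poisson_frac_iso)
qed

lemma plane_embedding:
  fixes h :: "'k::field_char_0 poly poly"
  assumes pres: "poisson_presentation P \<pi> g br cc"
    and br: "g dvd br p q - ev2 cc p q h" "\<not> g dvd br p q"
    and dom: "\<And>b. b \<in> fracs g (range (ev2 cc p q))"
  shows "poisson_frac (poisson_plane h) \<simeq>\<^sub>P poisson_frac P"
proof -
  interpret B: poisson_presentation P \<pi> g br cc by fact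
  note ev = ev2_simps[OF B.ring_map_cc]
  interpret A: poisson_presentation "poisson_plane h" "\<lambda>f. f" 0 "pbr h" pcst
    by (rule presentation_plane)
  have "g dvd br (ev2 cc p q u) (ev2 cc p q v) - ev2 cc p q (pbr h u v)" for u v
  proof -
    have "g dvd (ev2 cc p q (pdx u) * ev2 cc p q (pdy v) - ev2 cc p q (pdy u) * ev2 cc p q (pdx v))
        * (br p q - ev2 cc p q h)"
      using br by simp
    then show ?thesis
      by (simp add: B.br_ev2_ev2 pbr_def ev algebra_simps)
  qed
  moreover have "g dvd ev2 cc p q u \<longleftrightarrow> 0 dvd u" for u
    using algebraic_independence[OF pres br(2)] by (auto simp: ev)
  ultimately have "poisson_embedding (poisson_plane h) (\<lambda>f. f) 0 (pbr h) pcst P \<pi> g br cc (ev2 cc p q)"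
    using dom by unfold_locales (auto simp: ev fracs_def)
  then show ?thesis
    by (rule poisson_embedding.poisson_frac_iso)
qed

abbreviation plane_frac :: "'k::field poly poly \<Rightarrow> ('k, ('k poly poly \<times> 'k poly poly) set) poisson" where
  "plane_frac h \<equiv> poisson_frac (poisson_plane h)"

lemmas plane_frac_sym = poisson_presentation.poisson_frac_iso_sym[OF presentation_plane]

lemma surface_frac_sym: "prime_elem Om \<Longrightarrow> poisson_Q Om \<simeq>\<^sub>P R \<Longrightarrow> R \<simeq>\<^sub>P poisson_Q Om"
  unfolding poisson_Q_def
  by (rule poisson_presentation.poisson_frac_iso_sym[OF presentation_surface])

lemma plane_subalgebra: "poisson_subalgebra (poisson_plane h) (\<lambda>f. f) 0 (pbr h) pcst (range (ev2 pcst p q))"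
  by (rule poisson_presentation.subalgebra_range[OF presentation_plane ring_map_ev2[OF ring_map_pcst]])
    (rule ev2_gens[OF ring_map_pcst])

lemma plane_subalgebra3: "poisson_subalgebra (poisson_plane h) (\<lambda>f. f) 0 (pbr h) pcst (range (ev3 pcst p q r))"
  by (rule poisson_presentation.subalgebra_range[OF presentation_plane ring_map_ev3[OF ring_map_pcst]])
    (rule ev3_gens[OF ring_map_pcst])

lemma surface_subalgebra:
  "prime_elem Om \<Longrightarrow>
    poisson_subalgebra (poisson_P Om) (coset Om) Om (\<lambda>f h. jac f h Om) cst (range (ev2 cst p q))"
  by (rule poisson_presentation.subalgebra_range[OF presentation_surface ring_map_ev2[OF ring_map_cst]], assumption)
    (rule ev2_gens[OF ring_map_cst])

lemma surface_subalgebra3: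
  "prime_elem Om \<Longrightarrow>
    poisson_subalgebra (poisson_P Om) (coset Om) Om (\<lambda>f h. jac f h Om) cst (range (ev3 cst p q r))"
  by (rule poisson_presentation.subalgebra_range[OF presentation_surface ring_map_ev3[OF ring_map_cst]], assumption)
    (rule ev3_gens[OF ring_map_cst])

lemma range_ev2: "ring_map c \<Longrightarrow> p \<in> range (ev2 c p q)" "ring_map c \<Longrightarrow> q \<in> range (ev2 c p q)"
  by (metis ev2_gens(2) rangeI, metis ev2_gens(3) rangeI)

lemma range_ev3: "ring_map c \<Longrightarrow> p \<in> range (ev3 c p q r)" "ring_map c \<Longrightarrow> q \<in> range (ev3 c p q r)"
    "ring_map c \<Longrightarrow> r \<in> range (ev3 c p q r)"
  by (metis ev3_gens(2) rangeI, metis ev3_gens(3) rangeI, metis ev3_gens(4) rangeI)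

text \<open>
  In the next statements the hypotheses on \<open>F\<close> express that the target field is generated by the
  images of the coordinates, \<open>F\<close> being the subfield that these generate.
\<close>

definition subfield_over :: "('k \<Rightarrow> 'b) \<Rightarrow> 'b::comm_ring_1 \<Rightarrow> 'b set \<Rightarrow> bool" where
  "subfield_over c g F \<longleftrightarrow> (\<forall>s. c s \<in> F) \<and> (\<forall>u\<in>F. \<forall>v\<in>F. u + v \<in> F \<and> u - v \<in> F \<and> u * v \<in> F) \<and>
     (\<forall>u\<in>F. \<forall>v\<in>F. \<forall>w. \<not> g dvd v \<longrightarrow> g dvd w * v - u \<longrightarrow> w \<in> F)"

lemma (in poisson_subalgebra) subfield_over_fracs: "subfield_over cc g (fracs g H)"
  unfolding subfield_over_def
  by (intro conjI allI ballI impI) (rule fracs_intros fracs_divide; assumption?; fail)+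

lemma subfield_overD:
  assumes "subfield_over c g F"
  shows "c s \<in> F" "u \<in> F \<Longrightarrow> v \<in> F \<Longrightarrow> u + v \<in> F" "u \<in> F \<Longrightarrow> v \<in> F \<Longrightarrow> u - v \<in> F"
    "u \<in> F \<Longrightarrow> v \<in> F \<Longrightarrow> u * v \<in> F" "\<not> g dvd v \<Longrightarrow> u \<in> F \<Longrightarrow> v \<in> F \<Longrightarrow> g dvd w * v - u \<Longrightarrow> w \<in> F"
proof -
  note * = assms[unfolded subfield_over_def]
  show "c s \<in> F" by (rule *[THEN conjunct1, rule_format])
  show "u \<in> F \<Longrightarrow> v \<in> F \<Longrightarrow> u + v \<in> F" "u \<in> F \<Longrightarrow> v \<in> F \<Longrightarrow> u - v \<in> F" "u \<in> F \<Longrightarrow> v \<in> F \<Longrightarrow> u * v \<in> F"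
    by (simp_all add: *[THEN conjunct2, THEN conjunct1, rule_format])
  show "\<not> g dvd v \<Longrightarrow> u \<in> F \<Longrightarrow> v \<in> F \<Longrightarrow> g dvd w * v - u \<Longrightarrow> w \<in> F"
    by (rule *[THEN conjunct2, THEN conjunct2, rule_format])
qed

lemma subfield_over_power: "subfield_over c g F \<Longrightarrow> ring_map c \<Longrightarrow> u \<in> F \<Longrightarrow> u ^ n \<in> F"
  using subfield_overD(1)[of c g F 1] by (induction n) (simp_all add: ring_map_one subfield_overD(4))

section \<open>Transfer theorems between surfaces and planes\<close>

theorem surface_to_plane:
  fixes Om :: "'k::field_char_0 poly3"
  assumes Om: "prime_elem Om" "degree Om > 0" "ev3 pcst p q r Om = 0"
    and br: "pbr h p q = ev3 pcst p q r (dZ Om)" "pbr h q r = ev3 pcst p q r (dX Om)"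
    "pbr h r p = ev3 pcst p q r (dY Om)" "pbr h p q \<noteq> 0"
    and gen: "\<And>F. subfield_over pcst 0 F \<Longrightarrow> p \<in> F \<Longrightarrow> q \<in> F \<Longrightarrow> r \<in> F \<Longrightarrow> px \<in> F \<and> py \<in> F"
  shows "poisson_Q Om \<simeq>\<^sub>P plane_frac h"
proof (rule surface_embedding[OF presentation_plane Om(1), where p = p and q = q and r = r])
  interpret poisson_subalgebra "poisson_plane h" "\<lambda>f. f" 0 "pbr h" pcst "range (ev3 pcst p q r)"
    by (rule plane_subalgebra3)
  show "0 dvd ev3 pcst p q r f \<longleftrightarrow> Om dvd f" for f
    by (rule kernel_ev3[OF presentation_plane[of h]]) (use Om br in auto)
  have "px \<in> fracs 0 (range (ev3 pcst p q r)) \<and> py \<in> fracs 0 (range (ev3 pcst p q r))"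
    by (intro gen subfield_over_fracs fracs_self range_ev3 ring_map_pcst)
  then show "b \<in> fracs 0 (range (ev3 pcst p q r))" for b
    by (induction b rule: poly2_induct) (auto intro: fracs_intros)
qed (use br in auto)

theorem plane_to_plane:
  fixes h :: "'k::field_char_0 poly poly"
  assumes br: "pbr h' p q = ev2 pcst p q h" "pbr h' p q \<noteq> 0"
    and gen: "\<And>F. subfield_over pcst 0 F \<Longrightarrow> p \<in> F \<Longrightarrow> q \<in> F \<Longrightarrow> px \<in> F \<and> py \<in> F"
  shows "plane_frac h \<simeq>\<^sub>P plane_frac h'"
proof (rule plane_embedding[OF presentation_plane, where p = p and q = q])
  interpret poisson_subalgebra "poisson_plane h'" "\<lambda>f. f" 0 "pbr h'" pcst "range (ev2 pcst p q)"
    by (rule plane_subalgebra)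
  have "px \<in> fracs 0 (range (ev2 pcst p q)) \<and> py \<in> fracs 0 (range (ev2 pcst p q))"
    by (intro gen subfield_over_fracs fracs_self range_ev2 ring_map_pcst)
  then show "b \<in> fracs 0 (range (ev2 pcst p q))" for b
    by (induction b rule: poly2_induct) (auto intro: fracs_intros)
qed (use br in auto)

text \<open>The embedding runs the other way: \<open>p\<close> and \<open>q\<close> are functions on
  the surface that generate its field and whose bracket is a polynomial in them. The resulting
  isomorphism is inverted at the end.\<close>

theorem plane_to_surface:
  fixes Om :: "'k::field_char_0 poly3"
  assumes Om: "prime_elem Om"
    and br: "jac p q Om = ev2 cst p q h" "\<not> Om dvd jac p q Om"
    and gen: "\<And>F. subfield_over cst Om F \<Longrightarrow> p \<in> F \<Longrightarrow> q \<in> F \<Longrightarrow> vx \<in> F \<and> vy \<in> F \<and> vz \<in> F"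
  shows "poisson_Q Om \<simeq>\<^sub>P plane_frac h"
proof -
  interpret poisson_subalgebra "poisson_P Om" "coset Om" Om "\<lambda>f h. jac f h Om" cst "range (ev2 cst p q)"
    by (rule surface_subalgebra[OF Om])
  have "vx \<in> fracs Om (range (ev2 cst p q)) \<and> vy \<in> fracs Om (range (ev2 cst p q)) \<and>
      vz \<in> fracs Om (range (ev2 cst p q))"
    by (intro gen subfield_over_fracs fracs_self range_ev2 ring_map_cst)
  then have "b \<in> fracs Om (range (ev2 cst p q))" for b
    by (induction b rule: poly3_induct) (auto intro: fracs_intros)
  then have "plane_frac h \<simeq>\<^sub>P poisson_Q Om"
    unfolding poisson_Q_def
    by (intro plane_embedding[OF presentation_surface[OF Om]]) (use br in auto)
  then show ?thesis by (rule plane_frac_sym)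
qed

text \<open>Write \<theta> for the substitution. The chain rule gives J(p,q,\<theta>\<Omega>) = m
  \<theta>(\<Omega>_z), while the product rule on \<theta>\<Omega> = m\<Omega>' gives m
  J(p,q,\<Omega>') + \<Omega>' J(p,q,m). Modulo the prime \<Omega>' the factor m cancels, and this
  is why the Jacobian has to equal the multiplier of the potential.\<close>

theorem surface_to_surface:
  fixes Om :: "'k::field_char_0 poly3"
  assumes Om: "prime_elem Om" "degree Om > 0" "prime_elem Om'"
    and m: "ev3 cst p q r Om = m * Om'" "jac p q r = m" "\<not> Om' dvd m"
    and z: "\<not> Om' dvd ev3 cst p q r (dZ Om)"
    and gen: "\<And>F. subfield_over cst Om' F \<Longrightarrow> p \<in> F \<Longrightarrow> q \<in> F \<Longrightarrow> r \<in> F \<Longrightarrow> vx \<in> F \<and> vy \<in> F \<and> vz \<in> F"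
  shows "poisson_Q Om \<simeq>\<^sub>P poisson_Q Om'"
proof -
  interpret poisson_subalgebra "poisson_P Om'" "coset Om'" Om' "\<lambda>f h. jac f h Om'" cst
      "range (ev3 cst p q r)"
    by (rule surface_subalgebra3[OF Om(3)])
  have "vx \<in> fracs Om' (range (ev3 cst p q r)) \<and> vy \<in> fracs Om' (range (ev3 cst p q r)) \<and>
      vz \<in> fracs Om' (range (ev3 cst p q r))"
    by (intro gen subfield_over_fracs fracs_self range_ev3 ring_map_cst)
  then have dom: "b \<in> fracs Om' (range (ev3 cst p q r))" for b
    by (induction b rule: poly3_induct) (auto intro: fracs_intros)
  have cancel: "Om' dvd jac u v Om' - w" if "jac u v (ev3 cst p q r Om) = w * jac p q r" for u v w
  proof -
    have "m * (jac u v Om' - w) = - (Om' * jac u v m)"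
      using that unfolding m(1,2) jac_mult3 by (simp add: algebra_simps eq_neg_iff_add_eq_0)
    then have "Om' dvd m * (jac u v Om' - w)" by simp
    then show ?thesis using prime m(3) by blast
  qed
  note br = jac_ev3[THEN cancel]
  \<comment> \<open>The bracket of \<open>p\<close> and \<open>q\<close> is congruent to the image
    of \<Omega>_z, which is nonzero by assumption; this gives the independence needed for the
    kernel.\<close>
  have "\<not> Om' dvd jac p q Om'"
    using dvd_ev3_commute[OF poisson_presentation_axioms z br(1)] .
  then have "Om' dvd ev3 cst p q r f \<longleftrightarrow> Om dvd f" for f
    by (intro kernel_ev3[OF presentation_surface[OF Om(3)]]) (use Om m in auto)
  then show ?thesis
    unfolding poisson_Q_def[of Om']
    by (intro surface_embedding[OF presentation_surface[OF Om(3)] Om(1), where p = p and q = q and r = r]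
        br dom)
qed

section \<open>Invertible polynomial substitutions\<close>

definition inverse_subst ::
    "'k::field poly3 \<Rightarrow> 'k poly3 \<Rightarrow> 'k poly3 \<Rightarrow> 'k poly3 \<Rightarrow> 'k poly3 \<Rightarrow> 'k poly3 \<Rightarrow> bool" where
  "inverse_subst p q r p' q' r' \<longleftrightarrow>
     ev3 cst p q r p' = vx \<and> ev3 cst p q r q' = vy \<and> ev3 cst p q r r' = vz \<and>
     ev3 cst p' q' r' p = vx \<and> ev3 cst p' q' r' q = vy \<and> ev3 cst p' q' r' r = vz"

lemma inverse_subst_sym: "inverse_subst p q r p' q' r' \<Longrightarrow> inverse_subst p' q' r' p q r"
  by (simp add: inverse_subst_def)

lemma inverse_subst_ev3:
  assumes "inverse_subst p q r p' q' r'"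
  shows "ev3 cst p q r (ev3 cst p' q' r' f) = f"
  using assms ev3_comp[OF ring_map_cst ring_map_ev3[OF ring_map_cst, of p q r], of cst p' q' r' f]
  by (simp add: inverse_subst_def ev3_gens ring_map_cst ev3_id)

lemma cst_unit: "\<kappa> \<noteq> 0 \<Longrightarrow> cst \<kappa> dvd 1"
  by (rule dvdI[of _ _ "cst (inverse \<kappa>)"]) (simp flip: cst_simps)

lemma unit_mult_dvd_iff: "(u :: 'a::comm_ring_1) dvd 1 \<Longrightarrow> u * p dvd q \<longleftrightarrow> p dvd q"
  using mult_dvd_mono[of u 1 p q] dvd_mult_right[of u p q] by auto

lemma irreducible_unit_mult:
  assumes "(u :: 'a::idom) dvd 1"
  shows "irreducible (u * p) \<longleftrightarrow> irreducible p"
proof -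
  have *: "irreducible (v * q)" if q: "irreducible q" and v: "v dvd 1" for q v :: 'a
  proof (rule irreducibleI)
    obtain w where w: "1 = v * w" using v by (rule dvdE)
    show "v * q \<noteq> 0" using q v by (auto simp: irreducible_def)
    show "\<not> v * q dvd 1" using q unit_mult_dvd_iff[OF v, of q 1] by (auto simp: irreducible_def)
    fix a b assume ab: "v * q = a * b"
    have "q = v * w * q" using w by simp
    also have "\<dots> = w * a * b" using ab by (simp add: mult_ac)
    finally have "w * a dvd 1 \<or> b dvd 1" using q by (auto simp: irreducible_def)
    then show "a dvd 1 \<or> b dvd 1" by (metis dvd_mult_right)
  qed
  obtain w where "1 = u * w" using assms by (rule dvdE)
  then have w: "w * u = 1" by (simp add: mult.commute)
  then have "w * (u * p) = p" "w dvd 1"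
    by (simp add: mult.assoc[symmetric]) (metis w dvd_triv_left)
  then show ?thesis using *[OF _ assms, of p] *[of "u * p" w] by metis
qed

lemma irreducible_inverse_subst:
  assumes "inverse_subst p q r p' q' r'" "\<kappa> \<noteq> 0" "ev3 cst p q r Om = cst \<kappa> * Om'"
  shows "irreducible Om' \<longleftrightarrow> irreducible Om"
proof -
  note inv = inverse_subst_ev3[OF assms(1)] inverse_subst_ev3[OF inverse_subst_sym[OF assms(1)]]
  have "irreducible Om' \<longleftrightarrow> irreducible (ev3 cst p q r Om)"
    unfolding assms(3) using irreducible_unit_mult[OF cst_unit[OF assms(2)]] by blast
  also have "\<dots> \<longleftrightarrow> irreducible Om"
    using irreducible_ring_iso[OF ring_map_ev3[OF ring_map_cst] ring_map_ev3[OF ring_map_cst], of p' q' r' p q r]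
      irreducible_ring_iso[OF ring_map_ev3[OF ring_map_cst] ring_map_ev3[OF ring_map_cst], of p q r p' q' r']
      inv by metis
  finally show ?thesis .
qed

text \<open>The inverse substitution supplies both the kernel and the surjectivity, so this version
  also covers potentials that do not involve z.\<close>

theorem surface_automorphism:
  fixes Om :: "'k::field_char_0 poly3"
  assumes irr: "irreducible Om" and inv: "inverse_subst p q r p' q' r'"
    and m: "ev3 cst p q r Om = cst \<kappa> * Om'" "jac p q r = cst \<kappa>" "\<kappa> \<noteq> 0"
  shows "poisson_Q Om \<simeq>\<^sub>P poisson_Q Om'"
proof -
  have primes: "prime_elem Om" "prime_elem Om'"
    using irreducible_imp_prime_poly3 irr irreducible_inverse_subst[OF inv m(3,1)] by blast+
  note inv' = inverse_subst_ev3[OF inv] inverse_subst_ev3[OF inverse_subst_sym[OF inv]]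
  interpret poisson_subalgebra "poisson_P Om'" "coset Om'" Om' "\<lambda>f h. jac f h Om'" cst
      "range (ev3 cst p q r)"
    by (rule surface_subalgebra3[OF primes(2)])
  have dom: "b \<in> fracs Om' (range (ev3 cst p q r))" for b
    using inv'(1) by (metis fracs_self rangeI)
  have cancel: "Om' dvd jac u v Om' - w" if "jac u v (ev3 cst p q r Om) = w * jac p q r" for u v w
  proof -
    have "cst \<kappa> * (jac u v Om' - w) = 0"
      using that unfolding m(1,2) jac_mult3
      by (simp add: algebra_simps) (simp add: jac_def)
    then have "Om' dvd cst \<kappa> * (jac u v Om' - w)" by (simp only: dvd_0_right)
    then show ?thesis using dvd_cc_mult_iff m(3) by blast
  qed
  note br = jac_ev3[THEN cancel]
  have "Om' dvd ev3 cst p q r f \<longleftrightarrow> Om dvd f" for f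
  proof -
    have "Om' dvd ev3 cst p q r f \<longleftrightarrow> ev3 cst p q r Om dvd ev3 cst p q r f"
      unfolding m(1) using unit_mult_dvd_iff[OF cst_unit[OF m(3)]] by blast
    also have "\<dots> \<longleftrightarrow> Om dvd f"
      using ring_map_dvd[OF ring_map_ev3[OF ring_map_cst], of Om f p q r]
        ring_map_dvd[OF ring_map_ev3[OF ring_map_cst], of "ev3 cst p q r Om" "ev3 cst p q r f" p' q' r']
      unfolding inv' by blast
    finally show ?thesis .
  qed
  then show ?thesis
    unfolding poisson_Q_def[of Om']
    by (intro surface_embedding[OF presentation_surface[OF primes(2)] primes(1), where p = p and q = q and r = r]
        br dom)
qed

section \<open>Planes with quadratic and monomial brackets\<close>

lemma subfield_divide0:
  assumes "subfield_over c 0 F" "v \<noteq> 0" "u \<in> F" "v \<in> F" "w * v = u"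
  shows "w \<in> F"
  using subfield_overD(5)[OF assms(1), of v u w] assms by simp

lemma subfield_minus: "subfield_over c g F \<Longrightarrow> ring_map c \<Longrightarrow> u \<in> F \<Longrightarrow> - u \<in> F"
  using subfield_overD(3)[of c g F 0 u] subfield_overD(1)[of c g F 0] by (simp add: ring_map_zero)

lemma pcst_neq_0 [simp]: "pcst s = 0 \<longleftrightarrow> s = 0"
  by (simp add: pcst_def)

lemma px_neq_0 [simp]: "px \<noteq> 0" "py \<noteq> 0"
  by (simp_all add: px_def py_def)

lemma K_Weyl_eq: "K_Weyl = plane_frac 1"
  by (simp add: K_Weyl_def)

lemma K_skew_eq: "K_skew q = plane_frac (pcst q * px * py)"
  by (simp add: K_skew_def pcst_def px_def py_def)

lemmas ev_pcst = ev2_simps[OF ring_map_pcst] ev3_simps[OF ring_map_pcst]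
lemmas ev_cst = ev2_simps[OF ring_map_cst] ev3_simps[OF ring_map_cst]

text \<open>In the Weyl plane {x, \<beta>x^m y} = \<beta>x^m, so x and \<beta>x^m y are coordinates
  with the required bracket.\<close>

lemma plane_monomial:
  fixes \<beta> :: "'k::field_char_0"
  assumes "\<beta> \<noteq> 0"
  shows "plane_frac (pcst \<beta> * px ^ m) \<simeq>\<^sub>P (K_Weyl :: ('k, _) poisson)"
  unfolding K_Weyl_eq
proof (rule plane_to_plane[where p = px and q = "pcst \<beta> * px ^ m * py"])
  show "pbr 1 px (pcst \<beta> * px ^ m * py) = ev2 pcst px (pcst \<beta> * px ^ m * py) (pcst \<beta> * px ^ m)"
    by (simp add: ev_pcst pbr_def partial2_simps)
  show "pbr 1 px (pcst \<beta> * px ^ m * py) \<noteq> 0"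
    using assms by (simp add: pbr_def partial2_simps)
  fix F :: "'k poly poly set"
  assume F: "subfield_over pcst 0 F" "px \<in> F" "pcst \<beta> * px ^ m * py \<in> F"
  have "py \<in> F"
    by (rule subfield_divide0[OF F(1) _ F(3), of "pcst \<beta> * px ^ m"])
      (use F assms in \<open>auto simp: mult_ac intro: subfield_overD(1-4) subfield_over_power ring_map_pcst\<close>)
  then show "px \<in> F \<and> py \<in> F" using F by simp
qed

text \<open>The new coordinates are chosen so that \<open>?p - pcst r * ?q\<close> is x; then {p,q}
  = {x, e x^2 y} = e x^2 is the required square.\<close>

lemma plane_square:
  fixes e :: "'k::field_char_0"
  assumes "e \<noteq> 0"
  shows "plane_frac (pcst e * (px - pcst r * py) ^ 2) \<simeq>\<^sub>P (K_Weyl :: ('k, _) poisson)"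
  unfolding K_Weyl_eq
proof (rule plane_to_plane)
  let ?q = "pcst e * px ^ 2 * py"
  let ?p = "px + pcst r * ?q"
  show "pbr 1 ?p ?q = ev2 pcst ?p ?q (pcst e * (px - pcst r * py) ^ 2)"
    by (simp add: ev_pcst pbr_def partial2_simps algebra_simps)
  show "pbr 1 ?p ?q \<noteq> 0"
    using assms by (simp add: pbr_def partial2_simps algebra_simps)
  fix F :: "'k poly poly set"
  assume F: "subfield_over pcst 0 F" "?p \<in> F" "?q \<in> F"
  have "?p - pcst r * ?q \<in> F" by (rule F(2-) | rule subfield_overD(1-4)[OF F(1)])+
  then have "px \<in> F" by simp
  moreover have "py \<in> F"
    by (rule subfield_divide0[OF F(1) _ F(3), of "pcst e * px ^ 2"])
      (use F assms \<open>px \<in> F\<close> in \<open>auto simp: mult_ac intro: subfield_overD(1-4) subfield_over_power ring_map_pcst\<close>)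
  ultimately show "px \<in> F \<and> py \<in> F" by simp
qed

lemma plane_square':
  fixes e :: "'k::field_char_0"
  assumes "e \<noteq> 0"
  shows "plane_frac (pcst e * py ^ 2) \<simeq>\<^sub>P (K_Weyl :: ('k, _) poisson)"
  unfolding K_Weyl_eq
proof (rule plane_to_plane)
  let ?p = "pcst (- e) * px ^ 2 * py"
  show "pbr 1 ?p px = ev2 pcst ?p px (pcst e * py ^ 2)"
    by (simp add: ev_pcst pbr_def partial2_simps pcst_simps)
  show "pbr 1 ?p px \<noteq> 0"
    using assms by (simp add: pbr_def partial2_simps pcst_simps)
  fix F :: "'k poly poly set"
  assume F: "subfield_over pcst 0 F" "?p \<in> F" "px \<in> F"
  have "py \<in> F"
    by (rule subfield_divide0[OF F(1) _ F(2), of "pcst (- e) * px ^ 2"])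
      (use F assms in \<open>auto simp: mult_ac intro: subfield_overD(1-4) subfield_over_power ring_map_pcst\<close>)
  then show "px \<in> F \<and> py \<in> F" using F by simp
qed

text \<open>The two linear factors serve as coordinates: their Jacobian is the constant r - s, and
  their product is the bracket up to \<open>e\<close>.\<close>

lemma plane_two_lines:
  fixes e :: "'k::field_char_0"
  assumes "e \<noteq> 0" "r \<noteq> s"
  shows "plane_frac (pcst e * (px - pcst r * py) * (px - pcst s * py)) \<simeq>\<^sub>P K_skew ((r - s) * e)"
  unfolding K_skew_eq
proof (rule plane_frac_sym, rule plane_to_plane)
  let ?h = "pcst e * (px - pcst r * py) * (px - pcst s * py)"
  let ?p = "px - pcst r * py" and ?q = "px - pcst s * py"
  have "?p \<noteq> 0" "?q \<noteq> 0"
    by (auto simp: px_def py_def pcst_def)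
  then have h: "?h \<noteq> 0" using assms by simp
  have br: "pbr ?h ?p ?q = ?h * pcst (r - s)"
    by (simp add: pbr_def partial2_simps pcst_simps algebra_simps)
  show "pbr ?h ?p ?q = ev2 pcst ?p ?q (pcst ((r - s) * e) * px * py)"
    unfolding br by (simp add: ev_pcst pcst_simps)
  show "pbr ?h ?p ?q \<noteq> 0"
    unfolding br using h assms by simp
  fix F :: "'k poly poly set"
  assume F: "subfield_over pcst 0 F" "?p \<in> F" "?q \<in> F"
  have "py \<in> F"
  proof (rule subfield_divide0[OF F(1)])
    show "pcst (s - r) \<noteq> 0" using assms by simp
    show "pcst (s - r) \<in> F" "?p - ?q \<in> F"
      by (rule F(2-) subfield_overD(1,3)[OF F(1)])+
    show "py * pcst (s - r) = ?p - ?q"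
      by (simp add: pcst_simps algebra_simps)
  qed
  moreover have "?p + pcst r * py \<in> F"
    by (rule F(2-) \<open>py \<in> F\<close> | rule subfield_overD(1-4)[OF F(1)])+
  ultimately show "px \<in> F \<and> py \<in> F" by simp
qed

text \<open>The same principle as for two lines: the factors x and \<alpha>y + \<beta>x^n generate
  the field and have constant Jacobian \<alpha>.\<close>

lemma plane_axis_and_curve:
  fixes \<alpha> :: "'k::field_char_0"
  assumes "\<alpha> \<noteq> 0"
  shows "plane_frac (px * (pcst \<alpha> * py + pcst \<beta> * px ^ n)) \<simeq>\<^sub>P K_skew \<alpha>"
  unfolding K_skew_eq
proof (rule plane_frac_sym, rule plane_to_plane)
  let ?q = "pcst \<alpha> * py + pcst \<beta> * px ^ n"
  let ?h = "px * ?q"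
  have "?q \<noteq> 0"
  proof
    assume "?q = 0"
    then have "pdy ?q = 0" by (simp add: is_deriv_zero[OF is_deriv_partial2(2)])
    then show False using assms by (simp add: partial2_simps)
  qed
  then have h: "?h \<noteq> 0" by simp
  have br: "pbr ?h px ?q = ?h * pcst \<alpha>"
    by (simp add: pbr_def partial2_simps)
  show "pbr ?h px ?q = ev2 pcst px ?q (pcst \<alpha> * px * py)"
    unfolding br by (simp add: ev_pcst)
  show "pbr ?h px ?q \<noteq> 0"
    unfolding br using h assms by simp
  fix F :: "'k poly poly set"
  assume F: "subfield_over pcst 0 F" "px \<in> F" "?q \<in> F"
  have A: "?q - pcst \<beta> * px ^ n \<in> F"
    by (rule F(2-) | rule subfield_overD(1-4)[OF F(1)] subfield_over_power[OF F(1) ring_map_pcst])+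
  have "py \<in> F"
    by (rule subfield_divide0[OF F(1) _ A, of "pcst \<alpha>"])
      (use assms subfield_overD(1)[OF F(1)] in \<open>auto simp: mult.commute\<close>)
  then show "px \<in> F \<and> py \<in> F" using F by simp
qed

lemma plane_y_axis:
  fixes f :: "'k::field_char_0"
  assumes "f \<noteq> 0"
  shows "plane_frac (py * (pcst f * px + pcst g * py)) \<simeq>\<^sub>P K_skew (- f)"
  unfolding K_skew_eq
proof (rule plane_frac_sym, rule plane_to_plane)
  let ?q = "pcst f * px + pcst g * py"
  let ?h = "py * ?q"
  have "?q \<noteq> 0"
  proof
    assume "?q = 0"
    then have "pdx ?q = 0" by (simp add: is_deriv_zero[OF is_deriv_partial2(1)])
    then show False using assms by (simp add: partial2_simps)
  qed
  then have h: "?h \<noteq> 0" by simp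
  have br: "pbr ?h py ?q = ?h * pcst (- f)"
    by (simp add: pbr_def partial2_simps pcst_simps)
  show "pbr ?h py ?q = ev2 pcst py ?q (pcst (- f) * px * py)"
    unfolding br by (simp add: ev_pcst)
  show "pbr ?h py ?q \<noteq> 0"
    unfolding br using h assms by simp
  fix F :: "'k poly poly set"
  assume F: "subfield_over pcst 0 F" "py \<in> F" "?q \<in> F"
  have A: "?q - pcst g * py \<in> F"
    by (rule F(2-) | rule subfield_overD(1-4)[OF F(1)])+
  have "px \<in> F"
    by (rule subfield_divide0[OF F(1) _ A, of "pcst f"])
      (use assms subfield_overD(1)[OF F(1)] in \<open>auto simp: mult.commute\<close>)
  then show "px \<in> F \<and> py \<in> F" using F by simp
qed

lemma exists_sqrt: "\<exists>y. y ^ 2 = (x :: 'k::alg_closed_field)"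
  by (rule nth_root_exists) simp

text \<open>The form splits into two lines according to its discriminant, and in each skew case
  \<kappa> is a square root of that discriminant. A double line gives the Weyl field.\<close>

lemma plane_quadratic:
  fixes e f g :: "'k::{alg_closed_field, field_char_0}"
  defines "Q \<equiv> pcst e * px ^ 2 + pcst f * px * py + pcst g * py ^ 2"
  shows "f ^ 2 \<noteq> 4 * e * g \<Longrightarrow> \<exists>\<kappa>. \<kappa> \<noteq> 0 \<and> plane_frac Q \<simeq>\<^sub>P K_skew \<kappa>"
    and "f ^ 2 = 4 * e * g \<Longrightarrow> e \<noteq> 0 \<or> g \<noteq> 0 \<Longrightarrow> plane_frac Q \<simeq>\<^sub>P (K_Weyl :: ('k, _) poisson)"
proof -
  obtain d where d: "d ^ 2 = f ^ 2 - 4 * e * g" using exists_sqrt by blast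
  define r s where "r = (- f + d) / (2 * e)" and "s = (- f - d) / (2 * e)"
  have Q: "Q = pcst e * (px - pcst r * py) * (px - pcst s * py)" if "e \<noteq> 0"
  proof -
    have f: "f = - e * (r + s)"
      using that by (simp add: r_def s_def field_simps)
    have "4 * e * (e * (r * s)) = f ^ 2 - d ^ 2"
      using that by (simp add: r_def s_def field_simps power2_eq_square)
    then have "4 * e * (e * (r * s)) = 4 * e * g" using d by simp
    then have g: "g = e * (r * s)" using that by simp
    show ?thesis
      unfolding Q_def f g by (simp add: pcst_simps algebra_simps power2_eq_square)
  qed
  have rs: "(r - s) * e = d" if "e \<noteq> 0"
    using that by (simp add: r_def s_def field_simps)
  show "\<exists>\<kappa>. \<kappa> \<noteq> 0 \<and> plane_frac Q \<simeq>\<^sub>P K_skew \<kappa>" if "f ^ 2 \<noteq> 4 * e * g"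
  proof (cases "e = 0")
    case True
    then have "Q = py * (pcst f * px + pcst g * py)"
      by (simp add: Q_def pcst_simps algebra_simps power2_eq_square)
    moreover have "f \<noteq> 0" using that True by auto
    ultimately show ?thesis using plane_y_axis[of f g] by (metis neg_equal_0_iff_equal)
  next
    case False
    have "d \<noteq> 0" using that d by auto
    then have "r \<noteq> s" using rs[OF False] by auto
    then show ?thesis
      using plane_two_lines[OF False, of r s] rs[OF False] \<open>d \<noteq> 0\<close> unfolding Q[OF False] by auto
  qed
  show "plane_frac Q \<simeq>\<^sub>P (K_Weyl :: ('k, _) poisson)" if "f ^ 2 = 4 * e * g" "e \<noteq> 0 \<or> g \<noteq> 0"
  proof (cases "e = 0")
    case True
    then have "Q = pcst g * py ^ 2" "g \<noteq> 0"
      using that by (simp_all add: Q_def pcst_simps)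
    then show ?thesis using plane_square' by simp
  next
    case False
    have "d = 0" using that d by auto
    then have "r = s" using rs[OF False] False by auto
    then have "Q = pcst e * (px - pcst r * py) ^ 2"
      using Q[OF False] by (simp add: power2_eq_square mult.assoc)
    then show ?thesis using plane_square[OF False] by simp
  qed
qed


section \<open>Surfaces with rational function field\<close>

definition emb :: "'k::field poly poly \<Rightarrow> 'k poly3" where "emb u = [:u:]"

lemma ring_map_emb: "ring_map emb"
  by (simp add: ring_map_def emb_def one_pCons)

lemmas emb_simps = ring_map_simps[OF ring_map_emb]

lemma emb_gens: "emb (pcst s) = cst s" "emb px = vx" "emb py = vy"
  by (simp_all add: emb_def pcst_def px_def py_def cst_def vx_def vy_def)

lemma emb_eq_0 [simp]: "emb u = 0 \<longleftrightarrow> u = 0"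
  by (simp add: emb_def)

lemma cst_eq_0 [simp]: "cst s = 0 \<longleftrightarrow> s = 0"
  by (simp add: cst_def)

lemma vars_neq_0 [simp]: "vx \<noteq> 0" "vy \<noteq> 0" "vz \<noteq> 0"
  by (simp_all add: vx_def vy_def vz_def)

lemma ev2_emb: "ev2 cst vx vy u = emb u"
  by (induction u rule: poly2_induct) (simp_all add: ev_cst emb_gens emb_simps)

lemma ev3_emb: "ring_map c \<Longrightarrow> ev3 c p q r (emb u) = ev2 c p q u"
  by (simp add: emb_def ev3_const)

lemma partial_emb [simp]: "dX (emb u) = emb (pdx u)" "dY (emb u) = emb (pdy u)" "dZ (emb u) = 0"
  by (simp_all add: emb_def dX_def dY_def dZ_def pdx_def pdy_def map_poly_pCons pderiv_pCons)

lemma quadratic_pCons: "emb q + emb p * vz + emb s * vz ^ 2 = [:q, p, s:]"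
  by (simp add: emb_def vz_def power2_eq_square)

lemma linear_pCons: "emb q + emb p * vz = [:q, p:]"
  by (simp add: emb_def vz_def)

lemma monic_pCons: "vz ^ 2 + emb q = [:q, 0, 1:]"
  by (simp add: emb_def vz_def power2_eq_square)

lemma not_dvd_degree: "(f :: 'a::idom poly) \<noteq> 0 \<Longrightarrow> degree f < degree Om \<Longrightarrow> \<not> Om dvd f"
  using dvd_imp_degree_le[of Om f] by auto

lemma emb_mem:
  assumes "subfield_over cst g F" "vx \<in> F" "vy \<in> F"
  shows "emb u \<in> F"
  by (induction u rule: poly2_induct)
    (simp_all add: emb_gens emb_simps assms subfield_overD(1-4)[OF assms(1)])

text \<open>Solving \<open>zp + q = 0\<close> for \<open>z\<close>.\<close>

lemma surface_linear:
  fixes p q :: "'k::field_char_0 poly poly"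
  assumes "irreducible (emb q + emb p * vz)" "p \<noteq> 0"
  shows "poisson_Q (emb q + emb p * vz) \<simeq>\<^sub>P plane_frac p"
proof (rule plane_to_surface)
  let ?Om = "emb q + emb p * vz"
  show "prime_elem ?Om" by (rule irreducible_imp_prime_poly3[OF assms(1)])
  have jac: "jac vx vy ?Om = emb p"
    by (simp add: jac_vars partial_simps)
  then show "jac vx vy ?Om = ev2 cst vx vy p" by (simp add: ev2_emb)
  have nd: "\<not> ?Om dvd emb p"
    using assms(2) by (intro not_dvd_degree) (simp_all add: linear_pCons, simp add: emb_def)
  then show "\<not> ?Om dvd jac vx vy ?Om" by (simp only: jac not_False_eq_True)
  fix F assume F: "subfield_over cst ?Om F" "vx \<in> F" "vy \<in> F"
  have "vz \<in> F"
    by (rule subfield_overD(5)[OF F(1) nd, of "- emb q"])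
      (use emb_mem[OF F] in \<open>auto intro: subfield_minus[OF F(1)] ring_map_cst simp: algebra_simps\<close>)
  then show "vx \<in> F \<and> vy \<in> F \<and> vz \<in> F" using F by simp
qed

text \<open>
  The relation \<open>\<Omega>(p,q,r) = 0\<close> yields the two brackets with \<open>r\<close> from the bracket of \<open>p\<close> and \<open>q\<close>.
\<close>

lemma surface_to_plane':
  fixes Om :: "'k::field_char_0 poly3"
  assumes Om: "irreducible Om" "degree Om > 0" "ev3 pcst p q r Om = 0"
    and br: "pbr h p q = ev3 pcst p q r (dZ Om)" "pbr h p q \<noteq> 0"
    and gen: "\<And>F. subfield_over pcst 0 F \<Longrightarrow> p \<in> F \<Longrightarrow> q \<in> F \<Longrightarrow> r \<in> F \<Longrightarrow> px \<in> F \<and> py \<in> F"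
  shows "poisson_Q Om \<simeq>\<^sub>P plane_frac h"
proof (rule surface_to_plane[OF irreducible_imp_prime_poly3[OF Om(1)] Om(2,3) br(1) _ _ br(2) gen])
  interpret poisson_presentation "poisson_plane h" "\<lambda>f. f" 0 "pbr h" pcst
    by (rule presentation_plane)
  have *: "ev3 pcst p q r (dX Om) * pbr h p w + ev3 pcst p q r (dY Om) * pbr h q w
      + ev3 pcst p q r (dZ Om) * pbr h r w = 0" for w
    using br_ev3[of p q r Om w] Om(3) by simp
  have "pbr h p q * (ev3 pcst p q r (dX Om) - pbr h q r) = 0"
    using *[of q] pbr_rules(3)[of h r q] br(1) by (simp add: pbr_rules(4) algebra_simps)
  then show "pbr h q r = ev3 pcst p q r (dX Om)" using br(2) by simp
  have "pbr h p q * (ev3 pcst p q r (dY Om) - pbr h r p) = 0"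
    using *[of p] pbr_rules(3)[of h q p] br(1) by (auto simp: pbr_rules(4) algebra_simps)
  then show "pbr h r p = ev3 pcst p q r (dY Om)" using br(2) by simp
qed

lemma poly2_nonzero: "ev2 (\<lambda>s. s) u v f \<noteq> 0 \<Longrightarrow> f \<noteq> (0 :: 'k::field poly poly)"
  by (auto simp: ring_map_zero[OF ring_map_ev2[OF ring_map_id]])

lemmas ev_id = ev2_simps[OF ring_map_id] ev3_simps[OF ring_map_id]

text \<open>
  With \<open>z = xw\<close> the equation becomes the conic \<open>w\<^sup>2 + \<alpha>y\<^sup>2 + \<gamma>x\<^sup>N = uv + \<gamma>x\<^sup>N = 0\<close>, whose points are
  \<open>x = st\<close>, \<open>u = t\<close>, \<open>v = -\<gamma>s\<^sup>Nt\<^sup>N\<^sup>-\<^sup>1\<close>.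
\<close>

lemma surface_conic:
  fixes \<alpha> \<gamma> :: "'k::{alg_closed_field, field_char_0}"
  assumes irr: "irreducible (vz ^ 2 + vx ^ 2 * (cst \<alpha> * vy ^ 2 + cst \<gamma> * vx ^ N))"
    and "\<alpha> \<noteq> 0" "N \<ge> 1"
  shows "\<exists>\<kappa>. \<kappa> \<noteq> 0 \<and>
    poisson_Q (vz ^ 2 + vx ^ 2 * (cst \<alpha> * vy ^ 2 + cst \<gamma> * vx ^ N)) \<simeq>\<^sub>P K_skew \<kappa>"
proof -
  let ?Om = "vz ^ 2 + vx ^ 2 * (cst \<alpha> * vy ^ 2 + cst \<gamma> * vx ^ N)"
  obtain \<delta> where \<delta>: "\<delta> ^ 2 = - \<alpha>" using exists_sqrt by blast
  then have \<delta>0: "\<delta> \<noteq> 0" using assms by auto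
  obtain M where N: "N = Suc M" using assms by (cases N) auto
  define v where "v = - pcst \<gamma> * px ^ N * py ^ M"
  \<comment> \<open>With \<delta>^2 = -\<alpha> the factors are u = w + \<delta>y and v = w -
    \<delta>y, so y = (u - v)/(2\<delta>) and w = (u + v)/2. Here s and t are \<open>px\<close> and
    \<open>py\<close>.\<close>
  define i j where "i = inverse (2 * \<delta>)" and "j = inverse (2 :: 'k)"
  let ?p = "px * py" and ?q = "pcst i * (py - v)" and ?r = "pcst j * px * py * (py + v)"
  have Om_eq: "?Om = vz ^ 2 + emb (px ^ 2 * (pcst \<alpha> * py ^ 2 + pcst \<gamma> * px ^ N))"
    by (simp add: emb_simps emb_gens)
  \<comment> \<open>The bracket {s,t} = 2\<delta>st is forced by {x,y} = \<Omega>_z = 2z.\<close>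
  have "poisson_Q ?Om \<simeq>\<^sub>P plane_frac (pcst (2 * \<delta>) * px * py)"
  proof (rule surface_to_plane'[OF irr])
    show "degree ?Om > 0" unfolding Om_eq monic_pCons by simp
    have "j ^ 2 = - (\<alpha> * i ^ 2)"
      using \<delta> \<delta>0 \<open>\<alpha> \<noteq> 0\<close> unfolding i_def j_def by (simp add: field_simps power2_eq_square)
    then have "pcst (j ^ 2) = pcst (- (\<alpha> * i ^ 2))" by simp
    then have j: "pcst j ^ 2 = - (pcst \<alpha> * pcst i ^ 2)" by (simp add: pcst_simps)
    have 4: "4 * pcst j ^ 2 = 1"
      unfolding pcst_simps[symmetric] j_def by (simp add: power2_eq_square)
    have "ev3 pcst ?p ?q ?r ?Om = (px * py) ^ 2 * (pcst j ^ 2 * (py + v) ^ 2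
        + pcst \<alpha> * pcst i ^ 2 * (py - v) ^ 2 + pcst \<gamma> * (px * py) ^ N)"
      by (simp add: ev_pcst algebra_simps power2_eq_square)
    also have "\<dots> = (px * py) ^ 2 * (4 * pcst j ^ 2 * py * v + pcst \<gamma> * (px * py) ^ N)"
      unfolding j by (simp add: algebra_simps power2_eq_square)
    also have "\<dots> = 0"
      unfolding 4 v_def N by (simp add: power_mult_distrib algebra_simps)
    finally show "ev3 pcst ?p ?q ?r ?Om = 0" .
    have M: "of_nat M * py ^ (M - 1) * py = (of_nat M * py ^ M :: 'k poly poly)"
      by (cases M) simp_all
    \<comment> \<open>Euler's relation: v is a monomial of bidegree (N, N - 1), so t v_t - s v_s =
      -v.\<close>
    have "px * py * (py * pdy v - px * pdx v) = px * py * (px ^ N * pcst \<gamma> * (of_nat N * py ^ M - of_nat M * py ^ (M - 1) * py))"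
    proof -
      have "pdx v = - (pcst \<gamma> * of_nat N * px ^ M * py ^ M)"
        "pdy v = - (pcst \<gamma> * px ^ N * of_nat M * py ^ (M - 1))"
        by (simp_all add: v_def N partial2_simps mult_ac del: power_Suc of_nat_Suc)
      note * = this
      show ?thesis unfolding * by (simp add: N algebra_simps)
    qed
    also have "\<dots> = - (px * py * v)"
      unfolding M v_def N by (simp add: algebra_simps)
    finally have v: "px * py * (py * pdy v - px * pdx v) = - (px * py * v)" .
    have "pbr (pcst (2 * \<delta>) * px * py) ?p ?q =
        pcst (2 * \<delta>) * pcst i * (px * py * py - px * py * (py * pdy v - px * pdx v))"
      by (simp add: pbr_def partial2_simps algebra_simps)
    also have "\<dots> = pcst (2 * \<delta> * i) * (px * py * (py + v))"
      unfolding v by (simp add: pcst_simps algebra_simps)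
    also have "2 * \<delta> * i = 1" using \<delta>0 by (simp add: i_def)
    finally have br: "pbr (pcst (2 * \<delta>) * px * py) ?p ?q = px * py * (py + v)"
      by (simp add: pcst_simps)
    have "2 * pcst j = 1" unfolding pcst_simps[symmetric] j_def by simp
    then have "2 * (pcst j * u) = u" for u by (simp add: mult.assoc[symmetric])
    then show "pbr (pcst (2 * \<delta>) * px * py) ?p ?q = ev3 pcst ?p ?q ?r (dZ ?Om)"
      unfolding br by (simp add: partial_simps ev_pcst mult.assoc)
    have "py + v \<noteq> 0"
      by (rule poly2_nonzero[of 0 1]) (simp add: v_def N ev_id)
    then show "pbr (pcst (2 * \<delta>) * px * py) ?p ?q \<noteq> 0" unfolding br by simp
    fix F :: "'k poly poly set"
    assume F: "subfield_over pcst 0 F" "?p \<in> F" "?q \<in> F" "?r \<in> F"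
    have a: "py - v \<in> F"
      by (rule subfield_divide0[OF F(1) _ F(3), of "pcst i"])
        (use \<delta>0 subfield_overD(1)[OF F(1)] in \<open>auto simp: i_def mult.commute\<close>)
    have b: "py + v \<in> F"
      by (rule subfield_divide0[OF F(1) _ F(4), of "pcst j * ?p"])
        (use subfield_overD(4)[OF F(1) subfield_overD(1)[OF F(1)] F(2), of j] in \<open>auto simp: j_def mult_ac\<close>)
    have A: "(py - v) + (py + v) \<in> F"
      by (rule a b | rule subfield_overD(1-4)[OF F(1)])+
    have "py \<in> F"
      by (rule subfield_divide0[OF F(1) _ A, of "pcst 2"])
        (use subfield_overD(1)[OF F(1), of 2] in \<open>auto simp: pcst_simps\<close>)
    moreover have "px \<in> F"
      by (rule subfield_divide0[OF F(1) _ F(2), of py]) (use \<open>py \<in> F\<close> in auto)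
    ultimately show "px \<in> F \<and> py \<in> F" by simp
  qed
  then show ?thesis unfolding K_skew_eq using \<delta>0 by (intro exI[of _ "2 * \<delta>"]) simp
qed

text \<open>Here the equation is linear in \<open>y\<close>; \<open>t\<close> is \<open>z/x\<^sup>n\<^sup>+\<^sup>2\<close> up to a constant.\<close>

lemma surface_linear_y:
  fixes \<beta> \<gamma> :: "'k::field_char_0"
  assumes irr: "irreducible (vz ^ 2 + vx ^ 2 * (cst \<beta> * vx ^ n * vy + cst \<gamma> * vx ^ (n + l)))"
    and "\<beta> \<noteq> 0"
  shows "poisson_Q (vz ^ 2 + vx ^ 2 * (cst \<beta> * vx ^ n * vy + cst \<gamma> * vx ^ (n + l))) \<simeq>\<^sub>P
    (K_Weyl :: ('k, _) poisson)"
  unfolding K_Weyl_eq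
proof (rule surface_to_plane'[OF irr])
  let ?Om = "vz ^ 2 + vx ^ 2 * (cst \<beta> * vx ^ n * vy + cst \<gamma> * vx ^ (n + l))"
  have Om_eq: "?Om = vz ^ 2 + emb (px ^ 2 * (pcst \<beta> * px ^ n * py + pcst \<gamma> * px ^ (n + l)))"
    by (simp add: emb_simps emb_gens)
  show "degree ?Om > 0" unfolding Om_eq monic_pCons by simp
  \<comment> \<open>The constant -\<beta> in z = -\<beta>x^(n+2)t is the one for which {x,y} = 2z
    becomes {x,t} = 1; y is then solved from the equation.\<close>
  let ?q = "- (pcst \<beta> * px ^ (n + 2) * py ^ 2 + pcst (\<gamma> / \<beta>) * px ^ l)"
  let ?r = "- (pcst \<beta> * px ^ (n + 2) * py)"
  have bg: "pcst \<beta> * pcst (\<gamma> / \<beta>) = pcst \<gamma>"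
    unfolding pcst_simps(2)[symmetric] using assms by simp
  then have *: "pcst \<beta> * (pcst (\<gamma> / \<beta>) * u) = pcst \<gamma> * u" for u
    by (simp add: mult.assoc[symmetric])
  show "ev3 pcst px ?q ?r ?Om = 0"
    by (simp add: ev_pcst algebra_simps power2_eq_square power_add bg *)
  have br: "pbr 1 px ?q = - (2 * pcst \<beta> * px ^ (n + 2) * py)"
    by (simp add: pbr_def partial2_simps algebra_simps)
  show "pbr 1 px ?q = ev3 pcst px ?q ?r (dZ ?Om)"
    unfolding br by (simp add: partial_simps ev_pcst)
  show "pbr 1 px ?q \<noteq> 0"
    unfolding br using assms by simp
  fix F :: "'k poly poly set"
  assume F: "subfield_over pcst 0 F" "px \<in> F" "?q \<in> F" "?r \<in> F"
  have "py \<in> F"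
    by (rule subfield_divide0[OF F(1), of "pcst (- \<beta>) * px ^ (n + 2)" ?r])
      (use F assms in \<open>auto simp: pcst_simps simp del: power_Suc
        intro!: subfield_overD(4)[OF F(1)] subfield_minus[OF F(1)] subfield_overD(1)[OF F(1)]
        subfield_over_power ring_map_pcst\<close>)
  then show "px \<in> F \<and> py \<in> F" using F by simp
qed

text \<open>With c = -\<gamma> the curve z^2 = c x^(2M+3) has the parametrization x = c s^2, z =
  c^(M+2) s^(2M+3), which needs no root of c because the exponent is odd. The variable y is free and
  is scaled by the parameter so that {x,y} = 2z becomes {s,t} = 1.\<close>

lemma surface_cylinder:
  fixes \<gamma> :: "'k::field_char_0"
  assumes irr: "irreducible (vz ^ 2 + cst \<gamma> * vx ^ (2 * M + 3))"
    and "\<gamma> \<noteq> 0"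
  shows "poisson_Q (vz ^ 2 + cst \<gamma> * vx ^ (2 * M + 3)) \<simeq>\<^sub>P (K_Weyl :: ('k, _) poisson)"
  unfolding K_Weyl_eq
proof (rule surface_to_plane'[OF irr])
  let ?Om = "vz ^ 2 + cst \<gamma> * vx ^ (2 * M + 3)"
  have Om_eq: "?Om = vz ^ 2 + emb (pcst \<gamma> * px ^ (2 * M + 3))"
    by (simp add: emb_simps emb_gens)
  show "degree ?Om > 0" unfolding Om_eq monic_pCons by simp
  define c where "c = pcst (- \<gamma>)"
  have c: "c \<noteq> 0" "pcst \<gamma> = - c" using assms by (simp_all add: c_def pcst_simps)
  let ?p = "c * px ^ 2" and ?q = "c ^ (M + 1) * px ^ (2 * M + 2) * py" and ?r = "c ^ (M + 2) * px ^ (2 * M + 3)"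
  have "?r ^ 2 = c * ?p ^ (2 * M + 3)"
    unfolding power_mult_distrib power_mult[symmetric] by (simp add: algebra_simps numeral_eq_Suc)
  then show "ev3 pcst ?p ?q ?r ?Om = 0"
    by (simp add: ev_pcst c(2))
  have br: "pbr 1 ?p ?q = 2 * c ^ (M + 2) * px ^ (2 * M + 3)"
    by (simp add: pbr_def partial2_simps c_def pcst_simps algebra_simps power2_eq_square
      is_deriv_power[OF is_deriv_partial2(2)] numeral_3_eq_3)
  show "pbr 1 ?p ?q = ev3 pcst ?p ?q ?r (dZ ?Om)"
    unfolding br by (simp add: partial_simps ev_pcst)
  show "pbr 1 ?p ?q \<noteq> 0"
    unfolding br using c by simp
  fix F :: "'k poly poly set"
  assume F: "subfield_over pcst 0 F" "?p \<in> F" "?q \<in> F" "?r \<in> F"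
  have cF: "c \<in> F" unfolding c_def by (rule subfield_overD(1)[OF F(1)])
  have "px \<in> F"
  proof (rule subfield_divide0[OF F(1) _ F(4), of "c * ?p ^ (M + 1)"])
    show "c * ?p ^ (M + 1) \<noteq> 0" using c by simp
    show "c * ?p ^ (M + 1) \<in> F"
      by (rule F(2-) cF | rule subfield_overD(1-4)[OF F(1)] subfield_over_power[OF F(1) ring_map_pcst])+
    show "px * (c * ?p ^ (M + 1)) = ?r"
      unfolding power_mult_distrib power_mult[symmetric]
      by (simp add: algebra_simps numeral_3_eq_3)
  qed
  moreover have "py \<in> F"
  proof (rule subfield_divide0[OF F(1) _ F(3), of "c ^ (M + 1) * px ^ (2 * M + 2)"])
    show "c ^ (M + 1) * px ^ (2 * M + 2) \<noteq> 0" using c by simp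
    show "c ^ (M + 1) * px ^ (2 * M + 2) \<in> F"
      by (rule F(2-) cF \<open>px \<in> F\<close> | rule subfield_overD(1-4)[OF F(1)] subfield_over_power[OF F(1) ring_map_pcst])+
  qed (simp add: mult_ac)
  ultimately show "px \<in> F \<and> py \<in> F" by simp
qed

text \<open>Put t = z/y, the projection from the line y = z = 0. The equation becomes t^2 +
  \<alpha>y + \<beta>x^2 = 0, so x and t generate the field, and {x,y} = 2z turns into {x,t} = t^2 +
  \<beta>x^2.\<close>

lemma surface_double_root:
  fixes \<alpha> \<beta> :: "'k::{alg_closed_field, field_char_0}"
  assumes irr: "irreducible (vz ^ 2 + cst \<alpha> * vy ^ 3 + cst \<beta> * vx ^ 2 * vy ^ 2)" and "\<alpha> \<noteq> 0"
  shows "poisson_Q (vz ^ 2 + cst \<alpha> * vy ^ 3 + cst \<beta> * vx ^ 2 * vy ^ 2) \<simeq>\<^sub>P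
    plane_frac (pcst \<beta> * px ^ 2 + pcst 0 * px * py + pcst 1 * py ^ 2)"
proof (rule surface_to_plane'[OF irr])
  let ?Om = "vz ^ 2 + cst \<alpha> * vy ^ 3 + cst \<beta> * vx ^ 2 * vy ^ 2"
  have Om_eq: "?Om = vz ^ 2 + emb (pcst \<alpha> * py ^ 3 + pcst \<beta> * px ^ 2 * py ^ 2)"
    by (simp add: emb_simps emb_gens)
  show "degree ?Om > 0" unfolding Om_eq monic_pCons by simp
  let ?h = "pcst \<beta> * px ^ 2 + pcst 0 * px * py + pcst 1 * py ^ 2"
  let ?q = "- (pcst (inverse \<alpha>) * (py ^ 2 + pcst \<beta> * px ^ 2))"
  have *: "pcst \<alpha> * (pcst (inverse \<alpha>) * u) = u" for u
    using assms by (simp add: mult.assoc[symmetric] pcst_simps(2)[symmetric]) (simp add: pcst_simps)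
  have q: "pcst \<alpha> * ?q = - (py ^ 2 + pcst \<beta> * px ^ 2)"
    by (simp add: *)
  have "ev3 pcst px ?q (?q * py) ?Om = ?q ^ 2 * (py ^ 2 + pcst \<alpha> * ?q + pcst \<beta> * px ^ 2)"
    by (simp add: ev_pcst algebra_simps power2_eq_square power3_eq_cube)
  then show "ev3 pcst px ?q (?q * py) ?Om = 0"
    unfolding q by simp
  have br: "pbr ?h px ?q = 2 * (?q * py)"
    by (simp add: pbr_def partial2_simps pcst_simps algebra_simps)
  show "pbr ?h px ?q = ev3 pcst px ?q (?q * py) (dZ ?Om)"
    unfolding br by (simp add: partial_simps ev_pcst)
  have q0: "?q \<noteq> 0"
    by (rule poly2_nonzero[of 0 1]) (use assms in \<open>simp add: ev_id\<close>)
  then show "pbr ?h px ?q \<noteq> 0" unfolding br by simp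
  fix F :: "'k poly poly set"
  assume F: "subfield_over pcst 0 F" "px \<in> F" "?q \<in> F" "?q * py \<in> F"
  have "py \<in> F"
    by (rule subfield_divide0[OF F(1) q0 F(4,3)]) (simp add: mult_ac)
  then show "px \<in> F \<and> py \<in> F" using F by simp
qed

text \<open>The curve is parametrized by x = c s^n, z = s^m with c^m = -\<beta>/\<alpha>. The free
  variable y is (\<beta>/c) s^e t with e = (m - 1)(n - 1), which makes {x,y} = n\<beta>z^(n-1)
  equivalent to {s,t} = 1.\<close>

lemma surface_cusp:
  fixes \<alpha> \<beta> :: "'k::{alg_closed_field, field_char_0}"
  assumes irr: "irreducible (cst \<alpha> * vx ^ m + cst \<beta> * vz ^ n)"
    and nz: "\<alpha> \<noteq> 0" "\<beta> \<noteq> 0" and mn: "m \<ge> 1" "n \<ge> 1" "coprime m n"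
  shows "poisson_Q (cst \<alpha> * vx ^ m + cst \<beta> * vz ^ n) \<simeq>\<^sub>P (K_Weyl :: ('k, _) poisson)"
  unfolding K_Weyl_eq
proof -
  obtain c where c: "c ^ m = - \<beta> / \<alpha>" using nth_root_exists[of m] mn by auto
  have c0: "c \<noteq> 0" using c nz mn by (auto simp: power_0_left)
  let ?Om = "cst \<alpha> * vx ^ m + cst \<beta> * vz ^ n"
  let ?e = "(m - 1) * (n - 1)"
  let ?p = "pcst c * px ^ n" and ?q = "pcst (\<beta> / c) * px ^ ?e * py" and ?r = "px ^ m :: 'k poly poly"
  show "poisson_Q ?Om \<simeq>\<^sub>P plane_frac 1"
  proof (rule surface_to_plane'[OF irr])
    show "degree ?Om > 0"
    proof -
      have "?Om = emb (pcst \<alpha> * px ^ m) + monom [:[:\<beta>:]:] n"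
        by (simp add: emb_simps emb_gens cst_def vz_def monom_altdef)
      moreover have "degree (monom [:[:\<beta>:]:] n) = n"
        using nz by (simp add: degree_monom_eq)
      ultimately show ?thesis
        using mn by (simp add: emb_def degree_add_eq_right)
    qed
    have "ev3 pcst ?p ?q ?r ?Om = pcst (\<alpha> * c ^ m + \<beta>) * px ^ (m * n)"
      by (simp add: ev_pcst pcst_simps power_mult_distrib power_mult[symmetric] algebra_simps)
    also have "\<alpha> * c ^ m + \<beta> = 0" using c nz by simp
    finally show "ev3 pcst ?p ?q ?r ?Om = 0" by (simp add: pcst_simps)
    have e: "(n - 1) + ?e = m * (n - 1)"
      using mn by (cases m) (simp_all)
    have "pbr 1 ?p ?q = (pcst c * pcst (\<beta> / c)) * of_nat n * px ^ ((n - 1) + ?e)"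
      unfolding power_add
      by (simp add: pbr_def partial2_simps algebra_simps)
    also have "pcst c * pcst (\<beta> / c) = pcst \<beta>"
      unfolding pcst_simps(2)[symmetric] using c0 by simp
    finally have br: "pbr 1 ?p ?q = pcst \<beta> * of_nat n * px ^ (m * (n - 1))"
      unfolding e .
    show "pbr 1 ?p ?q = ev3 pcst ?p ?q ?r (dZ ?Om)"
      unfolding br by (simp add: partial_simps ev_pcst power_mult[symmetric] algebra_simps)
    show "pbr 1 ?p ?q \<noteq> 0"
      unfolding br using nz mn by simp
    fix F :: "'k poly poly set"
    assume F: "subfield_over pcst 0 F" "?p \<in> F" "?q \<in> F" "?r \<in> F"
    have pn: "px ^ n \<in> F"
      by (rule subfield_divide0[OF F(1) _ F(2), of "pcst c"])
        (use c0 subfield_overD(1)[OF F(1)] in \<open>auto simp: mult.commute\<close>)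
    \<comment> \<open>Coprimality enters through Bezout: s is the quotient of s^(na) by
      s^(mb).\<close>
    obtain a b where ab: "n * a = m * b + 1"
      using bezout_nat[of n m] mn by (auto simp: coprime_iff_gcd_eq_1 gcd.commute)
    have "px \<in> F"
    proof (rule subfield_divide0[OF F(1)])
      show "(px ^ m) ^ b \<noteq> (0 :: 'k poly poly)" by simp
      show "(px ^ n) ^ a \<in> F" "(px ^ m) ^ b \<in> F"
        using pn F by (simp_all add: subfield_over_power ring_map_pcst)
      show "px * (px ^ m) ^ b = (px ^ n) ^ a"
        unfolding power_mult[symmetric] ab by simp
    qed
    moreover have "py \<in> F"
    proof (rule subfield_divide0[OF F(1) _ F(3), of "pcst (\<beta> / c) * px ^ ?e"])
      show "pcst (\<beta> / c) * px ^ ?e \<noteq> 0" using nz c0 by simp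
      show "pcst (\<beta> / c) * px ^ ?e \<in> F"
        by (rule F(2-) \<open>px \<in> F\<close> | rule subfield_overD(1-4)[OF F(1)] subfield_over_power[OF F(1) ring_map_pcst])+
    qed (simp add: mult_ac)
    ultimately show "px \<in> F \<and> py \<in> F" by simp
  qed
qed

section \<open>Coordinate changes\<close>

definition sing :: "'k::field poly3 \<Rightarrow> 'k \<Rightarrow> 'k \<Rightarrow> 'k \<Rightarrow> bool" where
  "sing Om u v w \<longleftrightarrow> ev3 (\<lambda>s. s) u v w (dX Om) = 0 \<and> ev3 (\<lambda>s. s) u v w (dY Om) = 0 \<and>
     ev3 (\<lambda>s. s) u v w (dZ Om) = 0"

lemma isolated_singularity_iff:
  "isolated_singularity Om \<longleftrightarrow> (\<forall>u v w. sing Om u v w \<longleftrightarrow> u = 0 \<and> v = 0 \<and> w = 0)"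
  by (auto simp: isolated_singularity_def sing_def eval3_eq set_eq_iff)

lemma sing_subst:
  assumes "sing Om (ev3 (\<lambda>s. s) u v w p) (ev3 (\<lambda>s. s) u v w q) (ev3 (\<lambda>s. s) u v w r)"
    and "ev3 cst p q r Om = cst \<kappa> * Om'" "\<kappa> \<noteq> 0"
  shows "sing Om' u v w"
proof -
  let ?E = "ev3 (\<lambda>s. s) u v w"
  have comp: "?E (ev3 cst p q r f) = ev3 (\<lambda>s. s) (?E p) (?E q) (?E r) f" for f
    by (rule ev3_comp[OF ring_map_cst ring_map_ev3[OF ring_map_id]]) (simp add: ev_id)
  have "?E (d Om') = 0" if d: "is_deriv d" "\<And>s. d (cst s) = 0" for d
  proof -
    have "?E (d (ev3 cst p q r Om)) = 0"
      using assms(1) unfolding chain_rule[OF d(1) ring_map_cst d(2)]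
      by (simp add: ev_id comp sing_def)
    also have "d (ev3 cst p q r Om) = cst \<kappa> * d Om'"
      unfolding assms(2) by (simp add: is_deriv_mult[OF d(1)] d(2))
    finally show ?thesis using assms(3) by (simp add: ev_id)
  qed
  then show ?thesis unfolding sing_def using is_deriv_partial partial_gens(1,5,9) by blast
qed

text \<open>Irreducibility and the nature of the singularity travel along with the field, so that a
  chain of normalizations keeps the hypotheses of the classification available.\<close>

definition surface_equiv :: "'k::field poly3 \<Rightarrow> 'k poly3 \<Rightarrow> bool" where
  "surface_equiv Om Om' \<longleftrightarrow> (irreducible Om' \<longleftrightarrow> irreducible Om) \<and>
     (isolated_singularity Om' \<longleftrightarrow> isolated_singularity Om) \<and>
     (irreducible Om \<longrightarrow> poisson_Q Om \<simeq>\<^sub>P poisson_Q Om')"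

lemma surface_equiv_trans:
  "surface_equiv Om Om' \<Longrightarrow> surface_equiv Om' Om'' \<Longrightarrow> surface_equiv Om Om''"
  unfolding surface_equiv_def using is_poisson_iso_trans by blast

lemma cst_cancel: "s \<noteq> 0 \<Longrightarrow> cst s * (cst (inverse s) * u) = u"
    "s \<noteq> 0 \<Longrightarrow> cst (inverse s) * (cst s * u) = u"
  by (simp_all add: mult.assoc[symmetric] flip: cst_simps(2)) (simp_all add: cst_simps)

text \<open>The substitution has to fix the origin because an isolated singularity is required to
  lie there. Singular points correspond by the chain rule applied to the substitution and to its
  inverse.\<close>

lemma surface_equivI:
  fixes Om :: "'k::field_char_0 poly3"
  assumes inv: "inverse_subst p q r p' q' r'"
    and m: "ev3 cst p q r Om = cst \<kappa> * Om'" "jac p q r = cst \<kappa>" "\<kappa> \<noteq> 0"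
    and origin: "ev3 (\<lambda>s. s) 0 0 0 p = 0" "ev3 (\<lambda>s. s) 0 0 0 q = 0" "ev3 (\<lambda>s. s) 0 0 0 r = 0"
  shows "surface_equiv Om Om'"
proof -
  let ?E = "ev3 (\<lambda>s. s)"
  have comp: "?E u v w (ev3 cst p q r f) = ?E (?E u v w p) (?E u v w q) (?E u v w r) f"
    for u v w p q r f
    by (rule ev3_comp[OF ring_map_cst ring_map_ev3[OF ring_map_id]]) (simp add: ev_id)
  have m': "ev3 cst p' q' r' Om' = cst (inverse \<kappa>) * Om"
  proof -
    have "ev3 cst p' q' r' (ev3 cst p q r Om) = cst \<kappa> * ev3 cst p' q' r' Om'"
      unfolding m(1) by (simp add: ev_cst)
    then show ?thesis
      using inverse_subst_ev3[OF inverse_subst_sym[OF inv]] cst_cancel(2)[OF m(3)] by simp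
  qed
  have round: "?E (?E u v w p') (?E u v w q') (?E u v w r') p = u"
    "?E (?E u v w p') (?E u v w q') (?E u v w r') q = v"
    "?E (?E u v w p') (?E u v w q') (?E u v w r') r = w"
    "?E (?E u v w p) (?E u v w q) (?E u v w r) p' = u"
    "?E (?E u v w p) (?E u v w q) (?E u v w r) q' = v"
    "?E (?E u v w p) (?E u v w q) (?E u v w r) r' = w" for u v w
    using inv unfolding comp[symmetric] inverse_subst_def by (simp_all add: ev_id)
  have origin': "?E 0 0 0 p' = 0" "?E 0 0 0 q' = 0" "?E 0 0 0 r' = 0"
    using round(4-6)[of 0 0 0] unfolding origin by simp_all
  have sing: "sing Om' u v w \<longleftrightarrow> sing Om (?E u v w p) (?E u v w q) (?E u v w r)" for u v w
  proof
    assume "sing Om (?E u v w p) (?E u v w q) (?E u v w r)"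
    then show "sing Om' u v w" using sing_subst m by blast
  next
    assume "sing Om' u v w"
    then show "sing Om (?E u v w p) (?E u v w q) (?E u v w r)"
      using sing_subst[OF _ m', of "?E u v w p" "?E u v w q" "?E u v w r"] m(3)
      unfolding round by simp
  qed
  have zero: "u = 0 \<and> v = 0 \<and> w = 0 \<longleftrightarrow> ?E u v w p = 0 \<and> ?E u v w q = 0 \<and> ?E u v w r = 0" for u v w
    using round(4-6)[of u v w] origin origin' by auto
  have "isolated_singularity Om' \<longleftrightarrow> isolated_singularity Om"
  proof
    assume iso: "isolated_singularity Om"
    show "isolated_singularity Om'"
      unfolding isolated_singularity_iff
    proof (intro allI)
      fix u v w
      show "sing Om' u v w \<longleftrightarrow> u = 0 \<and> v = 0 \<and> w = 0"
        unfolding sing iso[unfolded isolated_singularity_iff, rule_format] using zero[of u v w] by argo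
    qed
  next
    assume iso: "isolated_singularity Om'"
    show "isolated_singularity Om"
      unfolding isolated_singularity_iff
    proof (intro allI)
      fix u v w
      have "sing Om u v w \<longleftrightarrow> sing Om' (?E u v w p') (?E u v w q') (?E u v w r')"
        unfolding sing round by simp
      also have "\<dots> \<longleftrightarrow> u = 0 \<and> v = 0 \<and> w = 0"
        using iso zero[of "?E u v w p'" "?E u v w q'" "?E u v w r'"]
        unfolding isolated_singularity_iff round by simp
      finally show "sing Om u v w \<longleftrightarrow> u = 0 \<and> v = 0 \<and> w = 0" .
    qed
  qed
  then show ?thesis
    unfolding surface_equiv_def
    using irreducible_inverse_subst[OF inv m(3,1)] surface_automorphism[OF _ inv m] by blast
qed

lemma surface_equiv_shear_z:
  fixes Om :: "'k::field_char_0 poly3"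
  shows "surface_equiv Om (ev3 cst (vx + cst u * vz) (vy + cst v * vz) vz Om)"
proof (rule surface_equivI[where \<kappa> = 1])
  show "inverse_subst (vx + cst u * vz) (vy + cst v * vz) vz
      (vx - cst u * vz) (vy - cst v * vz) vz"
    by (simp add: inverse_subst_def ev_cst)
qed (simp_all add: cst_simps jac_def partial_simps ev_id)

lemma surface_equiv_shift_y:
  fixes Om :: "'k::field_char_0 poly3"
  assumes "n \<ge> 1"
  shows "surface_equiv Om (ev3 cst vx (vy + cst c * vx ^ n) vz Om)"
proof (rule surface_equivI[where \<kappa> = 1])
  show "inverse_subst vx (vy + cst c * vx ^ n) vz vx (vy - cst c * vx ^ n) vz"
    by (simp add: inverse_subst_def ev_cst)
qed (use assms in \<open>simp_all add: cst_simps jac_def partial_simps ev_id power_0_left\<close>)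

lemma surface_equiv_shift_x:
  fixes Om :: "'k::field_char_0 poly3"
  shows "surface_equiv Om (ev3 cst (vx + cst c * vy) vy vz Om)"
proof (rule surface_equivI[where \<kappa> = 1])
  show "inverse_subst (vx + cst c * vy) vy vz (vx - cst c * vy) vy vz"
    by (simp add: inverse_subst_def ev_cst)
qed (simp_all add: cst_simps jac_def partial_simps ev_id)

text \<open>The substitution of (z - p/2)/\<alpha> for z has Jacobian 1/\<alpha>, and it multiplies
  the potential by the same factor 1/\<alpha> once the new constant term is written as \<alpha>q -
  p^2/4.\<close>

lemma surface_equiv_complete_square:
  fixes p q :: "'k::field_char_0 poly poly"
  assumes "\<alpha> \<noteq> 0" "ev2 (\<lambda>s. s) 0 0 p = 0"
  shows "surface_equiv (emb q + emb p * vz + cst \<alpha> * vz ^ 2)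
    (vz ^ 2 + emb (pcst \<alpha> * q - pcst (1 / 4) * p ^ 2))"
proof (rule surface_equivI[where \<kappa> = "inverse \<alpha>"])
  let ?r = "cst (inverse \<alpha>) * (vz - cst (1 / 2) * emb p)"
  show "inverse_subst vx vy ?r vx vy (cst \<alpha> * vz + cst (1 / 2) * emb p)"
    using assms by (simp add: inverse_subst_def ev_cst ev3_emb ring_map_cst ev2_emb cst_cancel)
  have 2: "cst (1 / 2) * 2 = (1 :: 'k poly3)" "cst (1 / 4) * 2 = (cst (1 / 2) :: 'k poly3)"
    "cst (1 / 2) * cst (1 / 2) = (cst (1 / 4) :: 'k poly3)"
    unfolding cst_simps(9)[symmetric] cst_simps(2)[symmetric] by (simp_all add: cst_simps)
  have half: "cst (1 / 2) * u + cst (1 / 2) * u = u" for u :: "'k poly3"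
    using 2(1) by (metis mult.assoc mult.commute mult_1 mult_2)
  have sq: "cst \<alpha> * ?r ^ 2 = cst (inverse \<alpha>) * (vz - cst (1 / 2) * emb p) ^ 2"
    using assms by (simp add: power2_eq_square mult_ac cst_cancel)
  have q: "emb q = cst (inverse \<alpha>) * (cst \<alpha> * emb q)"
    using assms by (simp add: cst_cancel)
  have "ev3 cst vx vy ?r (emb q + emb p * vz + cst \<alpha> * vz ^ 2) =
      cst (inverse \<alpha>) * (cst \<alpha> * emb q + emb p * (vz - cst (1 / 2) * emb p) + (vz - cst (1 / 2) * emb p) ^ 2)"
    unfolding distrib_left sq[symmetric] q[symmetric]
    by (simp add: ev_cst ev3_emb ring_map_cst ev2_emb mult_ac)
  moreover have "emb p * (vz - cst (1 / 2) * emb p) + (vz - cst (1 / 2) * emb p) ^ 2 =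
      vz ^ 2 - cst (1 / 4) * emb p ^ 2"
  proof -
    have "emb p * (vz - cst (1 / 2) * emb p) + (vz - cst (1 / 2) * emb p) ^ 2 =
      vz ^ 2 + (emb p * vz - (cst (1 / 2) * (emb p * vz) + cst (1 / 2) * (emb p * vz)))
        - emb p ^ 2 * cst (1 / 2) + (cst (1 / 2) * cst (1 / 2)) * emb p ^ 2"
      by (simp add: algebra_simps power2_eq_square)
    also have "emb p ^ 2 * cst (1 / 2) = cst (1 / 4) * emb p ^ 2 + cst (1 / 4) * emb p ^ 2"
      unfolding 2(2)[symmetric] by (simp add: algebra_simps)
    finally show ?thesis unfolding half 2(3) by simp
  qed
  ultimately show "ev3 cst vx vy ?r (emb q + emb p * vz + cst \<alpha> * vz ^ 2) =
      cst (inverse \<alpha>) * (vz ^ 2 + emb (pcst \<alpha> * q - pcst (1 / 4) * p ^ 2))"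
    by (simp add: emb_simps emb_gens add.assoc)
  have "ev3 (\<lambda>s. s) 0 0 0 (emb p) = 0"
    using assms by (simp add: ev3_emb ring_map_id)
  then show "ev3 (\<lambda>s. s) 0 0 0 ?r = 0"
    by (simp add: ev_id)
qed (use assms in \<open>simp_all add: jac_def partial_simps cst_simps ev_id\<close>)


section \<open>Irreducibility criteria\<close>

lemma irreducible_monic_quadratic:
  fixes g :: "'a::idom"
  shows "irreducible [:g, 0, 1:] \<longleftrightarrow> (\<forall>b. g \<noteq> - (b ^ 2))"
proof
  assume irr: "irreducible [:g, 0, 1:]"
  show "\<forall>b. g \<noteq> - (b ^ 2)"
  proof (intro allI notI)
    fix b assume "g = - (b ^ 2)"
    then have "[:g, 0, 1:] = [:b, 1:] * [:- b, 1:]" by (simp add: power2_eq_square)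
    then have "[:b, 1:] dvd 1 \<or> [:- b, 1:] dvd 1"
      using irr by (rule irreducibleD[rotated])
    then show False by (auto simp: is_unit_pCons_iff is_unit_poly_iff)
  qed
next
  assume sq: "\<forall>b. g \<noteq> - (b ^ 2)"
  show "irreducible [:g, 0, 1:]"
  proof (rule irreducibleI)
    fix A B assume AB: "[:g, 0, 1:] = A * B"
    then have nz: "A \<noteq> 0" "B \<noteq> 0" by auto
    then have deg: "degree A + degree B = 2"
      using arg_cong[OF AB, of degree] by (simp add: degree_mult_eq)
    have lc: "lead_coeff A * lead_coeff B = 1"
      using arg_cong[OF AB, of lead_coeff] by (simp add: lead_coeff_mult)
    have unit: "C dvd 1" if "degree C = 0" "lead_coeff C dvd 1" for C :: "'a poly"
      using that by (auto elim!: degree_eq_zeroE simp: is_unit_const_poly_iff)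
    have "\<not> (degree A = 1 \<and> degree B = 1)"
    proof
      assume "degree A = 1 \<and> degree B = 1"
      then obtain a0 a1 b0 b1 where "A = [:a0, a1:]" "B = [:b0, b1:]"
        by (metis degree1_coeffs)
      then have *: "g = a0 * b0" "a0 * b1 + a1 * b0 = 0" "a1 * b1 = 1"
        using AB by (auto simp: algebra_simps)
      have "b0 = (a1 * b1) * b0" using * by simp
      also have "\<dots> = b1 * (a1 * b0)" by (simp add: mult_ac)
      also have "a1 * b0 = - (a0 * b1)" using *(2) by (simp add: eq_neg_iff_add_eq_0 add.commute)
      finally have "g = - ((a0 * b1) ^ 2)" using *(1) by (simp add: power2_eq_square mult_ac)
      then show False using sq by blast
    qed
    then have "degree A = 0 \<or> degree B = 0" using deg by linarith
    then show "A dvd 1 \<or> B dvd 1"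
      using unit lc by (metis dvd_triv_left dvd_triv_right)
  qed (simp_all add: is_unit_poly_iff)
qed

text \<open>A proper factorization contains a linear factor; as the leading coefficients are units,
  that factor yields a root.\<close>

lemma irreducible_monic_cubic:
  fixes b c :: "'a::idom"
  assumes "\<And>l. l ^ 3 + b * l + c \<noteq> 0"
  shows "irreducible [:c, b, 0, 1:]"
proof (rule irreducibleI)
  have root: False if AB: "[:c, b, 0, 1:] = A * B" and d: "degree A = 1" and lc: "lead_coeff A * u = 1"
    for A B u
  proof -
    obtain a0 a1 where A: "A = [:a0, a1:]" using d by (metis degree1_coeffs)
    have "u * a1 = 1" using d lc A by (auto split: if_splits simp: mult.commute)
    then have "poly A (- (a0 * u)) = 0" by (simp add: A mult.assoc mult.commute[of a1])
    then have "poly [:c, b, 0, 1:] (- (a0 * u)) = 0" unfolding AB by simp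
    then show False using assms[of "- (a0 * u)"] by (simp add: power3_eq_cube algebra_simps)
  qed
  fix A B assume AB: "[:c, b, 0, 1:] = A * B"
  then have nz: "A \<noteq> 0" "B \<noteq> 0" by auto
  then have deg: "degree A + degree B = 3"
    using arg_cong[OF AB, of degree] by (simp add: degree_mult_eq)
  have lc: "lead_coeff A * lead_coeff B = 1"
    using arg_cong[OF AB, of lead_coeff] by (simp add: lead_coeff_mult)
  have unit: "C dvd 1" if "degree C = 0" "lead_coeff C dvd 1" for C :: "'a poly"
    using that by (auto elim!: degree_eq_zeroE simp: is_unit_const_poly_iff)
  have "degree A \<noteq> 1" using root[OF AB _ lc] by blast
  moreover have "degree B \<noteq> 1"
    using root[of B A "lead_coeff A"] AB lc by (metis mult.commute)
  ultimately have "degree A = 0 \<or> degree B = 0" using deg by linarith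
  then show "A dvd 1 \<or> B dvd 1"
    using unit lc by (metis dvd_triv_left dvd_triv_right)
qed (simp_all add: is_unit_poly_iff)

lemma not_minus_square_odd: "odd (degree g) \<Longrightarrow> g \<noteq> - (b ^ 2)" for g b :: "'a::idom poly"
  by (auto simp: degree_power_eq[of b 2] power2_eq_square degree_mult_eq) (metis degree_0 degree_mult_eq even_add even_zero mult_zero_left)

lemma irreducible_monic_odd:
  "odd (degree g) \<Longrightarrow> irreducible (vz ^ 2 + emb g)"
  unfolding monic_pCons irreducible_monic_quadratic using not_minus_square_odd by blast

lemma px_power: "px ^ n = [:monom 1 n:]"
  by (induction n) (simp_all add: px_def monom_Suc monom_0 mult_monom one_pCons)

lemma py_power: "py ^ 2 = [:0, 0, 1:]" "py ^ 3 = [:0, 0, 0, 1:]" "py ^ 4 = [:0, 0, 0, 0, 1:]"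
  by (simp_all add: py_def eval_nat_numeral)

lemma binary_pCons:
  "pcst a4 * px ^ n4 * py ^ 4 + pcst a3 * px ^ n3 * py ^ 3 + pcst a2 * px ^ n2 * py ^ 2
    + pcst a1 * px ^ n1 * py + pcst a0 * px ^ n0 =
    [:monom a0 n0, monom a1 n1, monom a2 n2, monom a3 n3, monom a4 n4:]"
  unfolding px_power py_power by (simp add: pcst_def py_def smult_monom)


section \<open>Elliptic surfaces\<close>

definition hesse :: "'k::field \<Rightarrow> 'k \<Rightarrow> 'k poly3" where
  "hesse \<zeta> l = cst \<zeta> * (vx ^ 3 + vy ^ 3 + vz ^ 3) + cst l * vx * vy * vz"

lemma poisson_S_eq: "poisson_S \<zeta> l = poisson_Q (hesse \<zeta> l)"
  by (simp only: poisson_S_def hesse_def cst_def vx_def vy_def vz_def)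

text \<open>A root in z would be a plane contained in the cubic cone. Degrees in y force l = l0 + l1
  y, and comparing coefficients gives l0^3 = -x^3, l1^3 = -1 and 3 l0 l1 = -s x. Cubing the last
  equation leaves 27 = -s^3.\<close>

lemma hesse_no_root:
  fixes l :: "'k::field_char_0 poly poly"
  assumes "l ^ 3 + pcst s * px * py * l + (px ^ 3 + py ^ 3) = 0"
  shows "s ^ 3 = - 27"
proof -
  have "degree (l ^ 3) = 3 * degree l"
    by (cases "l = 0") (simp_all add: degree_power_eq)
  moreover have "degree (pcst s * px * py * l) \<le> degree l + 1"
    using degree_mult_le[of "pcst s * px * py" l] by (simp add: pcst_def px_def py_def)
  moreover have "degree (px ^ 3 + py ^ 3 :: 'k poly poly) \<le> 3"
    unfolding px_power py_power by simp
  moreover have "l ^ 3 = - (pcst s * px * py * l + (px ^ 3 + py ^ 3))"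
    using assms by (simp only: eq_neg_iff_add_eq_0 add.assoc)
  moreover have "degree (- (pcst s * px * py * l + (px ^ 3 + py ^ 3))) \<le>
      max (degree (pcst s * px * py * l)) (degree (px ^ 3 + py ^ 3 :: 'k poly poly))"
    unfolding degree_minus by (rule degree_add_le_max)
  ultimately have "degree l \<le> 1" by (auto simp: max_def split: if_splits)
  define l0 l1 where "l0 = coeff l 0" and "l1 = coeff l 1"
  have l: "l = [:l0, l1:]"
  proof (rule poly_eqI)
    fix n
    show "coeff l n = coeff [:l0, l1:] n"
      using \<open>degree l \<le> 1\<close> coeff_eq_0[of l n]
      by (cases "n \<le> 1") (auto simp: coeff_pCons l0_def l1_def le_Suc_eq split: nat.splits)
  qed
  define x where "x = ([:0, 1:] :: 'k poly)"
  have three: "Polynomial.smult 3 u = u + Polynomial.smult 2 u" for u :: "'k poly"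
    using smult_add_left[of 1 2 u] by simp
  have "[:l0 ^ 3 + x ^ 3, 3 * l0 ^ 2 * l1 + [:s:] * x * l0, 3 * l0 * l1 ^ 2 + [:s:] * x * l1, l1 ^ 3 + 1:] = 0"
    using assms unfolding l py_power
    by (simp add: power3_eq_cube power2_eq_square pcst_def px_def py_def x_def algebra_simps numeral_poly three)
  then have *: "l0 ^ 3 = - (x ^ 3)" "l1 * (3 * l0 * l1 + [:s:] * x) = 0" "l1 ^ 3 = - 1"
    by (simp_all add: algebra_simps power2_eq_square eq_neg_iff_add_eq_0)
  then have "l1 \<noteq> 0" by auto
  then have "3 * l0 * l1 = - ([:s:] * x)" using *(2) by (simp add: eq_neg_iff_add_eq_0)
  then have "(3 * l0 * l1) ^ 3 = (- ([:s:] * x)) ^ 3" by simp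
  moreover have "(3 * u * v) ^ 3 = (- (t * y)) ^ 3 \<Longrightarrow> 27 * (u ^ 3 * v ^ 3) = - (t ^ 3 * y ^ 3)"
    for u v t y :: "'k poly"
    by (simp add: power_mult_distrib mult.assoc)
  ultimately have "27 * (l0 ^ 3 * l1 ^ 3) = - ([:s:] ^ 3 * x ^ 3)" by blast
  then have "27 * x ^ 3 = - ([:s:] ^ 3) * x ^ 3" unfolding * by simp
  moreover have "x \<noteq> 0" by (simp add: x_def)
  ultimately have "27 = - ([:s:] ^ 3)" by (metis mult_right_cancel power_not_zero)
  also have "[:s:] ^ 3 = [:s ^ 3:]" by (simp add: power3_eq_cube)
  finally have "[:27:] = [:- (s ^ 3):]" by (simp add: numeral_poly)
  then have "27 = - (s ^ 3)" by simp
  then show ?thesis by (metis minus_minus)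
qed

lemma hesse_irreducible:
  fixes \<zeta> l :: "'k::field_char_0"
  assumes "\<zeta> \<noteq> 0" "l ^ 3 \<noteq> - (3 ^ 3) * \<zeta> ^ 3"
  shows "irreducible (hesse \<zeta> l)"
proof -
  let ?s = "l / \<zeta>"
  have "vx ^ 3 + vy ^ 3 + vz ^ 3 + cst ?s * vx * vy * vz =
      [:px ^ 3 + py ^ 3, pcst ?s * px * py, 0, 1:]" (is "?H = _")
  proof -
    have "?H = emb (px ^ 3 + py ^ 3) + emb (pcst ?s * px * py) * vz + vz ^ 3"
      by (simp add: emb_simps emb_gens)
    then show ?thesis by (simp add: emb_def vz_def power3_eq_cube)
  qed
  moreover have "?s ^ 3 \<noteq> - 27" using assms by (simp add: field_simps power_divide)
  ultimately have "irreducible ?H"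
    using irreducible_monic_cubic hesse_no_root by metis
  moreover have "hesse \<zeta> l = cst \<zeta> * ?H"
    using assms by (simp add: hesse_def distrib_left mult.assoc[symmetric] cst_simps(2)[symmetric])
  ultimately show ?thesis
    using irreducible_unit_mult[OF cst_unit[OF assms(1)]] by simp
qed

section \<open>Weierstrass cubics and the passage to the Hesse form\<close>

definition weierstrass :: "'k::field \<Rightarrow> 'k \<Rightarrow> 'k \<Rightarrow> 'k \<Rightarrow> 'k poly3" where
  "weierstrass \<alpha> \<beta> \<gamma> \<delta> = vx * vz ^ 2 + (cst \<alpha> * vy ^ 3 + cst \<beta> * vx * vy ^ 2 + cst \<gamma> * vx ^ 2 * vy + cst \<delta> * vx ^ 3)"

definition double_root :: "'k::field \<Rightarrow> 'k \<Rightarrow> 'k \<Rightarrow> 'k \<Rightarrow> 'k \<Rightarrow> bool" where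
  "double_root \<alpha> \<beta> \<gamma> \<delta> \<rho> \<longleftrightarrow> \<alpha> * \<rho> ^ 3 + \<beta> * \<rho> ^ 2 + \<gamma> * \<rho> + \<delta> = 0 \<and> 3 * \<alpha> * \<rho> ^ 2 + 2 * \<beta> * \<rho> + \<gamma> = 0"

text \<open>\<open>L\<close> is the tangent line at the inflection point (1 : -1 : 0) of the Hesse
  cubic, hence the line at infinity of a Weierstrass form in the coordinates \<open>L\<close>, x -
  y, z. The line z = 0 passes through three inflection points, which is why a perfect square appears
  beside the term in z^3.\<close>

lemma hesse_weierstrass_identity:
  fixes x y z s :: "'a::comm_ring_1"
  assumes "L = 3 * (x + y) - s * z"
  shows "27 * L * (x - y) ^ 2 + (4 * s ^ 3 + 108) * z ^ 3 + L * (3 * s * z + L) ^ 2 =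
    108 * (x ^ 3 + y ^ 3 + z ^ 3 + s * x * y * z)"
  unfolding assms by (simp add: algebra_simps power2_eq_square power3_eq_cube)

text \<open>
  The line \<open>y = \<nu>x + \<dots>\<close> through a second inflection point makes the quadratic part of the
  translated cubic a square; this condition on \<open>\<nu>\<close> is the 3-division polynomial.
\<close>

lemma inflection_point:
  fixes \<alpha> \<beta> \<gamma> \<delta> :: "'k::{alg_closed_field, field_char_0}"
  assumes "\<alpha> \<noteq> 0"
  obtains \<nu> b d where "3 * \<alpha> * \<nu> + \<beta> = b ^ 2" "3 * \<alpha> * \<nu> ^ 2 + 2 * \<beta> * \<nu> + \<gamma> = 2 * b * d"
    "\<alpha> * \<nu> ^ 3 + \<beta> * \<nu> ^ 2 + \<gamma> * \<nu> + \<delta> = d ^ 2"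
proof -
  define Q where "Q = [:\<gamma>, 2 * \<beta>, 3 * \<alpha>:] ^ 2 - 4 * ([:\<beta>, 3 * \<alpha>:] * [:\<delta>, \<gamma>, \<beta>, \<alpha>:])"
  \<comment> \<open>\<open>Q\<close> is the discriminant of the quadratic part as a polynomial in
    \<nu>. Its leading coefficient 9\<alpha>^2 - 12\<alpha>^2 is nonzero, so it has a root.\<close>
  have "coeff Q 4 = - 3 * \<alpha> ^ 2"
    by (simp add: Q_def power2_eq_square numeral_poly coeff_pCons eval_nat_numeral algebra_simps)
  then have "degree Q \<ge> 4" using assms by (intro le_degree) simp
  then obtain \<nu> where "poly Q \<nu> = 0" using alg_closed_imp_poly_has_root[of Q] by auto
  then have \<nu>: "(3 * \<alpha> * \<nu> ^ 2 + 2 * \<beta> * \<nu> + \<gamma>) ^ 2 =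
      4 * ((3 * \<alpha> * \<nu> + \<beta>) * (\<alpha> * \<nu> ^ 3 + \<beta> * \<nu> ^ 2 + \<gamma> * \<nu> + \<delta>))"
    by (simp add: Q_def algebra_simps power2_eq_square power3_eq_cube)
  obtain b d where bd: "b ^ 2 = 3 * \<alpha> * \<nu> + \<beta>" "d ^ 2 = \<alpha> * \<nu> ^ 3 + \<beta> * \<nu> ^ 2 + \<gamma> * \<nu> + \<delta>"
    using exists_sqrt by metis
  have "(3 * \<alpha> * \<nu> ^ 2 + 2 * \<beta> * \<nu> + \<gamma>) ^ 2 = (2 * b * d) ^ 2"
    unfolding \<nu> bd[symmetric] by (simp add: power_mult_distrib)
  then consider "3 * \<alpha> * \<nu> ^ 2 + 2 * \<beta> * \<nu> + \<gamma> = 2 * b * d" | "3 * \<alpha> * \<nu> ^ 2 + 2 * \<beta> * \<nu> + \<gamma> = 2 * b * (- d)"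
    by (auto simp: power2_eq_iff)
  then show thesis
  proof cases
    case 1
    then show ?thesis using that[of \<nu> b d] bd by simp
  next
    case 2
    then show ?thesis using that[of \<nu> b "- d"] bd by simp
  qed
qed

text \<open>Translating y by \<nu>x brings the cubic to \<alpha>T^3 + x(bT + dx)^2, the shape in the
  Hesse identity. With L for x, mz for T and \<epsilon>(x - y) for z, matching against d^2 times
  that identity requires \<epsilon>^2 = 27d^2, bm = 3ds and \<alpha>m^3 = d^2(4s^3 + 108).
  Eliminating s determines m^3.\<close>

theorem weierstrass_hesse:
  fixes \<alpha> \<beta> \<gamma> \<delta> :: "'k::{alg_closed_field, field_char_0}"
  assumes \<alpha>: "\<alpha> \<noteq> 0" and nr: "\<And>\<rho>. \<not> double_root \<alpha> \<beta> \<gamma> \<delta> \<rho>"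
  shows "\<exists>\<zeta> l. \<zeta> \<noteq> 0 \<and> l ^ 3 \<noteq> - (3 ^ 3) * \<zeta> ^ 3 \<and> irreducible (weierstrass \<alpha> \<beta> \<gamma> \<delta>) \<and>
    poisson_Q (weierstrass \<alpha> \<beta> \<gamma> \<delta>) \<simeq>\<^sub>P poisson_S \<zeta> l"
proof -
  obtain \<nu> b d where rel: "3 * \<alpha> * \<nu> + \<beta> = b ^ 2" "3 * \<alpha> * \<nu> ^ 2 + 2 * \<beta> * \<nu> + \<gamma> = 2 * b * d"
    "\<alpha> * \<nu> ^ 3 + \<beta> * \<nu> ^ 2 + \<gamma> * \<nu> + \<delta> = d ^ 2"
    by (rule inflection_point[OF \<alpha>, where \<beta> = \<beta> and \<gamma> = \<gamma> and \<delta> = \<delta>])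
  have \<beta>: "\<beta> = b ^ 2 - 3 * \<alpha> * \<nu>" using rel(1) by (simp add: algebra_simps)
  have \<gamma>: "\<gamma> = 2 * b * d - 3 * \<alpha> * \<nu> ^ 2 - 2 * \<beta> * \<nu>" using rel(2) by (simp add: algebra_simps)
  have \<delta>: "\<delta> = d ^ 2 - \<alpha> * \<nu> ^ 3 - \<beta> * \<nu> ^ 2 - \<gamma> * \<nu>" using rel(3) by (simp add: algebra_simps)
  \<comment> \<open>For d = 0 both the value and the derivative of the cubic vanish at
    \<nu>.\<close>
  have d: "d \<noteq> 0"
    using nr[of \<nu>] rel by (auto simp: double_root_def)
  \<comment> \<open>In case of equality the translated cubic \<alpha>t^3 + (bt + d)^2 has the double
    root t = -3d/b.\<close>
  have ne: "27 * \<alpha> * d \<noteq> 4 * b ^ 3"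
  proof
    assume *: "27 * \<alpha> * d = 4 * b ^ 3"
    then have b: "b \<noteq> 0" using \<alpha> d by auto
    define t where "t = - 3 * d / b"
    have \<alpha>': "\<alpha> = 4 * b ^ 3 / (27 * d)" using * d by (simp add: field_simps)
    have "\<alpha> * (t + \<nu>) ^ 3 + \<beta> * (t + \<nu>) ^ 2 + \<gamma> * (t + \<nu>) + \<delta> = \<alpha> * t ^ 3 + (b * t + d) ^ 2"
      unfolding \<delta> \<gamma> \<beta> by (simp add: algebra_simps power2_eq_square power3_eq_cube)
    also have "\<dots> = 0"
      unfolding \<alpha>' t_def using b d by (simp add: field_simps power2_eq_square power3_eq_cube)
    finally have 1: "\<alpha> * (t + \<nu>) ^ 3 + \<beta> * (t + \<nu>) ^ 2 + \<gamma> * (t + \<nu>) + \<delta> = 0" .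
    have "3 * \<alpha> * (t + \<nu>) ^ 2 + 2 * \<beta> * (t + \<nu>) + \<gamma> = 3 * \<alpha> * t ^ 2 + 2 * b * (b * t + d)"
      unfolding \<gamma> \<beta> by (simp add: algebra_simps power2_eq_square power3_eq_cube)
    also have "\<dots> = 0"
      unfolding \<alpha>' t_def using b d by (simp add: field_simps power2_eq_square power3_eq_cube)
    finally show False using 1 nr[of "t + \<nu>"] by (simp add: double_root_def)
  qed
  obtain m where m: "m ^ 3 = 108 * 27 * d ^ 3 / (27 * \<alpha> * d - 4 * b ^ 3)"
    using nth_root_exists[of 3] by auto
  then have m0: "m \<noteq> 0" using d ne by (auto simp: power_0_left)
  define s where "s = b * m / (3 * d)"
  have bm: "b * m = 3 * d * s" using d by (simp add: s_def)
  have \<alpha>m: "\<alpha> * m ^ 3 = d ^ 2 * (4 * s ^ 3 + 108)"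
  proof -
    have "m ^ 3 * (27 * \<alpha> * d - 4 * b ^ 3) = 108 * 27 * d ^ 3"
      using m ne by simp
    then have "27 * d * (\<alpha> * m ^ 3) = 4 * (b * m) ^ 3 + 108 * 27 * d ^ 3"
      by (simp add: algebra_simps power_mult_distrib)
    also have "\<dots> = 27 * d * (d ^ 2 * (4 * s ^ 3 + 108))"
      unfolding bm by (simp add: algebra_simps power2_eq_square power3_eq_cube)
    finally show ?thesis using d by simp
  qed
  have s: "s ^ 3 \<noteq> - 27"
  proof
    assume "s ^ 3 = - 27"
    then have "\<alpha> * m ^ 3 = 0" unfolding \<alpha>m by simp
    then show False using \<alpha> m0 by simp
  qed
  obtain \<epsilon> where \<epsilon>: "\<epsilon> ^ 2 = 27 * d ^ 2" using exists_sqrt by blast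
  then have \<epsilon>0: "\<epsilon> \<noteq> 0" using d by auto
  define L where "L = 3 * (vx + vy) - cst s * vz"
  \<comment> \<open>\<kappa> is the Jacobian of the substitution. The potential must be multiplied
    by the same \<kappa>, which fixes \<zeta> through \<kappa>\<zeta> = 108d^2.\<close>
  define \<kappa> where "\<kappa> = 6 * m * \<epsilon>"
  have \<kappa>: "\<kappa> \<noteq> 0" using m0 \<epsilon>0 by (simp add: \<kappa>_def)
  define \<zeta> where "\<zeta> = inverse \<kappa> * (108 * d ^ 2)"
  have \<zeta>: "\<zeta> \<noteq> 0" using \<kappa> d by (simp add: \<zeta>_def)
  let ?q = "cst m * vz + cst \<nu> * L" and ?r = "cst \<epsilon> * (vx - vy)"
  let ?W = "weierstrass \<alpha> \<beta> \<gamma> \<delta>"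
  have shift: "cst \<alpha> * (T + cst \<nu> * u) ^ 3 + cst \<beta> * u * (T + cst \<nu> * u) ^ 2
      + cst \<gamma> * u ^ 2 * (T + cst \<nu> * u) + cst \<delta> * u ^ 3 = cst \<alpha> * T ^ 3 + u * (cst b * T + cst d * u) ^ 2"
    for T u
    unfolding \<delta> \<gamma> \<beta> by (simp add: cst_simps algebra_simps power2_eq_square power3_eq_cube)
  have ev: "ev3 cst L ?q ?r ?W = cst \<kappa> * hesse \<zeta> (\<zeta> * s)"
  proof -
    have "ev3 cst L ?q ?r ?W = L * ?r ^ 2 + (cst \<alpha> * ?q ^ 3 + cst \<beta> * L * ?q ^ 2 + cst \<gamma> * L ^ 2 * ?q + cst \<delta> * L ^ 3)"
      by (simp only: weierstrass_def ev_cst)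
    also have "\<dots> = L * (cst (\<epsilon> ^ 2) * (vx - vy) ^ 2) + (cst (\<alpha> * m ^ 3) * vz ^ 3 + L * (cst (b * m) * vz + cst d * L) ^ 2)"
      unfolding shift by (simp add: cst_simps power_mult_distrib mult_ac)
    also have "\<dots> = cst (d ^ 2) * (27 * L * (vx - vy) ^ 2 + (4 * cst s ^ 3 + 108) * vz ^ 3 + L * (3 * cst s * vz + L) ^ 2)"
      unfolding \<epsilon> \<alpha>m bm by (simp add: cst_simps algebra_simps power2_eq_square)
    also have "\<dots> = cst (108 * d ^ 2) * (vx ^ 3 + vy ^ 3 + vz ^ 3 + cst s * vx * vy * vz)"
      unfolding hesse_weierstrass_identity[OF L_def] by (simp add: cst_simps)
    also have "\<dots> = cst \<kappa> * hesse \<zeta> (\<zeta> * s)"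
    proof -
      have "cst \<kappa> * hesse \<zeta> (\<zeta> * s) = cst (\<kappa> * \<zeta>) * (vx ^ 3 + vy ^ 3 + vz ^ 3 + cst s * vx * vy * vz)"
        by (simp add: hesse_def cst_simps algebra_simps)
      also have "\<kappa> * \<zeta> = 108 * d ^ 2" using \<kappa> by (simp add: \<zeta>_def)
      finally show ?thesis by simp
    qed
    finally show ?thesis .
  qed
  have jac: "jac L ?q ?r = cst \<kappa>"
    unfolding \<kappa>_def L_def by (simp add: jac_def partial_simps cst_simps algebra_simps)
  define i2 i3 :: 'k where "i2 = inverse 2" and "i3 = inverse 3"
  let ?z = "cst (inverse m) * (vy - cst \<nu> * vx)"
  let ?s = "cst i3 * (vx + cst s * ?z)"
  let ?d = "cst (inverse \<epsilon>) * vz"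
  have inv: "inverse_subst L ?q ?r (cst i2 * (?s + ?d)) (cst i2 * (?s - ?d)) ?z"
  proof -
    have three: "cst i3 * (3 * u) = u" "cst i2 * (2 * u) = u"
        "3 * (cst i3 * u) = u" "2 * (cst i2 * u) = u" for u :: "'k poly3"
      using cst_cancel[of 3 u] cst_cancel[of 2 u] unfolding i2_def i3_def
      by (simp_all only: cst_simps zero_neq_numeral[symmetric] simp_thms)
    have z: "ev3 cst L ?q ?r ?z = vz"
      using m0 by (simp add: ev_cst cst_cancel)
    have s': "ev3 cst L ?q ?r ?s = vx + vy"
      unfolding ring_map_mult[OF ring_map_ev3[OF ring_map_cst], of _ _ _ _ "vx + cst s * ?z"]
        ring_map_add[OF ring_map_ev3[OF ring_map_cst]]
        ring_map_mult[OF ring_map_ev3[OF ring_map_cst], of _ _ _ _ ?z] z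
      by (simp add: ev_cst L_def three(1) del: distrib_left_numeral)
    have d': "ev3 cst L ?q ?r ?d = vx - vy"
      using \<epsilon>0 by (simp add: ev_cst cst_cancel)
    have half: "cst i2 * (vx + vy + (vx - vy)) = vx" "cst i2 * (vx + vy - (vx - vy)) = vy"
    proof -
      have *: "vx + vy + (vx - vy) = 2 * (vx :: 'k poly3)" "vx + vy - (vx - vy) = 2 * (vy :: 'k poly3)"
        by (simp_all add: algebra_simps)
      show "cst i2 * (vx + vy + (vx - vy)) = vx" "cst i2 * (vx + vy - (vx - vy)) = vy"
        unfolding * by (rule three(2))+
    qed
    let ?X = "cst i2 * (?s + ?d)" and ?Y = "cst i2 * (?s - ?d)"
    have "cst i2 * (u + v) + cst i2 * (u - v) = cst i2 * (2 * u)"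
      "cst i2 * (u + v) - cst i2 * (u - v) = cst i2 * (2 * v)" for u v :: "'k poly3"
      by (simp_all add: algebra_simps)
    then have sum: "?X + ?Y = ?s" "?X - ?Y = ?d"
      unfolding three by blast+
    have L': "ev3 cst ?X ?Y ?z L = vx"
    proof -
      have "ev3 cst ?X ?Y ?z L = 3 * (?X + ?Y) - cst s * ?z"
        by (simp only: L_def ev_cst)
      then show ?thesis unfolding sum by (simp add: three(3))
    qed
    have q': "ev3 cst ?X ?Y ?z ?q = vy"
      unfolding ring_map_add[OF ring_map_ev3[OF ring_map_cst]] ring_map_mult[OF ring_map_ev3[OF ring_map_cst]] L'
      using m0 by (simp add: ev_cst cst_cancel)
    have r': "ev3 cst ?X ?Y ?z ?r = vz"
    proof -
      have "ev3 cst ?X ?Y ?z ?r = cst \<epsilon> * (?X - ?Y)" by (simp only: ev_cst)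
      then show ?thesis unfolding sum using \<epsilon>0 by (simp add: cst_cancel)
    qed
    have "ev3 cst L ?q ?r ?X = vx" "ev3 cst L ?q ?r ?Y = vy"
      unfolding ring_map_mult[OF ring_map_ev3[OF ring_map_cst], of _ _ _ "cst i2"]
        ring_map_add[OF ring_map_ev3[OF ring_map_cst], of _ _ _ ?s] ring_map_diff[OF ring_map_ev3[OF ring_map_cst], of _ _ _ ?s]
        s' d' ev3_gens(1)[OF ring_map_cst] by (rule half)+
    then show ?thesis
      unfolding inverse_subst_def using z L' q' r' by blast
  qed
  have l: "(\<zeta> * s) ^ 3 \<noteq> - (3 ^ 3) * \<zeta> ^ 3"
  proof
    assume "(\<zeta> * s) ^ 3 = - (3 ^ 3) * \<zeta> ^ 3"
    then have "\<zeta> ^ 3 * s ^ 3 = \<zeta> ^ 3 * (- 27)" by (simp add: power_mult_distrib)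
    then have "s ^ 3 = - 27"
      using \<zeta> by (metis mult_left_cancel power_not_zero)
    then show False using s by simp
  qed
  have irr: "irreducible ?W"
    using hesse_irreducible[OF \<zeta> l] irreducible_inverse_subst[OF inv \<kappa> ev] by blast
  have "poisson_Q ?W \<simeq>\<^sub>P poisson_S \<zeta> (\<zeta> * s)"
    unfolding poisson_S_eq by (rule surface_automorphism[OF irr inv ev jac \<kappa>])
  then show ?thesis using \<zeta> l irr by blast
qed

section \<open>Double covers and their Weierstrass cubics\<close>

definition sextic :: "'k::field \<Rightarrow> 'k \<Rightarrow> 'k \<Rightarrow> 'k \<Rightarrow> 'k poly3" where
  "sextic \<alpha> \<beta> \<gamma> \<delta> = vz ^ 2 + (cst \<alpha> * vy ^ 3 + cst \<beta> * vx ^ 2 * vy ^ 2 + cst \<gamma> * vx ^ 4 * vy + cst \<delta> * vx ^ 6)"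

definition quartic :: "'k::field \<Rightarrow> 'k \<Rightarrow> 'k \<Rightarrow> 'k \<Rightarrow> 'k \<Rightarrow> 'k poly3" where
  "quartic \<alpha>' \<alpha> \<beta> \<gamma> \<delta> = vz ^ 2 + (cst \<alpha>' * vy ^ 4 + cst \<alpha> * vx * vy ^ 3 + cst \<beta> * vx ^ 2 * vy ^ 2 + cst \<gamma> * vx ^ 3 * vy + cst \<delta> * vx ^ 4)"

lemma sextic_eq: "sextic \<alpha> \<beta> \<gamma> \<delta> = vz ^ 2 + emb [:monom \<delta> 6, monom \<gamma> 4, monom \<beta> 2, monom \<alpha> 0:]"
  using arg_cong[OF binary_pCons[of 0 0 \<alpha> 0 \<beta> 2 \<gamma> 4 \<delta> 6], of emb]
  by (simp add: sextic_def emb_simps emb_gens pcst_simps del: emb_eq_0)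

lemma quartic_eq: "quartic \<alpha>' \<alpha> \<beta> \<gamma> \<delta> =
    vz ^ 2 + emb [:monom \<delta> 4, monom \<gamma> 3, monom \<beta> 2, monom \<alpha> 1, monom \<alpha>' 0:]"
  using arg_cong[OF binary_pCons[of \<alpha>' 0 \<alpha> 1 \<beta> 2 \<gamma> 3 \<delta> 4], of emb]
  by (simp add: quartic_def emb_simps emb_gens pcst_simps del: emb_eq_0)

lemma weierstrass_pCons: "weierstrass \<alpha> \<beta> \<gamma> \<delta> =
    [:pcst \<alpha> * py ^ 3 + pcst \<beta> * px * py ^ 2 + pcst \<gamma> * px ^ 2 * py + pcst \<delta> * px ^ 3, 0, px:]"
  unfolding quadratic_pCons[symmetric] weierstrass_def by (simp add: emb_simps emb_gens)

lemma degree_emb_mult_vz: "u \<noteq> 0 \<Longrightarrow> degree (emb u) = 0" "u \<noteq> 0 \<Longrightarrow> degree (emb u * vz) = 1"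
  by (simp_all add: emb_def vz_def)

lemma weierstrass_not_dvd:
  assumes "u \<noteq> 0"
  shows "\<not> weierstrass \<alpha> \<beta> \<gamma> \<delta> dvd emb u" "\<not> weierstrass \<alpha> \<beta> \<gamma> \<delta> dvd emb u * vz"
  using assms degree_emb_mult_vz[OF assms] unfolding weierstrass_pCons
  by (intro not_dvd_degree; simp)+

text \<open>Dividing y by x and z by x^2 makes all weights equal: the substitution (x, xy, x^2 z)
  has Jacobian x^3 and sends the sextic to x^3 times the cubic.\<close>

lemma sextic_weierstrass:
  fixes \<alpha> :: "'k::field_char_0"
  assumes "\<alpha> \<noteq> 0" "irreducible (weierstrass \<alpha> \<beta> \<gamma> \<delta>)"
  shows "irreducible (sextic \<alpha> \<beta> \<gamma> \<delta>)"
    "poisson_Q (sextic \<alpha> \<beta> \<gamma> \<delta>) \<simeq>\<^sub>P poisson_Q (weierstrass \<alpha> \<beta> \<gamma> \<delta>)"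
proof -
  let ?F = "sextic \<alpha> \<beta> \<gamma> \<delta>" and ?W = "weierstrass \<alpha> \<beta> \<gamma> \<delta>"
  show irr: "irreducible ?F"
    unfolding sextic_eq using assms by (intro irreducible_monic_odd) (simp add: monom_0)
  show "poisson_Q ?F \<simeq>\<^sub>P poisson_Q ?W"
  proof (rule surface_to_surface)
    show "prime_elem ?F" "prime_elem ?W"
      using irr assms by (auto intro: irreducible_imp_prime_poly3)
    show "degree ?F > 0" unfolding sextic_eq monic_pCons by simp
    show "ev3 cst vx (vx * vy) (vx ^ 2 * vz) ?F = vx ^ 3 * ?W"
      by (simp add: sextic_def weierstrass_def ev_cst algebra_simps eval_nat_numeral)
    show "jac vx (vx * vy) (vx ^ 2 * vz) = vx ^ 3"
      by (simp add: jac_def partial_simps eval_nat_numeral)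
    show nd: "\<not> ?W dvd vx ^ 3"
      using weierstrass_not_dvd(1)[of "px ^ 3"] by (simp add: emb_simps emb_gens)
    show "\<not> ?W dvd ev3 cst vx (vx * vy) (vx ^ 2 * vz) (dZ ?F)"
      using weierstrass_not_dvd(2)[of "2 * px ^ 2 :: 'k poly poly"]
      by (simp add: sextic_def partial_simps ev_cst emb_simps emb_gens mult.assoc)
    fix F assume F: "subfield_over cst ?W F" "vx \<in> F" "vx * vy \<in> F" "vx ^ 2 * vz \<in> F"
    have nd': "\<not> ?W dvd vx" "\<not> ?W dvd vx ^ 2"
      using weierstrass_not_dvd(1)[of "px"] weierstrass_not_dvd(1)[of "px ^ 2"]
      by (simp_all add: emb_simps emb_gens)
    have "vy \<in> F"
      by (rule subfield_overD(5)[OF F(1) nd'(1) F(3,2)]) (simp add: mult.commute)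
    moreover have "vz \<in> F"
      by (rule subfield_overD(5)[OF F(1) nd'(2) F(4) subfield_over_power[OF F(1) ring_map_cst F(2)]])
        (simp add: mult.commute)
    ultimately show "vx \<in> F \<and> vy \<in> F \<and> vz \<in> F" using F by simp
  qed
qed

text \<open>A root of the quartic at x = 0 lets one factor x be removed: replacing z by xz has
  Jacobian x and multiplies the cubic by x.\<close>

lemma quartic_weierstrass:
  fixes \<alpha> :: "'k::field_char_0"
  assumes "\<alpha> \<noteq> 0" "irreducible (weierstrass \<alpha> \<beta> \<gamma> \<delta>)"
  shows "irreducible (quartic 0 \<alpha> \<beta> \<gamma> \<delta>)"
    "poisson_Q (quartic 0 \<alpha> \<beta> \<gamma> \<delta>) \<simeq>\<^sub>P poisson_Q (weierstrass \<alpha> \<beta> \<gamma> \<delta>)"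
proof -
  let ?F = "quartic 0 \<alpha> \<beta> \<gamma> \<delta>" and ?W = "weierstrass \<alpha> \<beta> \<gamma> \<delta>"
  show irr: "irreducible ?F"
    unfolding quartic_eq using assms by (intro irreducible_monic_odd) simp
  show "poisson_Q ?F \<simeq>\<^sub>P poisson_Q ?W"
  proof (rule surface_to_surface)
    show "prime_elem ?F" "prime_elem ?W"
      using irr assms by (auto intro: irreducible_imp_prime_poly3)
    show "degree ?F > 0" unfolding quartic_eq monic_pCons by simp
    show "ev3 cst vx vy (vx * vz) ?F = vx * ?W"
      by (simp add: quartic_def weierstrass_def ev_cst cst_simps algebra_simps eval_nat_numeral)
    show "jac vx vy (vx * vz) = vx"
      by (simp add: jac_def partial_simps)
    show nd: "\<not> ?W dvd vx"
      using weierstrass_not_dvd(1)[of px] by (simp add: emb_gens)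
    show "\<not> ?W dvd ev3 cst vx vy (vx * vz) (dZ ?F)"
      using weierstrass_not_dvd(2)[of "2 * px :: 'k poly poly"]
      by (simp add: quartic_def partial_simps ev_cst emb_simps emb_gens mult.assoc)
    fix F assume F: "subfield_over cst ?W F" "vx \<in> F" "vy \<in> F" "vx * vz \<in> F"
    have "vz \<in> F"
      by (rule subfield_overD(5)[OF F(1) nd F(4,2)]) (simp add: mult.commute)
    then show "vx \<in> F \<and> vy \<in> F \<and> vz \<in> F" using F by simp
  qed
qed

text \<open>Projecting \<open>lz\<^sup>2 + pz + q = 0\<close> from the point at infinity gives a double cover of the plane.\<close>

lemma cubic_double_cover:
  fixes l p q :: "'k::field_char_0 poly poly"
  assumes irr: "irreducible (emb q + emb p * vz + emb l * vz ^ 2)"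
    "irreducible (vz ^ 2 + emb (l * q - pcst (1 / 4) * p ^ 2))" and "l \<noteq> 0"
  shows "poisson_Q (vz ^ 2 + emb (l * q - pcst (1 / 4) * p ^ 2)) \<simeq>\<^sub>P
    poisson_Q (emb q + emb p * vz + emb l * vz ^ 2)"
proof (rule surface_to_surface)
  let ?F = "vz ^ 2 + emb (l * q - pcst (1 / 4) * p ^ 2)" and ?W = "emb q + emb p * vz + emb l * vz ^ 2"
  let ?r = "emb l * vz + emb (pcst (1 / 2) * p)"
  show "prime_elem ?F" "prime_elem ?W"
    using irr by (auto intro: irreducible_imp_prime_poly3)
  show "degree ?F > 0" unfolding monic_pCons by simp
  have 2: "2 * pcst (1 / 2) = (1 :: 'k poly poly)" "pcst (1 / 2) ^ 2 = (pcst (1 / 4) :: 'k poly poly)"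
    unfolding pcst_simps(9)[symmetric] pcst_simps(2,7)[symmetric] by (simp_all add: pcst_simps power2_eq_square)
  have "ev3 cst vx vy ?r ?F = ?r ^ 2 + emb (l * q - pcst (1 / 4) * p ^ 2)"
    by (simp add: ev_cst ev3_emb ring_map_cst ev2_emb emb_simps emb_gens)
  also have "?r ^ 2 = emb l ^ 2 * vz ^ 2 + emb (2 * pcst (1 / 2) * p * l) * vz + emb (pcst (1 / 2) ^ 2 * p ^ 2)"
    by (simp add: emb_simps algebra_simps power2_eq_square)
  finally show "ev3 cst vx vy ?r ?F = emb l * ?W"
    unfolding 2 by (simp add: emb_simps algebra_simps power2_eq_square)
  show "jac vx vy ?r = emb l"
    by (simp add: jac_def partial_simps)
  have W: "?W = [:q, p, l:]" by (rule quadratic_pCons)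
  show nd: "\<not> ?W dvd emb l"
    unfolding W using assms by (intro not_dvd_degree) (simp_all add: degree_emb_mult_vz)
  have "ev3 cst vx vy ?r (dZ ?F) = [:p, 2 * l:]"
  proof -
    have "ev3 cst vx vy ?r (dZ ?F) = emb (2 * l) * vz + emb (2 * pcst (1 / 2) * p)"
      by (simp add: partial_simps ev_cst emb_simps algebra_simps)
    then show ?thesis unfolding 2 by (simp add: emb_def vz_def)
  qed
  then show "\<not> ?W dvd ev3 cst vx vy ?r (dZ ?F)"
    unfolding W using assms by (simp only:) (intro not_dvd_degree; simp)
  fix F assume F: "subfield_over cst ?W F" "vx \<in> F" "vy \<in> F" "?r \<in> F"
  note e = emb_mem[OF F(1-3)]
  have "vz \<in> F"
    by (rule subfield_overD(5)[OF F(1) nd subfield_overD(3)[OF F(1) F(4) e[of "pcst (1 / 2) * p"]] e])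
      (simp add: mult.commute)
  then show "vx \<in> F \<and> vy \<in> F \<and> vz \<in> F" using F by simp
qed

section \<open>The normal forms\<close>

definition rational_type :: "'k::field poly3 \<Rightarrow> bool" where
  "rational_type Om \<longleftrightarrow> poisson_Q Om \<simeq>\<^sub>P (K_Weyl :: ('k, _) poisson) \<or> (\<exists>q. q \<noteq> 0 \<and> poisson_Q Om \<simeq>\<^sub>P K_skew q)"

definition skew_type :: "'k::field poly3 \<Rightarrow> bool" where
  "skew_type Om \<longleftrightarrow> (\<exists>q. q \<noteq> 0 \<and> poisson_Q Om \<simeq>\<^sub>P K_skew q)"

definition weyl_type :: "'k::field poly3 \<Rightarrow> bool" where
  "weyl_type Om \<longleftrightarrow> poisson_Q Om \<simeq>\<^sub>P (K_Weyl :: ('k, _) poisson)"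

definition elliptic_type :: "'k::field poly3 \<Rightarrow> bool" where
  "elliptic_type Om \<longleftrightarrow> (\<exists>\<zeta> l. \<zeta> \<noteq> 0 \<and> l ^ 3 \<noteq> - (3 ^ 3) * \<zeta> ^ 3 \<and> poisson_Q Om \<simeq>\<^sub>P poisson_S \<zeta> l)"

lemma rational_type_iff: "rational_type Om \<longleftrightarrow> weyl_type Om \<or> skew_type Om"
  by (simp add: rational_type_def weyl_type_def skew_type_def)

lemma type_cong:
  assumes "poisson_Q Om \<simeq>\<^sub>P poisson_Q Om'"
  shows "skew_type Om' \<Longrightarrow> skew_type Om" "weyl_type Om' \<Longrightarrow> weyl_type Om"
    "elliptic_type Om' \<Longrightarrow> elliptic_type Om" "rational_type Om' \<Longrightarrow> rational_type Om"
  using is_poisson_iso_trans[OF assms]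
  unfolding skew_type_def weyl_type_def elliptic_type_def rational_type_def by blast+

lemma type_equiv:
  assumes "surface_equiv Om Om'" "irreducible Om"
  shows "skew_type Om' \<Longrightarrow> skew_type Om" "weyl_type Om' \<Longrightarrow> weyl_type Om"
    "elliptic_type Om' \<Longrightarrow> elliptic_type Om" "rational_type Om' \<Longrightarrow> rational_type Om"
  using type_cong assms unfolding surface_equiv_def by blast+

lemma surface_equiv_irreducible: "surface_equiv Om Om' \<Longrightarrow> irreducible Om' \<longleftrightarrow> irreducible Om"
  and surface_equiv_isolated: "surface_equiv Om Om' \<Longrightarrow> isolated_singularity Om' \<longleftrightarrow> isolated_singularity Om"
  by (simp_all add: surface_equiv_def)

lemma numeral_mult_eq_0: "numeral n * x = 0 \<Longrightarrow> x = (0 :: 'k::field_char_0)"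
  by (simp del: distrib_left_numeral right_diff_distrib_numeral)

lemma not_isolatedI: "sing Om u v w \<Longrightarrow> u \<noteq> 0 \<or> v \<noteq> 0 \<or> w \<noteq> 0 \<Longrightarrow> \<not> isolated_singularity Om"
  by (auto simp: isolated_singularity_iff)

text \<open>Each transposition of variables is paired with a sign so that its Jacobian is 1.\<close>

lemma surface_equiv_rotate:
  fixes Om :: "'k::field_char_0 poly3"
  shows "surface_equiv Om (ev3 cst vy vx (- vz) Om)" "surface_equiv Om (ev3 cst (- vz) vy vx Om)"
    "surface_equiv Om (ev3 cst vx (- vz) vy Om)"
proof -
  have *: "surface_equiv Om (ev3 cst p q r Om)"
    if "inverse_subst p q r p' q' r'" "jac p q r = cst 1" "ev3 (\<lambda>s. s) 0 0 0 p = 0"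
      "ev3 (\<lambda>s. s) 0 0 0 q = 0" "ev3 (\<lambda>s. s) 0 0 0 r = 0" for p q r p' q' r'
    by (rule surface_equivI[OF that(1) _ that(2) _ that(3-5)]) (simp_all add: cst_simps)
  show "surface_equiv Om (ev3 cst vy vx (- vz) Om)"
    by (rule *[of _ _ _ vy vx "- vz"]; simp add: inverse_subst_def ev_cst jac_def partial_simps ev_id cst_simps)
  show "surface_equiv Om (ev3 cst (- vz) vy vx Om)"
    by (rule *[of _ _ _ vz vy "- vx"]; simp add: inverse_subst_def ev_cst jac_def partial_simps ev_id cst_simps)
  show "surface_equiv Om (ev3 cst vx (- vz) vy Om)"
    by (rule *[of _ _ _ vx vz "- vy"]; simp add: inverse_subst_def ev_cst jac_def partial_simps ev_id cst_simps)
qed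

lemma not_irreducible_square:
  "\<not> irreducible (vz ^ 2 + emb (- (b ^ 2)))"
  unfolding monic_pCons irreducible_monic_quadratic by blast

lemma not_irreducible_even:
  fixes \<delta> :: "'k::alg_closed_field"
  shows "\<not> irreducible (vz ^ 2 + cst \<delta> * vx ^ (2 * n) * vy ^ (2 * m))"
proof -
  obtain e where e: "e ^ 2 = - \<delta>" using exists_sqrt by blast
  have "cst \<delta> * vx ^ (2 * n) * vy ^ (2 * m) = emb (pcst \<delta> * (px ^ n * py ^ m) ^ 2)"
    by (simp add: emb_simps emb_gens power_mult_distrib power_mult[symmetric] mult.commute mult.assoc)
  also have "pcst \<delta> = - (pcst e ^ 2)"
    by (simp flip: pcst_simps add: e)
  also have "- (pcst e ^ 2) * (px ^ n * py ^ m) ^ 2 = - ((pcst e * (px ^ n * py ^ m)) ^ 2)"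
    by (simp add: power_mult_distrib)
  finally show ?thesis using not_irreducible_square by metis
qed

text \<open>Completing the square in y by a shift with a multiple of x^n removes \<beta> and leaves
  the conic case with exponent 2n.\<close>

lemma x_square_skew:
  fixes \<alpha> \<beta> \<gamma> :: "'k::{alg_closed_field, field_char_0}"
  assumes irr: "irreducible (vz ^ 2 + vx ^ 2 * (cst \<alpha> * vy ^ 2 + cst \<beta> * vx ^ n * vy + cst \<gamma> * vx ^ (2 * n)))"
    and "\<alpha> \<noteq> 0" "n \<ge> 1"
  shows "skew_type (vz ^ 2 + vx ^ 2 * (cst \<alpha> * vy ^ 2 + cst \<beta> * vx ^ n * vy + cst \<gamma> * vx ^ (2 * n)))"
    (is "skew_type ?Om")
proof -
  define c where "c = - (\<beta> / (2 * \<alpha>))"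
  have \<beta>: "\<beta> = - (2 * \<alpha> * c)" using assms by (simp add: c_def)
  let ?Om' = "vz ^ 2 + vx ^ 2 * (cst \<alpha> * vy ^ 2 + cst (\<gamma> - \<alpha> * c ^ 2) * vx ^ (2 * n))"
  have "vx ^ (2 * n) = vx ^ n * (vx ^ n :: 'k poly3)"
    by (simp add: mult_2[of n] power_add)
  then have "ev3 cst vx (vy + cst c * vx ^ n) vz ?Om = ?Om'"
    unfolding \<beta> by (simp add: ev_cst cst_simps algebra_simps power2_eq_square)
  then have eq: "surface_equiv ?Om ?Om'"
    using surface_equiv_shift_y[OF assms(3), of ?Om c] by simp
  then have "irreducible ?Om'" using irr surface_equiv_irreducible by blast
  then have "skew_type ?Om'"
    unfolding skew_type_def using assms by (intro surface_conic) simp_all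
  then show ?thesis using type_equiv[OF eq irr] by blast
qed

lemma x_square_weyl:
  fixes \<beta> \<gamma> :: "'k::field_char_0"
  assumes irr: "irreducible (vz ^ 2 + vx ^ 2 * (cst \<beta> * vx ^ n * vy + cst \<gamma> * vx ^ (2 * n)))" and "\<beta> \<noteq> 0"
  shows "weyl_type (vz ^ 2 + vx ^ 2 * (cst \<beta> * vx ^ n * vy + cst \<gamma> * vx ^ (2 * n)))"
  using surface_linear_y[of \<beta> n \<gamma> n] assms unfolding weyl_type_def mult_2 by blast

lemma x_square_rational:
  fixes \<alpha> \<beta> \<gamma> :: "'k::{alg_closed_field, field_char_0}"
  assumes irr: "irreducible (vz ^ 2 + vx ^ 2 * (cst \<alpha> * vy ^ 2 + cst \<beta> * vx ^ n * vy + cst \<gamma> * vx ^ (2 * n)))"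
    and "n \<ge> 1"
  shows "rational_type (vz ^ 2 + vx ^ 2 * (cst \<alpha> * vy ^ 2 + cst \<beta> * vx ^ n * vy + cst \<gamma> * vx ^ (2 * n)))"
proof -
  have "\<alpha> \<noteq> 0 \<or> \<beta> \<noteq> 0"
  proof (rule ccontr)
    assume "\<not> (\<alpha> \<noteq> 0 \<or> \<beta> \<noteq> 0)"
    then show False
      using irr not_irreducible_even[of \<gamma> "Suc n" 0] by (simp add: cst_simps power2_eq_square mult_ac)
  qed
  then show ?thesis
    unfolding rational_type_iff
    using x_square_skew[OF irr] x_square_weyl[of \<beta> n \<gamma>] irr assms(2)
    by (cases "\<alpha> = 0") (auto simp: cst_simps)
qed

text \<open>Every term lies in the square of the ideal (x, z), so the whole y-axis is
  singular.\<close>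

lemma x_square_not_isolated:
  "\<not> isolated_singularity (vz ^ 2 + vx ^ 2 * (cst \<alpha> * vy ^ 2 + cst \<beta> * vx ^ n * vy + cst \<gamma> * vx ^ m))"
  by (rule not_isolatedI[of _ 0 1 0]) (simp_all add: sing_def partial_simps ev_id)

section \<open>Singular and isolated cases of sextics and quartics\<close>

lemma sing_sextic: "sing (sextic \<alpha> \<beta> \<gamma> \<delta>) u v w \<longleftrightarrow>
    2 * \<beta> * u * v ^ 2 + 4 * \<gamma> * u ^ 3 * v + 6 * \<delta> * u ^ 5 = 0 \<and>
    3 * \<alpha> * v ^ 2 + 2 * \<beta> * u ^ 2 * v + \<gamma> * u ^ 4 = 0 \<and> 2 * w = 0"
  by (simp add: sing_def sextic_def partial_simps ev_id algebra_simps)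

lemma sing_quartic: "sing (quartic \<alpha>' \<alpha> \<beta> \<gamma> \<delta>) u v w \<longleftrightarrow>
    \<alpha> * v ^ 3 + 2 * \<beta> * u * v ^ 2 + 3 * \<gamma> * u ^ 2 * v + 4 * \<delta> * u ^ 3 = 0 \<and>
    4 * \<alpha>' * v ^ 3 + 3 * \<alpha> * u * v ^ 2 + 2 * \<beta> * u ^ 2 * v + \<gamma> * u ^ 3 = 0 \<and> 2 * w = 0"
  by (simp add: sing_def quartic_def partial_simps ev_id algebra_simps)

lemma sextic_x_square: "sextic 0 \<beta> \<gamma> \<delta> = vz ^ 2 + vx ^ 2 * (cst \<beta> * vy ^ 2 + cst \<gamma> * vx ^ 2 * vy + cst \<delta> * vx ^ (2 * 2))"
  by (simp add: sextic_def cst_simps algebra_simps eval_nat_numeral)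

lemma quartic_x_square: "quartic 0 0 \<beta> \<gamma> \<delta> = vz ^ 2 + vx ^ 2 * (cst \<beta> * vy ^ 2 + cst \<gamma> * vx ^ 1 * vy + cst \<delta> * vx ^ (2 * 1))"
  by (simp add: quartic_def cst_simps algebra_simps eval_nat_numeral)

text \<open>Shifting y by \<rho>x^2 moves the double root to y = 0. The remaining coefficient
  3\<alpha>\<rho> + \<beta> vanishes exactly for a triple root, when the bracket t^2 +
  (3\<alpha>\<rho> + \<beta>)x^2 becomes a double line.\<close>

lemma sextic_double_root:
  fixes \<alpha> \<beta> \<gamma> \<delta> :: "'k::{alg_closed_field, field_char_0}"
  assumes irr: "irreducible (sextic \<alpha> \<beta> \<gamma> \<delta>)" and "\<alpha> \<noteq> 0" and dr: "double_root \<alpha> \<beta> \<gamma> \<delta> \<rho>"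
  shows "if 3 * \<alpha> * \<rho> + \<beta> = 0 then weyl_type (sextic \<alpha> \<beta> \<gamma> \<delta>) else skew_type (sextic \<alpha> \<beta> \<gamma> \<delta>)"
proof -
  let ?\<beta> = "3 * \<alpha> * \<rho> + \<beta>"
  have \<gamma>: "\<gamma> = - 3 * \<alpha> * \<rho> ^ 2 - 2 * \<beta> * \<rho>"
    using dr by (simp add: double_root_def eq_neg_iff_add_eq_0 algebra_simps)
  have "\<delta> = - (\<alpha> * \<rho> ^ 3) - \<beta> * \<rho> ^ 2 - \<gamma> * \<rho>"
    using dr by (simp add: double_root_def eq_neg_iff_add_eq_0 algebra_simps)
  then have \<delta>: "\<delta> = 2 * \<alpha> * \<rho> ^ 3 + \<beta> * \<rho> ^ 2"
    unfolding \<gamma> by (simp add: algebra_simps power2_eq_square power3_eq_cube)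
  let ?Om' = "vz ^ 2 + cst \<alpha> * vy ^ 3 + cst ?\<beta> * vx ^ 2 * vy ^ 2"
  have "ev3 cst vx (vy + cst \<rho> * vx ^ 2) vz (sextic \<alpha> \<beta> \<gamma> \<delta>) = ?Om'"
    unfolding \<delta> \<gamma> sextic_def
    by (simp add: ev_cst cst_simps algebra_simps eval_nat_numeral)
  then have eq: "surface_equiv (sextic \<alpha> \<beta> \<gamma> \<delta>) ?Om'"
    using surface_equiv_shift_y[of 2 "sextic \<alpha> \<beta> \<gamma> \<delta>" \<rho>] by simp
  then have "irreducible ?Om'" using irr surface_equiv_irreducible by blast
  note * = surface_double_root[OF this assms(2)]
  show ?thesis
  proof (cases "?\<beta> = 0")
    case True
    have "weyl_type ?Om'"
      unfolding weyl_type_def using is_poisson_iso_trans[OF *] plane_quadratic(2)[of 0 ?\<beta> 1] True by simp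
    then show ?thesis using type_equiv[OF eq irr] True by simp
  next
    case False
    have "(0 :: 'k) ^ 2 \<noteq> 4 * ?\<beta> * 1" using False by (simp del: distrib_left_numeral)
    from plane_quadratic(1)[OF this] have "skew_type ?Om'"
      unfolding skew_type_def using is_poisson_iso_trans[OF *] by blast
    then show ?thesis using type_equiv[OF eq irr] False by simp
  qed
qed

theorem sextic_rational:
  fixes \<alpha> \<beta> \<gamma> \<delta> :: "'k::{alg_closed_field, field_char_0}"
  assumes irr: "irreducible (sextic \<alpha> \<beta> \<gamma> \<delta>)" and ns: "\<not> isolated_singularity (sextic \<alpha> \<beta> \<gamma> \<delta>)"
  shows "rational_type (sextic \<alpha> \<beta> \<gamma> \<delta>)"
proof (cases "\<alpha> = 0")
  case True
  show ?thesis
    using x_square_rational[of \<beta> \<gamma> 2 \<delta>] irr unfolding True sextic_x_square by simp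
next
  case False
  have "sing (sextic \<alpha> \<beta> \<gamma> \<delta>) 0 0 0" by (simp add: sing_sextic)
  then obtain u v w where s: "sing (sextic \<alpha> \<beta> \<gamma> \<delta>) u v w" and nz: "u \<noteq> 0 \<or> v \<noteq> 0 \<or> w \<noteq> 0"
    using ns unfolding isolated_singularity_iff by blast
  have u: "u \<noteq> 0"
  proof
    assume "u = 0"
    then show False using s nz False by (auto simp: sing_sextic)
  qed
  \<comment> \<open>Scaling by the weights moves the singular point to (1, \<rho>, 0).\<close>
  define \<rho> where "\<rho> = v / u ^ 2"
  have v: "v = \<rho> * u ^ 2" using u by (simp add: \<rho>_def)
  have "u ^ 5 * (2 * \<beta> * \<rho> ^ 2 + 4 * \<gamma> * \<rho> + 6 * \<delta>) = 0" "u ^ 4 * (3 * \<alpha> * \<rho> ^ 2 + 2 * \<beta> * \<rho> + \<gamma>) = 0"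
    using s unfolding v sing_sextic by (simp_all add: algebra_simps eval_nat_numeral)
  then have *: "2 * \<beta> * \<rho> ^ 2 + 4 * \<gamma> * \<rho> + 6 * \<delta> = 0" "3 * \<alpha> * \<rho> ^ 2 + 2 * \<beta> * \<rho> + \<gamma> = 0"
    using u by simp_all
  \<comment> \<open>Euler's relation in weighted degree 6: vanishing of both partial derivatives
    implies vanishing of the form.\<close>
  have "6 * (\<alpha> * \<rho> ^ 3 + \<beta> * \<rho> ^ 2 + \<gamma> * \<rho> + \<delta>) =
      2 * \<rho> * (3 * \<alpha> * \<rho> ^ 2 + 2 * \<beta> * \<rho> + \<gamma>) + (2 * \<beta> * \<rho> ^ 2 + 4 * \<gamma> * \<rho> + 6 * \<delta>)"
    by (simp add: algebra_simps power2_eq_square power3_eq_cube)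
  then have "6 * (\<alpha> * \<rho> ^ 3 + \<beta> * \<rho> ^ 2 + \<gamma> * \<rho> + \<delta>) = 0"
    unfolding * by (simp only: mult_zero_right add_0_left)
  then have "double_root \<alpha> \<beta> \<gamma> \<delta> \<rho>"
    using * numeral_mult_eq_0 unfolding double_root_def by blast
  then show ?thesis
    using sextic_double_root[OF irr False] unfolding rational_type_iff by metis
qed

lemma elliptic_from_weierstrass:
  fixes \<alpha> \<beta> \<gamma> \<delta> :: "'k::{alg_closed_field, field_char_0}"
  assumes "\<alpha> \<noteq> 0" "\<And>\<rho>. \<not> double_root \<alpha> \<beta> \<gamma> \<delta> \<rho>"
  shows "irreducible (sextic \<alpha> \<beta> \<gamma> \<delta>)" "elliptic_type (sextic \<alpha> \<beta> \<gamma> \<delta>)"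
    "irreducible (quartic 0 \<alpha> \<beta> \<gamma> \<delta>)" "elliptic_type (quartic 0 \<alpha> \<beta> \<gamma> \<delta>)"
proof -
  have *: "irreducible (weierstrass \<alpha> \<beta> \<gamma> \<delta>)" "elliptic_type (weierstrass \<alpha> \<beta> \<gamma> \<delta>)"
    using weierstrass_hesse[OF assms] unfolding elliptic_type_def by blast+
  show "irreducible (sextic \<alpha> \<beta> \<gamma> \<delta>)" "elliptic_type (sextic \<alpha> \<beta> \<gamma> \<delta>)"
    using sextic_weierstrass[OF assms(1) *(1)] type_cong(3)[OF _ *(2)] by blast+
  show "irreducible (quartic 0 \<alpha> \<beta> \<gamma> \<delta>)" "elliptic_type (quartic 0 \<alpha> \<beta> \<gamma> \<delta>)"
    using quartic_weierstrass[OF assms(1) *(1)] type_cong(3)[OF _ *(2)] by blast+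
qed

theorem sextic_isolated:
  fixes \<alpha> \<beta> \<gamma> \<delta> :: "'k::{alg_closed_field, field_char_0}"
  assumes iso: "isolated_singularity (sextic \<alpha> \<beta> \<gamma> \<delta>)"
  shows "elliptic_type (sextic \<alpha> \<beta> \<gamma> \<delta>)"
proof -
  have "\<alpha> \<noteq> 0"
    using not_isolatedI[of "sextic \<alpha> \<beta> \<gamma> \<delta>" 0 1 0] iso by (auto simp: sing_sextic)
  moreover have "\<not> double_root \<alpha> \<beta> \<gamma> \<delta> \<rho>" for \<rho>
  proof
    assume *: "double_root \<alpha> \<beta> \<gamma> \<delta> \<rho>"
    have "2 * \<beta> * \<rho> ^ 2 + 4 * \<gamma> * \<rho> + 6 * \<delta> = 6 * (\<alpha> * \<rho> ^ 3 + \<beta> * \<rho> ^ 2 + \<gamma> * \<rho> + \<delta>)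
        - 2 * \<rho> * (3 * \<alpha> * \<rho> ^ 2 + 2 * \<beta> * \<rho> + \<gamma>)"
      by (simp add: algebra_simps power2_eq_square power3_eq_cube)
    then have "2 * \<beta> * \<rho> ^ 2 + 4 * \<gamma> * \<rho> + 6 * \<delta> = 0"
      unfolding *[unfolded double_root_def, THEN conjunct1] *[unfolded double_root_def, THEN conjunct2]
      by simp
    then have "sing (sextic \<alpha> \<beta> \<gamma> \<delta>) 1 \<rho> 0"
      using * by (simp add: sing_sextic double_root_def)
    then show False using not_isolatedI iso by fastforce
  qed
  ultimately show ?thesis using elliptic_from_weierstrass(2) by blast
qed

lemma quartic_shift:
  fixes \<alpha>' \<alpha> \<beta> \<gamma> \<delta> :: "'k::{alg_closed_field, field_char_0}"
  shows "surface_equiv (quartic \<alpha>' \<alpha> \<beta> \<gamma> \<delta>)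
    (quartic (\<alpha>' + \<alpha> * r + \<beta> * r ^ 2 + \<gamma> * r ^ 3 + \<delta> * r ^ 4) (\<alpha> + 2 * \<beta> * r + 3 * \<gamma> * r ^ 2 + 4 * \<delta> * r ^ 3)
      (\<beta> + 3 * \<gamma> * r + 6 * \<delta> * r ^ 2) (\<gamma> + 4 * \<delta> * r) \<delta>)" (is "surface_equiv ?A ?B")
proof -
  have "ev3 cst (vx + cst r * vy) vy vz ?A = ?B"
    unfolding quartic_def by (simp add: ev_cst cst_simps algebra_simps eval_nat_numeral)
  then show ?thesis using surface_equiv_shift_x[of ?A r] by simp
qed

lemma quartic_swap:
  fixes \<alpha>' \<alpha> \<beta> \<gamma> \<delta> :: "'k::{alg_closed_field, field_char_0}"
  shows "surface_equiv (quartic \<alpha>' \<alpha> \<beta> \<gamma> \<delta>) (quartic \<delta> \<gamma> \<beta> \<alpha> \<alpha>')" (is "surface_equiv ?A ?B")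
proof -
  have "ev3 cst vy vx (- vz) ?A = ?B"
    unfolding quartic_def by (simp add: ev_cst algebra_simps)
  then show ?thesis using surface_equiv_rotate(1)[of ?A] by simp
qed

text \<open>A singular point away from the origin is a repeated root of the binary quartic. Moved to
  x = 0 it removes the terms in y^4 and xy^3, and what is left is divisible by x^2.\<close>

theorem quartic_rational:
  fixes \<alpha>' \<alpha> \<beta> \<gamma> \<delta> :: "'k::{alg_closed_field, field_char_0}"
  assumes irr: "irreducible (quartic \<alpha>' \<alpha> \<beta> \<gamma> \<delta>)" and ns: "\<not> isolated_singularity (quartic \<alpha>' \<alpha> \<beta> \<gamma> \<delta>)"
  shows "rational_type (quartic \<alpha>' \<alpha> \<beta> \<gamma> \<delta>)"
proof -
  have "\<exists>\<beta> \<gamma> \<delta>. surface_equiv (quartic \<alpha>' \<alpha> \<beta>' \<gamma>' \<delta>') (quartic 0 0 \<beta> \<gamma> \<delta>)"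
    if "\<beta>' = \<beta>" "\<gamma>' = \<gamma>" "\<delta>' = \<delta>" for \<beta>' \<gamma>' \<delta>'
    unfolding that
  proof -
    have "sing (quartic \<alpha>' \<alpha> \<beta> \<gamma> \<delta>) 0 0 0" by (simp add: sing_quartic)
    then obtain u v w where s: "sing (quartic \<alpha>' \<alpha> \<beta> \<gamma> \<delta>) u v w" and nz: "u \<noteq> 0 \<or> v \<noteq> 0 \<or> w \<noteq> 0"
      using ns unfolding isolated_singularity_iff by blast
    show "\<exists>\<beta>' \<gamma>' \<delta>'. surface_equiv (quartic \<alpha>' \<alpha> \<beta> \<gamma> \<delta>) (quartic 0 0 \<beta>' \<gamma>' \<delta>')"
    proof (cases "v = 0")
      case True
      then have "\<gamma> = 0" "\<delta> = 0" using s nz by (auto simp: sing_quartic)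
      then show ?thesis using quartic_swap[of \<alpha>' \<alpha> \<beta> \<gamma> \<delta>] by auto
    next
      case False
      define r where "r = u / v"
      have u: "u = r * v" using False by (simp add: r_def)
      have "v ^ 3 * (\<alpha> + 2 * \<beta> * r + 3 * \<gamma> * r ^ 2 + 4 * \<delta> * r ^ 3) = 0"
        "v ^ 3 * (4 * \<alpha>' + 3 * \<alpha> * r + 2 * \<beta> * r ^ 2 + \<gamma> * r ^ 3) = 0"
        using s unfolding u sing_quartic by (simp_all add: algebra_simps eval_nat_numeral)
      then have *: "\<alpha> + 2 * \<beta> * r + 3 * \<gamma> * r ^ 2 + 4 * \<delta> * r ^ 3 = 0"
        "4 * \<alpha>' + 3 * \<alpha> * r + 2 * \<beta> * r ^ 2 + \<gamma> * r ^ 3 = 0"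
        using False by simp_all
      have "4 * (\<alpha>' + \<alpha> * r + \<beta> * r ^ 2 + \<gamma> * r ^ 3 + \<delta> * r ^ 4) =
          r * (\<alpha> + 2 * \<beta> * r + 3 * \<gamma> * r ^ 2 + 4 * \<delta> * r ^ 3) + (4 * \<alpha>' + 3 * \<alpha> * r + 2 * \<beta> * r ^ 2 + \<gamma> * r ^ 3)"
        by (simp add: algebra_simps eval_nat_numeral)
      then have "4 * (\<alpha>' + \<alpha> * r + \<beta> * r ^ 2 + \<gamma> * r ^ 3 + \<delta> * r ^ 4) = 0"
        unfolding * by (simp only: mult_zero_right add_0_left)
      then have "\<alpha>' + \<alpha> * r + \<beta> * r ^ 2 + \<gamma> * r ^ 3 + \<delta> * r ^ 4 = 0"
        by (rule numeral_mult_eq_0)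
      then show ?thesis using quartic_shift[of \<alpha>' \<alpha> \<beta> \<gamma> \<delta> r] unfolding * by auto
    qed
  qed
  then obtain \<beta>' \<gamma>' \<delta>' where eq: "surface_equiv (quartic \<alpha>' \<alpha> \<beta> \<gamma> \<delta>) (quartic 0 0 \<beta>' \<gamma>' \<delta>')"
    by blast
  then have "rational_type (quartic 0 0 \<beta>' \<gamma>' \<delta>')"
    using irr surface_equiv_irreducible unfolding quartic_x_square by (intro x_square_rational) auto
  then show ?thesis using type_equiv[OF eq irr] by blast
qed

text \<open>Any root of the binary quartic, moved to x = 0, splits off the factor x. A double root
  of the remaining cubic would be a singular point, so the Weierstrass form is nonsingular.\<close>

theorem quartic_isolated:
  fixes \<alpha>' \<alpha> \<beta> \<gamma> \<delta> :: "'k::{alg_closed_field, field_char_0}"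
  assumes iso: "isolated_singularity (quartic \<alpha>' \<alpha> \<beta> \<gamma> \<delta>)"
  shows "irreducible (quartic \<alpha>' \<alpha> \<beta> \<gamma> \<delta>)" "elliptic_type (quartic \<alpha>' \<alpha> \<beta> \<gamma> \<delta>)"
proof -
  have "\<exists>a b c d. surface_equiv (quartic \<alpha>' \<alpha> \<beta> \<gamma> \<delta>) (quartic 0 a b c d)"
  proof (cases "\<delta> = 0")
    case True
    then show ?thesis using quartic_swap[of \<alpha>' \<alpha> \<beta> \<gamma> \<delta>] by auto
  next
    case False
    then obtain r where "poly [:\<alpha>', \<alpha>, \<beta>, \<gamma>, \<delta>:] r = 0"
      using alg_closed_imp_poly_has_root[of "[:\<alpha>', \<alpha>, \<beta>, \<gamma>, \<delta>:]"] by auto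
    then have "\<alpha>' + \<alpha> * r + \<beta> * r ^ 2 + \<gamma> * r ^ 3 + \<delta> * r ^ 4 = 0"
      by (simp add: algebra_simps eval_nat_numeral)
    then show ?thesis using quartic_shift[of \<alpha>' \<alpha> \<beta> \<gamma> \<delta> r] by auto
  qed
  then obtain a b c d where eq: "surface_equiv (quartic \<alpha>' \<alpha> \<beta> \<gamma> \<delta>) (quartic 0 a b c d)"
    by blast
  then have iso': "isolated_singularity (quartic 0 a b c d)"
    using iso surface_equiv_isolated by blast
  have "a \<noteq> 0"
    using not_isolatedI[of "quartic 0 a b c d" 0 1 0] iso' by (auto simp: sing_quartic)
  moreover have "\<not> double_root a b c d \<rho>" for \<rho>
  proof
    assume *: "double_root a b c d \<rho>"
    have "a * \<rho> ^ 3 + 2 * b * \<rho> ^ 2 + 3 * c * \<rho> + 4 * d =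
        4 * (a * \<rho> ^ 3 + b * \<rho> ^ 2 + c * \<rho> + d) - \<rho> * (3 * a * \<rho> ^ 2 + 2 * b * \<rho> + c)"
      by (simp add: algebra_simps power2_eq_square power3_eq_cube)
    then have "a * \<rho> ^ 3 + 2 * b * \<rho> ^ 2 + 3 * c * \<rho> + 4 * d = 0"
      unfolding *[unfolded double_root_def, THEN conjunct1] *[unfolded double_root_def, THEN conjunct2]
      by simp
    then have "sing (quartic 0 a b c d) 1 \<rho> 0"
      using * by (simp add: sing_quartic double_root_def)
    then show False using not_isolatedI iso' by fastforce
  qed
  ultimately have *: "irreducible (quartic 0 a b c d)" "elliptic_type (quartic 0 a b c d)"
    using elliptic_from_weierstrass(3,4) by blast+
  then show "irreducible (quartic \<alpha>' \<alpha> \<beta> \<gamma> \<delta>)" using eq surface_equiv_irreducible by blast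
  then show "elliptic_type (quartic \<alpha>' \<alpha> \<beta> \<gamma> \<delta>)" using type_equiv[OF eq] * by blast
qed


section \<open>Ternary cubics\<close>

definition cubic :: "'k::field \<Rightarrow> 'k \<Rightarrow> 'k \<Rightarrow> 'k \<Rightarrow> 'k \<Rightarrow> 'k \<Rightarrow> 'k \<Rightarrow> 'k \<Rightarrow> 'k \<Rightarrow> 'k \<Rightarrow> 'k poly3" where
  "cubic k l1 l0 p2 p1 p0 q3 q2 q1 q0 = cst k * vz ^ 3 + (cst l1 * vx + cst l0 * vy) * vz ^ 2
    + (cst p2 * vx ^ 2 + cst p1 * vx * vy + cst p0 * vy ^ 2) * vz
    + (cst q3 * vx ^ 3 + cst q2 * vx ^ 2 * vy + cst q1 * vx * vy ^ 2 + cst q0 * vy ^ 3)"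

lemma sing_cubic: "sing (cubic k l1 l0 p2 p1 p0 q3 q2 q1 q0) u v w \<longleftrightarrow>
    l1 * w ^ 2 + (2 * p2 * u + p1 * v) * w + (3 * q3 * u ^ 2 + 2 * q2 * u * v + q1 * v ^ 2) = 0 \<and>
    l0 * w ^ 2 + (p1 * u + 2 * p0 * v) * w + (q2 * u ^ 2 + 2 * q1 * u * v + 3 * q0 * v ^ 2) = 0 \<and>
    3 * k * w ^ 2 + 2 * (l1 * u + l0 * v) * w + (p2 * u ^ 2 + p1 * u * v + p0 * v ^ 2) = 0"
  by (simp add: sing_def cubic_def partial_simps ev_id algebra_simps)

lemma cubic_shear:
  fixes k l1 l0 p2 p1 p0 q3 q2 q1 q0 :: "'k::{alg_closed_field, field_char_0}"
  shows "surface_equiv (cubic k l1 l0 p2 p1 p0 q3 q2 q1 q0)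
   (cubic (k + l1 * u + l0 * v + p2 * u ^ 2 + p1 * u * v + p0 * v ^ 2 + q3 * u ^ 3 + q2 * u ^ 2 * v + q1 * u * v ^ 2 + q0 * v ^ 3)
     (l1 + (2 * p2 * u + p1 * v) + (3 * q3 * u ^ 2 + 2 * q2 * u * v + q1 * v ^ 2))
     (l0 + (p1 * u + 2 * p0 * v) + (q2 * u ^ 2 + 2 * q1 * u * v + 3 * q0 * v ^ 2))
     (p2 + 3 * q3 * u + q2 * v) (p1 + 2 * q2 * u + 2 * q1 * v) (p0 + q1 * u + 3 * q0 * v) q3 q2 q1 q0)"
  (is "surface_equiv ?A ?B")
proof -
  have "ev3 cst (vx + cst u * vz) (vy + cst v * vz) vz ?A = ?B"
    unfolding cubic_def by (simp add: ev_cst cst_simps algebra_simps eval_nat_numeral)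
  then show ?thesis using surface_equiv_shear_z[of ?A u v] by simp
qed

lemma cubic_rotate_xz:
  "ev3 cst (- vz) vy vx (cubic k l1 l0 p2 p1 p0 q3 q2 q1 q0) =
    cubic (- q3) p2 q2 (- l1) (- p1) (- q1) k l0 p0 q0"
  unfolding cubic_def by (simp add: ev_cst cst_simps algebra_simps eval_nat_numeral)

lemma cubic_rotate_yz:
  "ev3 cst vx (- vz) vy (cubic k l1 l0 p2 p1 p0 q3 q2 q1 q0) =
    cubic (- q0) q1 p0 (- q2) (- p1) (- l0) q3 p2 l1 k"
  unfolding cubic_def by (simp add: ev_cst cst_simps algebra_simps eval_nat_numeral)

lemma binary_cubic_reducible:
  fixes q3 q2 q1 q0 :: "'k::alg_closed_field"
  shows "\<not> irreducible (cubic 0 0 0 0 0 0 q3 q2 q1 q0)"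
proof
  let ?f = "cst q3 * vx ^ 3 + cst q2 * vx ^ 2 * vy + cst q1 * vx * vy ^ 2 + cst q0 * vy ^ 3"
  assume irr: "irreducible (cubic 0 0 0 0 0 0 q3 q2 q1 q0)"
  have f: "cubic 0 0 0 0 0 0 q3 q2 q1 q0 = ?f" by (simp add: cubic_def cst_simps)
  have unit: "ev3 (\<lambda>s. s) 0 0 0 a \<noteq> 0" if "a dvd 1" for a :: "'k poly3"
    using ring_map_dvd[OF ring_map_ev3[OF ring_map_id] that, of 0 0 0] by (auto simp: ev_id)
  have no: False if "?f = a * b" "ev3 (\<lambda>s. s) 0 0 0 a = 0" "ev3 (\<lambda>s. s) 0 0 0 b = 0" for a b
    using irr unit that unfolding f irreducible_def by blast
  show False
  proof (cases "q0 = 0")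
    case True
    show False
      by (rule no[of vx "cst q3 * vx ^ 2 + cst q2 * vx * vy + cst q1 * vy ^ 2"])
        (simp_all add: True cst_simps ev_id algebra_simps eval_nat_numeral)
  next
    case False
    then obtain r where "poly [:q3, q2, q1, q0:] r = 0"
      using alg_closed_imp_poly_has_root[of "[:q3, q2, q1, q0:]"] by auto
    then have q3: "q3 = - (q0 * r ^ 3 + q1 * r ^ 2 + q2 * r)"
      by (simp add: algebra_simps eval_nat_numeral eq_neg_iff_add_eq_0)
    show False
      by (rule no[of "vy - cst r * vx" "cst q0 * (vy ^ 2 + cst r * vx * vy + cst (r ^ 2) * vx ^ 2)
            + cst q1 * vx * (vy + cst r * vx) + cst q2 * vx ^ 2"])
        (simp_all add: q3 cst_simps ev_id algebra_simps eval_nat_numeral)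
  qed
qed

lemma cubic_linear_rational:
  fixes p2 p1 p0 q3 q2 q1 q0 :: "'k::{alg_closed_field, field_char_0}"
  assumes irr: "irreducible (cubic 0 0 0 p2 p1 p0 q3 q2 q1 q0)"
  shows "rational_type (cubic 0 0 0 p2 p1 p0 q3 q2 q1 q0)"
proof -
  let ?p = "pcst p2 * px ^ 2 + pcst p1 * px * py + pcst p0 * py ^ 2"
  let ?q = "pcst q3 * px ^ 3 + pcst q2 * px ^ 2 * py + pcst q1 * px * py ^ 2 + pcst q0 * py ^ 3"
  have eq: "cubic 0 0 0 p2 p1 p0 q3 q2 q1 q0 = emb ?q + emb ?p * vz"
    by (simp add: cubic_def cst_simps emb_simps emb_gens)
  have p: "p2 \<noteq> 0 \<or> p1 \<noteq> 0 \<or> p0 \<noteq> 0"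
    using irr binary_cubic_reducible by blast
  have "?p \<noteq> 0"
  proof
    assume "?p = 0"
    then have "ev2 (\<lambda>s. s) u v ?p = 0" for u v by (simp add: ev_id)
    from this[of 1 0] this[of 0 1] this[of 1 1] show False using p by (simp add: ev_id)
  qed
  then have *: "poisson_Q (emb ?q + emb ?p * vz) \<simeq>\<^sub>P plane_frac ?p"
    using surface_linear irr unfolding eq by blast
  show ?thesis
  proof (cases "p1 ^ 2 = 4 * p2 * p0")
    case True
    then have "p2 \<noteq> 0 \<or> p0 \<noteq> 0" using p by auto
    then show ?thesis
      using is_poisson_iso_trans[OF *] plane_quadratic(2)[OF True] unfolding rational_type_def eq by blast
  next
    case False
    show ?thesis
      using is_poisson_iso_trans[OF *] plane_quadratic(1)[OF False] unfolding rational_type_def eq by blast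
  qed
qed

text \<open>A shear moves the singular point to (0 : 0 : 1). The coefficients of z^3 and z^2 are
  then the value and the derivatives at that point, so they vanish and the cubic becomes linear in
  z.\<close>

lemma cubic_sing_z:
  fixes k l1 l0 p2 p1 p0 q3 q2 q1 q0 :: "'k::{alg_closed_field, field_char_0}"
  assumes irr: "irreducible (cubic k l1 l0 p2 p1 p0 q3 q2 q1 q0)"
    and s: "sing (cubic k l1 l0 p2 p1 p0 q3 q2 q1 q0) u v w" and w: "w \<noteq> 0"
  shows "rational_type (cubic k l1 l0 p2 p1 p0 q3 q2 q1 q0)"
proof -
  define r t where "r = u / w" and "t = v / w"
  have uv: "u = r * w" "v = t * w" using w by (simp_all add: r_def t_def)
  have "w ^ 2 * (l1 + (2 * p2 * r + p1 * t) + (3 * q3 * r ^ 2 + 2 * q2 * r * t + q1 * t ^ 2)) = 0"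
    "w ^ 2 * (l0 + (p1 * r + 2 * p0 * t) + (q2 * r ^ 2 + 2 * q1 * r * t + 3 * q0 * t ^ 2)) = 0"
    "w ^ 2 * (3 * k + 2 * (l1 * r + l0 * t) + (p2 * r ^ 2 + p1 * r * t + p0 * t ^ 2)) = 0"
    using s unfolding uv sing_cubic by (simp_all add: algebra_simps eval_nat_numeral)
  then have *: "l1 + (2 * p2 * r + p1 * t) + (3 * q3 * r ^ 2 + 2 * q2 * r * t + q1 * t ^ 2) = 0"
    "l0 + (p1 * r + 2 * p0 * t) + (q2 * r ^ 2 + 2 * q1 * r * t + 3 * q0 * t ^ 2) = 0"
    "3 * k + 2 * (l1 * r + l0 * t) + (p2 * r ^ 2 + p1 * r * t + p0 * t ^ 2) = 0"
    using w by simp_all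
  \<comment> \<open>Euler's relation in degree 3.\<close>
  have "3 * (k + l1 * r + l0 * t + p2 * r ^ 2 + p1 * r * t + p0 * t ^ 2 + q3 * r ^ 3 + q2 * r ^ 2 * t + q1 * r * t ^ 2 + q0 * t ^ 3)
    = r * (l1 + (2 * p2 * r + p1 * t) + (3 * q3 * r ^ 2 + 2 * q2 * r * t + q1 * t ^ 2))
    + t * (l0 + (p1 * r + 2 * p0 * t) + (q2 * r ^ 2 + 2 * q1 * r * t + 3 * q0 * t ^ 2))
    + (3 * k + 2 * (l1 * r + l0 * t) + (p2 * r ^ 2 + p1 * r * t + p0 * t ^ 2))"
    by (simp add: algebra_simps eval_nat_numeral)
  then have "3 * (k + l1 * r + l0 * t + p2 * r ^ 2 + p1 * r * t + p0 * t ^ 2 + q3 * r ^ 3 + q2 * r ^ 2 * t + q1 * r * t ^ 2 + q0 * t ^ 3) = 0"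
    unfolding * by (simp only: mult_zero_right add_0_left)
  then have k: "k + l1 * r + l0 * t + p2 * r ^ 2 + p1 * r * t + p0 * t ^ 2 + q3 * r ^ 3 + q2 * r ^ 2 * t + q1 * r * t ^ 2 + q0 * t ^ 3 = 0"
    by (rule numeral_mult_eq_0)
  note eq = cubic_shear[of k l1 l0 p2 p1 p0 q3 q2 q1 q0 r t, unfolded * k]
  then show ?thesis
    using type_equiv(4)[OF eq irr] cubic_linear_rational irr surface_equiv_irreducible by blast
qed

text \<open>A singular point with last coordinate zero is first rotated so that a nonzero coordinate
  takes the place of z.\<close>

theorem cubic_rational:
  fixes k l1 l0 p2 p1 p0 q3 q2 q1 q0 :: "'k::{alg_closed_field, field_char_0}"
  assumes irr: "irreducible (cubic k l1 l0 p2 p1 p0 q3 q2 q1 q0)" (is "irreducible ?Om")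
    and ns: "\<not> isolated_singularity (cubic k l1 l0 p2 p1 p0 q3 q2 q1 q0)"
  shows "rational_type (cubic k l1 l0 p2 p1 p0 q3 q2 q1 q0)"
proof -
  have "sing ?Om 0 0 0" by (simp add: sing_cubic)
  then obtain u v w where s: "sing ?Om u v w" and nz: "u \<noteq> 0 \<or> v \<noteq> 0 \<or> w \<noteq> 0"
    using ns unfolding isolated_singularity_iff by blast
  show ?thesis
  proof (cases "w = 0")
    case False
    then show ?thesis using cubic_sing_z[OF irr s] by blast
  next
    case w: True
    show ?thesis
    proof (cases "v = 0")
      case False
      note eq = surface_equiv_rotate(3)[of ?Om, unfolded cubic_rotate_yz]
      have "sing (cubic (- q0) q1 p0 (- q2) (- p1) (- l0) q3 p2 l1 k) u w (- v)"
        by (rule sing_subst[of ?Om _ _ _ vx "- vz" vy 1])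
          (use s in \<open>simp_all add: ev_id cubic_rotate_yz cst_simps\<close>)
      from cubic_sing_z[OF _ this] show ?thesis
        using type_equiv(4)[OF eq irr] irr surface_equiv_irreducible[OF eq] False by simp
    next
      case True
      note eq = surface_equiv_rotate(2)[of ?Om, unfolded cubic_rotate_xz]
      have "sing (cubic (- q3) p2 q2 (- l1) (- p1) (- q1) k l0 p0 q0) w v (- u)"
        by (rule sing_subst[of ?Om _ _ _ "- vz" vy vx 1])
          (use s in \<open>simp_all add: ev_id cubic_rotate_xz cst_simps\<close>)
      from cubic_sing_z[OF _ this] show ?thesis
        using type_equiv(4)[OF eq irr] irr surface_equiv_irreducible[OF eq] True w nz by simp
    qed
  qed
qed

text \<open>
  A singular point of the discriminant quartic \<open>lq - p\<^sup>2/4\<close> lies under a singular point of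
  \<open>lz\<^sup>2 + pz + q\<close>, by Euler's relations for the partial derivatives \<open>Lx, \<dots>, Qy\<close> at \<open>(u,v)\<close>.
\<close>

lemma singular_point_above:
  fixes u v :: "'k::{alg_closed_field, field_char_0}"
  assumes euler: "u * Lx + v * Ly = L" "u * Px + v * Py = 2 * P" "u * Qx + v * Qy = 3 * Q"
    and g: "Lx * Q + L * Qx - P * Px / 2 = 0" "Ly * Q + L * Qy - P * Py / 2 = 0"
    and nz: "u \<noteq> 0 \<or> v \<noteq> 0" "Lx \<noteq> 0 \<or> Ly \<noteq> 0"
  shows "\<exists>z. Lx * z ^ 2 + Px * z + Qx = 0 \<and> Ly * z ^ 2 + Py * z + Qy = 0 \<and> 2 * L * z + P = 0"
proof -
  \<comment> \<open>Euler's relation for the quartic LQ - P^2/4: a singular point of it also lies on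
    it.\<close>
  have "u * (Lx * Q + L * Qx - P * Px / 2) + v * (Ly * Q + L * Qy - P * Py / 2) =
      (u * Lx + v * Ly) * Q + L * (u * Qx + v * Qy) - P * (u * Px + v * Py) / 2"
    by (simp add: field_simps)
  then have "L * Q + L * (3 * Q) - P * (2 * P) / 2 = 0"
    unfolding g euler by simp
  then have PQ: "P ^ 2 = 4 * L * Q"
    by (simp add: field_simps power2_eq_square)
  show ?thesis
  proof (cases "L = 0")
    case False
    \<comment> \<open>This is the double root of Lz^2 + Pz + Q, the unique point of the surface over
      (u,v).\<close>
    define z where "z = - P / (2 * L)"
    have z2: "z ^ 2 = Q / L"
      using PQ False by (simp add: z_def power_divide field_simps power2_eq_square)
    have "Lx * z ^ 2 + Px * z + Qx = (Lx * Q + L * Qx - P * Px / 2) / L"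
      unfolding z2 using False by (simp add: z_def field_simps)
    moreover have "Ly * z ^ 2 + Py * z + Qy = (Ly * Q + L * Qy - P * Py / 2) / L"
      unfolding z2 using False by (simp add: z_def field_simps)
    moreover have "2 * L * z + P = 0" using False by (simp add: z_def)
    ultimately show ?thesis unfolding g by auto
  next
    case True
    then have P: "P = 0" using PQ by simp
    have Q: "Q = 0" using g nz(2) P True by auto
    \<comment> \<open>When L = P = Q = 0 the whole fibre lies on the surface and z is still free.
      Euler's relations tie the two remaining quadratics together, so one with nonzero leading
      coefficient is solved and the other follows.\<close>
    have e: "u * (Lx * z ^ 2 + Px * z + Qx) + v * (Ly * z ^ 2 + Py * z + Qy) = 0" for z
    proof -
      have "u * (Lx * z ^ 2 + Px * z + Qx) + v * (Ly * z ^ 2 + Py * z + Qy) =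
        (u * Lx + v * Ly) * z ^ 2 + (u * Px + v * Py) * z + (u * Qx + v * Qy)"
        by (simp add: algebra_simps)
      then show ?thesis unfolding euler using True P Q by simp
    qed
    have root: "\<exists>z. A * z ^ 2 + B * z + C = 0" if "A \<noteq> 0" for A B C :: 'k
      using alg_closed_imp_poly_has_root[of "[:C, B, A:]"] that
      by (auto simp: algebra_simps power2_eq_square)
    have uv: "u * Lx + v * Ly = 0" using euler True by simp
    show ?thesis
    proof (cases "u = 0")
      case u: True
      then have "Lx \<noteq> 0" using uv nz by auto
      then obtain z where "Lx * z ^ 2 + Px * z + Qx = 0" using root by blast
      moreover from this have "Ly * z ^ 2 + Py * z + Qy = 0" using e[of z] u nz by auto
      ultimately show ?thesis using True P by auto
    next
      case u: False
      then have "Ly \<noteq> 0" using uv nz by auto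
      then obtain z where "Ly * z ^ 2 + Py * z + Qy = 0" using root by blast
      moreover from this have "Lx * z ^ 2 + Px * z + Qx = 0" using e[of z] u by auto
      ultimately show ?thesis using True P by auto
    qed
  qed
qed

lemma cubic_isolated_aux:
  fixes l1 l0 p2 p1 p0 q3 q2 q1 q0 :: "'k::{alg_closed_field, field_char_0}"
  assumes irr: "irreducible (cubic 0 l1 l0 p2 p1 p0 q3 q2 q1 q0)" (is "irreducible ?Om")
    and iso: "isolated_singularity (cubic 0 l1 l0 p2 p1 p0 q3 q2 q1 q0)"
  shows "elliptic_type (cubic 0 l1 l0 p2 p1 p0 q3 q2 q1 q0)"
proof -
  let ?l = "pcst l1 * px + pcst l0 * py"
  let ?p = "pcst p2 * px ^ 2 + pcst p1 * px * py + pcst p0 * py ^ 2"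
  let ?q = "pcst q3 * px ^ 3 + pcst q2 * px ^ 2 * py + pcst q1 * px * py ^ 2 + pcst q0 * py ^ 3"
  have eq: "?Om = emb ?q + emb ?p * vz + emb ?l * vz ^ 2"
    by (simp add: cubic_def cst_simps emb_simps emb_gens)
  have l: "l1 \<noteq> 0 \<or> l0 \<noteq> 0"
    using not_isolatedI[of ?Om 0 0 1] iso by (auto simp: sing_cubic)
  have l': "?l \<noteq> 0"
  proof
    assume "?l = 0"
    then have "ev2 (\<lambda>s. s) u v ?l = 0" for u v by (simp add: ev_id)
    from this[of 1 0] this[of 0 1] show False using l by (simp add: ev_id)
  qed
  \<comment> \<open>These are the coefficients of lq - p^2/4, the branch quartic of the projection
    from (0 : 0 : 1).\<close>
  let ?g4 = "l0 * q0 - p0 ^ 2 / 4" and ?g3 = "l1 * q0 + l0 * q1 - p1 * p0 / 2"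
    and ?g2 = "l1 * q1 + l0 * q2 - (p1 ^ 2 + 2 * p2 * p0) / 4" and ?g1 = "l1 * q2 + l0 * q3 - p2 * p1 / 2"
    and ?g0 = "l1 * q3 - p2 ^ 2 / 4"
  let ?G = "quartic ?g4 ?g3 ?g2 ?g1 ?g0"
  have G: "vz ^ 2 + emb (?l * ?q - pcst (1 / 4) * ?p ^ 2) = ?G"
  proof -
    have h: "pcst (s / 2) = pcst (1 / 4) * (2 * pcst s)" "pcst (s / 4) = pcst (1 / 4) * pcst s" for s :: 'k
      unfolding pcst_simps(9)[symmetric] pcst_simps(2)[symmetric] by (simp_all add: pcst_simps)
    have "?G = vz ^ 2 + emb (pcst ?g4 * py ^ 4 + pcst ?g3 * px * py ^ 3 + pcst ?g2 * px ^ 2 * py ^ 2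
        + pcst ?g1 * px ^ 3 * py + pcst ?g0 * px ^ 4)"
      by (simp add: quartic_def emb_simps emb_gens)
    also have "pcst ?g4 * py ^ 4 + pcst ?g3 * px * py ^ 3 + pcst ?g2 * px ^ 2 * py ^ 2
        + pcst ?g1 * px ^ 3 * py + pcst ?g0 * px ^ 4 = ?l * ?q - pcst (1 / 4) * ?p ^ 2"
      unfolding pcst_simps(1,6) h(1)[of "p1 * p0"] h(1)[of "p2 * p1"] h(2)[of "p0 ^ 2"] h(2)[of "p2 ^ 2"]
        h(2)[of "p1 ^ 2 + 2 * p2 * p0"] by (simp add: pcst_simps algebra_simps eval_nat_numeral)
    finally show ?thesis by simp
  qed
  have "isolated_singularity ?G"
    unfolding isolated_singularity_iff
  proof (intro allI iffI)
    fix u v w assume s: "sing ?G u v w"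
    then have w: "w = 0" by (simp add: sing_quartic)
    have "u = 0 \<and> v = 0"
    proof (rule ccontr)
      assume nz: "\<not> (u = 0 \<and> v = 0)"
      let ?L = "l1 * u + l0 * v" and ?P = "p2 * u ^ 2 + p1 * u * v + p0 * v ^ 2"
        and ?Q = "q3 * u ^ 3 + q2 * u ^ 2 * v + q1 * u * v ^ 2 + q0 * v ^ 3"
        and ?Px = "2 * p2 * u + p1 * v" and ?Py = "p1 * u + 2 * p0 * v"
        and ?Qx = "3 * q3 * u ^ 2 + 2 * q2 * u * v + q1 * v ^ 2"
        and ?Qy = "q2 * u ^ 2 + 2 * q1 * u * v + 3 * q0 * v ^ 2"
      have "\<exists>z. l1 * z ^ 2 + ?Px * z + ?Qx = 0 \<and> l0 * z ^ 2 + ?Py * z + ?Qy = 0 \<and> 2 * ?L * z + ?P = 0"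
      proof (rule singular_point_above)
        show "u * l1 + v * l0 = ?L" "u * ?Px + v * ?Py = 2 * ?P" "u * ?Qx + v * ?Qy = 3 * ?Q"
          by (simp_all add: algebra_simps eval_nat_numeral)
        have "l1 * ?Q + ?L * ?Qx - ?P * ?Px / 2 = ?g3 * v ^ 3 + 2 * ?g2 * u * v ^ 2 + 3 * ?g1 * u ^ 2 * v + 4 * ?g0 * u ^ 3"
          by (simp add: field_simps eval_nat_numeral)
        then show "l1 * ?Q + ?L * ?Qx - ?P * ?Px / 2 = 0" using s by (simp add: sing_quartic)
        have "l0 * ?Q + ?L * ?Qy - ?P * ?Py / 2 = 4 * ?g4 * v ^ 3 + 3 * ?g3 * u * v ^ 2 + 2 * ?g2 * u ^ 2 * v + ?g1 * u ^ 3"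
          by (simp add: field_simps eval_nat_numeral)
        then show "l0 * ?Q + ?L * ?Qy - ?P * ?Py / 2 = 0" using s by (simp add: sing_quartic)
      qed (use nz l in auto)
      then obtain z where "sing ?Om u v z" by (auto simp: sing_cubic)
      then show False using not_isolatedI iso nz by blast
    qed
    then show "u = 0 \<and> v = 0 \<and> w = 0" using w by simp
  qed (simp add: sing_quartic)
  note Giso = quartic_isolated[OF this]
  have "poisson_Q ?G \<simeq>\<^sub>P poisson_Q ?Om"
    using cubic_double_cover[OF irr[unfolded eq] _ l'] Giso(1) unfolding G eq by blast
  then have "poisson_Q ?Om \<simeq>\<^sub>P poisson_Q ?G"
    using surface_frac_sym irreducible_imp_prime_poly3 Giso(1) by blast
  then show ?thesis using type_cong(3) Giso(2) by blast
qed

theorem cubic_isolated: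
  fixes k l1 l0 p2 p1 p0 q3 q2 q1 q0 :: "'k::{alg_closed_field, field_char_0}"
  assumes irr: "irreducible (cubic k l1 l0 p2 p1 p0 q3 q2 q1 q0)" (is "irreducible ?Om")
    and iso: "isolated_singularity (cubic k l1 l0 p2 p1 p0 q3 q2 q1 q0)"
  shows "elliptic_type (cubic k l1 l0 p2 p1 p0 q3 q2 q1 q0)"
proof (cases "k = 0")
  case True
  then show ?thesis using cubic_isolated_aux irr iso by blast
next
  case False
  \<comment> \<open>The point (0 : 1 : r) lies on the cubic; a rotation and a shear move it to (0 :
    0 : 1), where the projection starts.\<close>
  then obtain r where "poly [:q0, p0, l0, k:] r = 0"
    using alg_closed_imp_poly_has_root[of "[:q0, p0, l0, k:]"] by auto
  then have "q0 + p0 * r + l0 * r ^ 2 + k * r ^ 3 = 0"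
    by (simp add: algebra_simps eval_nat_numeral)
  moreover have "- q0 + q1 * 0 + p0 * (- r) + (- q2) * 0 ^ 2 + (- p1) * 0 * (- r) + (- l0) * (- r) ^ 2
      + q3 * 0 ^ 3 + p2 * 0 ^ 2 * (- r) + l1 * 0 * (- r) ^ 2 + k * (- r) ^ 3 = - (q0 + p0 * r + l0 * r ^ 2 + k * r ^ 3)"
    by (simp add: power2_eq_square power3_eq_cube)
  ultimately have r: "- q0 + q1 * 0 + p0 * (- r) + (- q2) * 0 ^ 2 + (- p1) * 0 * (- r) + (- l0) * (- r) ^ 2
      + q3 * 0 ^ 3 + p2 * 0 ^ 2 * (- r) + l1 * 0 * (- r) ^ 2 + k * (- r) ^ 3 = 0" by simp
  note eq = surface_equiv_trans[OF surface_equiv_rotate(3)[of ?Om, unfolded cubic_rotate_yz] cubic_shear[of _ _ _ _ _ _ _ _ _ _ 0 "- r"], unfolded r]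
  show ?thesis
    using cubic_isolated_aux type_equiv(3)[OF eq irr] surface_equiv_irreducible[OF eq]
      surface_equiv_isolated[OF eq] irr iso by blast
qed

section \<open>Weighted homogeneous polynomials\<close>

lemma whomogeneousD: "whomogeneous a b c d f \<Longrightarrow> coeff (coeff (coeff f l) j) i \<noteq> 0 \<Longrightarrow> a * i + b * j + c * l = d"
  by (simp add: whomogeneous_def)

lemma whomogeneous_add: "whomogeneous a b c d f \<Longrightarrow> whomogeneous a b c d g \<Longrightarrow> whomogeneous a b c d (f + g)"
  unfolding whomogeneous_def by (metis add.right_neutral coeff_add)

lemma whomogeneous_uminus: "whomogeneous a b c d f \<Longrightarrow> whomogeneous a b c d (- f)"
  by (simp add: whomogeneous_def)

lemma whomogeneous_mult:
  assumes "whomogeneous a b c d f" "whomogeneous a b c e g"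
  shows "whomogeneous a b c (d + e) (f * g)"
  unfolding whomogeneous_def
proof (intro allI impI)
  fix i j l assume "coeff (coeff (coeff (f * g) l) j) i \<noteq> 0"
  then obtain l' where l: "l' \<le> l" "coeff (coeff (coeff f l' * coeff g (l - l')) j) i \<noteq> 0"
    unfolding coeff_mult[of f] coeff_sum by (auto elim!: sum.not_neutral_contains_not_neutral)
  then obtain j' where j: "j' \<le> j" "coeff (coeff (coeff f l') j' * coeff (coeff g (l - l')) (j - j')) i \<noteq> 0"
    unfolding coeff_mult[of "coeff f l'"] coeff_sum by (auto elim!: sum.not_neutral_contains_not_neutral)
  then obtain i' where i: "i' \<le> i" "coeff (coeff (coeff f l') j') i' * coeff (coeff (coeff g (l - l')) (j - j')) (i - i') \<noteq> 0"
    unfolding coeff_mult by (auto elim!: sum.not_neutral_contains_not_neutral)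
  then have "a * i' + b * j' + c * l' = d" "a * (i - i') + b * (j - j') + c * (l - l') = e"
    using assms whomogeneousD by (metis mult_zero_left, metis mult_zero_right)
  moreover have "a * i = a * i' + a * (i - i')" "b * j = b * j' + b * (j - j')" "c * l = c * l' + c * (l - l')"
    using l(1) j(1) i(1) by (simp_all flip: distrib_left)
  ultimately show "a * i + b * j + c * l = d + e" by linarith
qed

lemma whomogeneous_gens: "whomogeneous a b c 0 (cst s)" "whomogeneous a b c a vx" "whomogeneous a b c b vy"
    "whomogeneous a b c c vz"
  by (auto simp: whomogeneous_def cst_def vx_def vy_def vz_def coeff_pCons split: nat.splits if_splits)

lemma whomogeneous_power: "whomogeneous a b c d f \<Longrightarrow> whomogeneous a b c (d * n) (f ^ n)"
proof (induction n)
  case 0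
  then show ?case using whomogeneous_gens(1)[of a b c 1] by (simp add: cst_simps)
next
  case (Suc n)
  then show ?case using whomogeneous_mult[of a b c d f "d * n"] by simp
qed

lemma whomogeneous_emb: "whomogeneous a b c d (emb h) \<longleftrightarrow> (\<forall>i j. coeff (coeff h j) i \<noteq> 0 \<longrightarrow> a * i + b * j = d)"
proof -
  have "coeff (emb h) l = (if l = 0 then h else 0)" for l
    by (simp add: emb_def coeff_pCons split: nat.splits)
  then show ?thesis by (auto simp: whomogeneous_def split: if_splits)
qed

lemma monom_unique_coeff: "(\<And>i. coeff h i \<noteq> 0 \<Longrightarrow> i = n) \<Longrightarrow> h = monom (coeff h n) n"
  by (rule poly_eqI) auto

text \<open>Meant for forms whose weight fixes the exponent \<open>n j\<close> of x that accompanies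
  y^j.\<close>

lemma binary_form:
  assumes "\<And>i j. coeff (coeff h j) i \<noteq> 0 \<Longrightarrow> j \<le> 4 \<and> i = n j"
  shows "h = pcst (coeff (coeff h 4) (n 4)) * px ^ n 4 * py ^ 4 + pcst (coeff (coeff h 3) (n 3)) * px ^ n 3 * py ^ 3
    + pcst (coeff (coeff h 2) (n 2)) * px ^ n 2 * py ^ 2 + pcst (coeff (coeff h 1) (n 1)) * px ^ n 1 * py
    + pcst (coeff (coeff h 0) (n 0)) * px ^ n 0"
  unfolding binary_pCons
proof (rule poly_eqI)
  fix j
  have *: "coeff h j = monom (coeff (coeff h j) (n j)) (n j)" for j
    by (rule monom_unique_coeff) (use assms in blast)
  have "coeff h j = 0" if "j > 4"
    by (rule poly_eqI) (use assms[of j] that in fastforce)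
  then show "coeff h j = coeff [:monom (coeff (coeff h 0) (n 0)) (n 0), monom (coeff (coeff h 1) (n 1)) (n 1),
      monom (coeff (coeff h 2) (n 2)) (n 2), monom (coeff (coeff h 3) (n 3)) (n 3), monom (coeff (coeff h 4) (n 4)) (n 4):] j"
    unfolding *[symmetric] by (auto simp: coeff_pCons numeral_eq_Suc split: nat.splits)
qed

lemma unit_poly3: "u dvd 1 \<Longrightarrow> \<exists>\<kappa>. \<kappa> \<noteq> 0 \<and> u = cst (\<kappa> :: 'k::field)"
  by (auto simp: is_unit_poly_iff cst_def)

lemma ev_origin: "ev2 (\<lambda>s. s) 0 0 h = coeff (coeff h 0) 0"
  by (induction h rule: poly2_induct)
    (simp_all add: ev_id coeff_mult, simp_all add: pcst_def px_def py_def)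

lemma partial_origin: "ev2 (\<lambda>s. s) 0 0 (pdx h) = coeff (coeff h 0) 1" "ev2 (\<lambda>s. s) 0 0 (pdy h) = coeff (coeff h 1) 0"
  by (simp_all add: ev_origin pdx_def pdy_def coeff_map_poly coeff_pderiv)

lemma vx_dvdI:
  fixes f :: "'k::field poly3"
  assumes "\<And>j l. coeff (coeff (coeff f l) j) 0 = 0"
  shows "vx dvd f"
proof -
  have "[:0, 1:] dvd h" if "coeff h 0 = 0" for h :: "'k poly"
    using that by (cases h) (auto intro!: dvdI)
  then show ?thesis
    using assms by (simp add: vx_def const_poly_dvd_iff)
qed

lemma irreducible_dvd:
  assumes "irreducible f" "v dvd f" "\<not> v dvd 1"
  shows "\<exists>\<kappa>. \<kappa> \<noteq> 0 \<and> f = v * cst (\<kappa> :: 'k::field)"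
proof -
  obtain u where u: "f = v * u" using assms by (auto elim: dvdE)
  then have "u dvd 1" using assms by (auto simp: irreducible_def)
  then show ?thesis using unit_poly3 u by blast
qed

lemma vars_not_unit: "\<not> vx dvd (1 :: 'k::field poly3)" "\<not> vy dvd (1 :: 'k poly3)"
  using ring_map_dvd[OF ring_map_ev3[OF ring_map_id], of vx 1 0 0 0]
    ring_map_dvd[OF ring_map_ev3[OF ring_map_id], of vy 1 0 0 0] by (auto simp: ev_id)

lemma irreducible_dvd_weight:
  assumes "irreducible f" "whomogeneous a b c d f"
  shows "vx dvd f \<Longrightarrow> d = a" "vy dvd f \<Longrightarrow> d = b"
proof -
  assume "vx dvd f"
  then obtain \<kappa> where "\<kappa> \<noteq> 0" "f = vx * cst \<kappa>" using irreducible_dvd assms vars_not_unit by blast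
  then have "coeff (coeff (coeff f 0) 0) 1 \<noteq> 0" by (simp add: vx_def cst_def)
  then show "d = a" using whomogeneousD[OF assms(2)] by fastforce
next
  assume "vy dvd f"
  then obtain \<kappa> where "\<kappa> \<noteq> 0" "f = vy * cst \<kappa>" using irreducible_dvd assms vars_not_unit by blast
  then have "coeff (coeff (coeff f 0) 1) 0 \<noteq> 0" by (simp add: vy_def cst_def)
  then show "d = b" using whomogeneousD[OF assms(2)] by fastforce
qed

text \<open>At (0, 0, 1) only constant and linear terms of \<open>p\<close> and \<open>q\<close>
  contribute to the gradient, and the weights exclude all of them.\<close>

lemma sing_linear_in_z:
  assumes "whomogeneous a b c d (emb q)" "whomogeneous a b c e (emb p)" "1 \<le> a" "a < d" "b < d" "a < e" "b < e"
  shows "\<not> isolated_singularity (emb q + emb p * vz)"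
proof (rule not_isolatedI[of _ 0 0 1])
  have *: "coeff (coeff h 0) 0 = 0" "coeff (coeff h 0) 1 = 0" "coeff (coeff h 1) 0 = 0"
    if "whomogeneous a b c d (emb h)" "a < d" "b < d" for h d
    using that unfolding whomogeneous_emb by fastforce+
  show "sing (emb q + emb p * vz) 0 0 1"
    using *[OF assms(1)] *[OF assms(2)] assms(4-7)
    by (simp add: sing_def partial_simps ev_id ev3_emb ring_map_id partial_origin) (simp add: ev_origin)
qed simp


section \<open>The classification of the function fields\<close>

lemma linear_quadratic_type:
  fixes e f g :: "'k::{alg_closed_field, field_char_0}"
  defines "p \<equiv> pcst e * px ^ 2 + pcst f * px * py + pcst g * py ^ 2"
  assumes irr: "irreducible (emb q + emb p * vz)" and p0: "p \<noteq> 0"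
  shows "f ^ 2 \<noteq> 4 * e * g \<Longrightarrow> skew_type (emb q + emb p * vz)"
    "f ^ 2 = 4 * e * g \<Longrightarrow> weyl_type (emb q + emb p * vz)"
proof -
  note * = is_poisson_iso_trans[OF surface_linear[OF irr p0]]
  show "skew_type (emb q + emb p * vz)" if "f ^ 2 \<noteq> 4 * e * g"
    using plane_quadratic(1)[OF that] * unfolding p_def skew_type_def by blast
  show "weyl_type (emb q + emb p * vz)" if "f ^ 2 = 4 * e * g"
  proof -
    have "e \<noteq> 0 \<or> g \<noteq> 0" using p0 that by (auto simp: p_def pcst_simps)
    then show ?thesis using plane_quadratic(2)[OF that] * unfolding p_def weyl_type_def by blast
  qed
qed

lemma linear_curve_type:
  fixes \<alpha> \<beta> :: "'k::{alg_closed_field, field_char_0}" and n :: nat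
  defines "p \<equiv> px * (pcst \<alpha> * py + pcst \<beta> * px ^ n)"
  assumes irr: "irreducible (emb q + emb p * vz)" and p0: "p \<noteq> 0"
  shows "\<alpha> \<noteq> 0 \<Longrightarrow> skew_type (emb q + emb p * vz)" "\<alpha> = 0 \<Longrightarrow> weyl_type (emb q + emb p * vz)"
proof -
  note * = is_poisson_iso_trans[OF surface_linear[OF irr p0]]
  show "skew_type (emb q + emb p * vz)" if "\<alpha> \<noteq> 0"
    using plane_axis_and_curve[OF that, of \<beta> n] * that unfolding p_def skew_type_def by blast
  show "weyl_type (emb q + emb p * vz)" if "\<alpha> = 0"
  proof -
    have "\<beta> \<noteq> 0" using p0 that by (auto simp: p_def pcst_simps)
    moreover have "p = pcst \<beta> * px ^ Suc n" using that by (simp add: p_def pcst_simps mult_ac)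
    ultimately show ?thesis using plane_monomial[of \<beta> "Suc n"] * unfolding weyl_type_def by metis
  qed
qed

lemma cusp_type:
  fixes \<alpha> \<beta> :: "'k::{alg_closed_field, field_char_0}"
  assumes irr: "irreducible (cst \<alpha> * vx ^ m + cst \<beta> * vy ^ n)"
    and nz: "\<alpha> \<noteq> 0" "\<beta> \<noteq> 0" and mn: "m \<ge> 1" "n \<ge> 1" "coprime m n"
  shows "weyl_type (cst \<alpha> * vx ^ m + cst \<beta> * vy ^ n)" (is "weyl_type ?Om")
proof -
  let ?Om' = "cst \<alpha> * vx ^ m + cst ((- 1) ^ n * \<beta>) * vz ^ n"
  have "ev3 cst vx (- vz) vy ?Om = ?Om'"
    by (simp add: ev_cst cst_simps power_minus[of vz] mult_ac)
  then have eq: "surface_equiv ?Om ?Om'"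
    using surface_equiv_rotate(3)[of ?Om] by simp
  then have "irreducible ?Om'" using irr surface_equiv_irreducible by blast
  then have "weyl_type ?Om'"
    unfolding weyl_type_def using nz mn by (intro surface_cusp) auto
  then show ?thesis using type_equiv[OF eq irr] by blast
qed

lemma diff_dvd_power_diff: "(u :: 'a::comm_ring_1) - v dvd u ^ n - v ^ n"
proof (induction n)
  case (Suc n)
  have "u ^ Suc n - v ^ Suc n = u * (u ^ n - v ^ n) + (u - v) * v ^ n" by (simp add: algebra_simps)
  then show ?case using Suc by simp
qed simp

text \<open>
  Dividing the weights by their gcd makes the polynomial a binary form in \<open>x\<^sup>b\<close> and \<open>y\<^sup>a\<close>, which
  over an algebraically closed field has a linear factor.
\<close>

lemma plane_curve_type:
  fixes q :: "'k::{alg_closed_field, field_char_0} poly poly"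
  assumes irr: "irreducible (emb q)" and h: "\<And>i j. coeff (coeff q j) i \<noteq> 0 \<Longrightarrow> a * i + b * j = d"
    and ab: "1 \<le> a" "1 \<le> b" "d \<noteq> a" "d \<noteq> b"
  shows "weyl_type (emb q)"
proof -
  have wh: "whomogeneous a b c d (emb q)" for c
    using h by (simp add: whomogeneous_emb)
  have nx: "\<not> vx dvd emb q" and ny: "\<not> vy dvd emb q"
    using irreducible_dvd_weight[OF irr wh] ab by auto
  \<comment> \<open>Neither variable divides \<open>q\<close>, so pure powers y^n and x^m both
    occur; comparing their weights shows that a' divides n.\<close>
  have "\<exists>j. coeff (coeff q j) 0 \<noteq> 0"
  proof (rule ccontr)
    assume "\<not> ?thesis"
    then have "vx dvd emb q" by (intro vx_dvdI) (simp add: emb_def coeff_pCons split: nat.splits)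
    then show False using nx by blast
  qed
  then obtain n where n: "coeff (coeff q n) 0 \<noteq> 0" by blast
  have "coeff q 0 \<noteq> 0"
  proof
    assume "coeff q 0 = 0"
    then obtain t where "q = py * t" by (cases q) (auto simp: py_def)
    then show False using ny by (auto simp: emb_simps emb_gens)
  qed
  then obtain m where m: "coeff (coeff q 0) m \<noteq> 0" by (metis coeff_0 poly_eqI)
  define g a' b' where "g = gcd a b" and "a' = a div g" and "b' = b div g"
  have g: "g > 0" "a = g * a'" "b = g * b'" using ab by (simp_all add: g_def a'_def b'_def)
  have co: "coprime a' b'"
    unfolding a'_def b'_def g_def using ab by (intro div_gcd_coprime) auto
  have pos: "a' > 0" "b' > 0" using ab g by (auto intro: gr0I)
  have bn: "b * n = d" and am: "a * m = d" using h[OF n] h[OF m] by simp_all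
  then have "b' * n = a' * m" using g by (metis mult.assoc mult_left_cancel less_numeral_extra(3))
  then have "a' dvd n" using co by (metis coprime_dvd_mult_right_iff dvd_triv_left)
  then obtain t where t: "n = a' * t" by blast
  have d: "d = g * (a' * b' * t)" using bn g t by (simp add: mult_ac)
  have "t > 0" using am m d ab irr wh n
  proof -
    have "t \<noteq> 0"
    proof
      assume "t = 0"
      then have d0: "d = 0" using d by simp
      have "i = 0 \<and> j = 0" if "coeff (coeff q j) i \<noteq> 0" for i j
        using h[OF that] d0 ab by auto
      then have "q = pcst (coeff (coeff q 0) 0)"
        unfolding pcst_def
        by (intro poly_eqI) (auto simp: coeff_pCons split: nat.splits)
      then have "emb q = cst (coeff (coeff q 0) 0)" by (metis emb_gens(1))
      then show False using irr cst_unit by (metis cst_eq_0 irreducible_def)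
    qed
    then show ?thesis by simp
  qed
  let ?V = "px ^ b' :: 'k poly poly" and ?W = "py ^ a' :: 'k poly poly"
  \<comment> \<open>With V = x^b' and W = y^a', every monomial of weight d is some V^(t-s) W^s, so
    \<open>q\<close> is a binary form of degree t with coefficients \<open>e s\<close>.\<close>
  define e where "e s = coeff (coeff q (a' * s)) (b' * (t - s))" for s
  have q: "q = (\<Sum>s\<le>t. pcst (e s) * ?V ^ (t - s) * ?W ^ s)"
  proof (intro poly_eqI)
    fix j i
    have pyp: "py ^ k = monom 1 k" for k
      by (simp add: py_def monom_altdef)
    have monomial: "coeff (coeff (pcst (e s) * ?V ^ (t - s) * ?W ^ s) j) i =
        (if a' * s = j \<and> b' * (t - s) = i then e s else 0)" for s
    proof -
      have "pcst (e s) * ?V ^ (t - s) * ?W ^ s = monom (monom (e s) (b' * (t - s))) (a' * s)"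
        unfolding power_mult[symmetric] unfolding px_power pyp
        by (simp add: pcst_def smult_monom)
      then show ?thesis by auto
    qed
    have "coeff (coeff q j) i = (\<Sum>s\<le>t. if a' * s = j \<and> b' * (t - s) = i then e s else 0)"
    proof (cases "\<exists>s\<le>t. a' * s = j \<and> b' * (t - s) = i")
      case True
      then obtain s where s: "s \<le> t" "a' * s = j" "b' * (t - s) = i" by blast
      have "(\<Sum>s'\<le>t. if a' * s' = j \<and> b' * (t - s') = i then e s' else 0) = (\<Sum>s'\<le>t. if s' = s then e s' else 0)"
        using s pos by (intro sum.cong) auto
      also have "\<dots> = e s" using s by simp
      finally show ?thesis using s by (simp add: e_def)
    next
      case False
      then have "(\<Sum>s\<le>t. if a' * s = j \<and> b' * (t - s) = i then e s else 0) = 0"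
        by (intro sum.neutral) auto
      moreover have "coeff (coeff q j) i = 0"
      proof (rule ccontr)
        assume "coeff (coeff q j) i \<noteq> 0"
        then have "a * i + b * j = d" by (rule h)
        moreover have "a * i + b * j = g * (a' * i + b' * j)"
          unfolding g(2,3) by (simp add: algebra_simps)
        ultimately have "g * (a' * i + b' * j) = g * (a' * b' * t)"
          using d by simp
        then have ij: "a' * i + b' * j = a' * b' * t" using g by simp
        then have "a' dvd b' * j"
          by (metis dvd_add_right_iff dvd_triv_left mult.assoc)
        then have "a' dvd j" using co by (metis coprime_dvd_mult_right_iff)
        then obtain s where s: "j = a' * s" by blast
        have "a' * (i + b' * s) = a' * (b' * t)" using ij s by (simp add: algebra_simps)
        then have i: "i + b' * s = b' * t" using pos by simp
        then have "s \<le> t" using pos by (metis le_add2 mult_le_cancel1)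
        moreover have "b' * (t - s) = i" using i by (simp add: diff_mult_distrib2)
        ultimately show False using False s by blast
      qed
      ultimately show ?thesis by simp
    qed
    then show "coeff (coeff q j) i = coeff (coeff (\<Sum>s\<le>t. pcst (e s) * ?V ^ (t - s) * ?W ^ s) j) i"
      by (simp add: coeff_sum monomial)
  qed
  define R where "R = (\<Sum>s\<le>t. monom (e s) s)"
  have "coeff R t = e t" by (simp add: R_def coeff_sum)
  moreover have "e t \<noteq> 0" using n t by (simp add: e_def)
  ultimately have "degree R > 0" using \<open>t > 0\<close> le_degree[of R t] by simp
  then obtain \<rho> where "poly R \<rho> = 0" using alg_closed_imp_poly_has_root by blast
  then have \<rho>: "(\<Sum>s\<le>t. e s * \<rho> ^ s) = 0" by (simp add: R_def poly_sum poly_monom)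
  let ?U = "?W - pcst \<rho> * ?V"
  \<comment> \<open>Subtracting a multiple of the vanishing value R(\<rho>) turns the s-th term into
    a multiple of W^s - (\<rho>V)^s, hence of W - \<rho>V.\<close>
  have "q = q - pcst (\<Sum>s\<le>t. e s * \<rho> ^ s) * ?V ^ t" unfolding \<rho> by (simp add: pcst_simps)
  also have "pcst (\<Sum>s\<le>t. e s * \<rho> ^ s) = (\<Sum>s\<le>t. pcst (e s) * pcst \<rho> ^ s)"
    by (induction t) (simp_all add: pcst_simps)
  also have "q - (\<Sum>s\<le>t. pcst (e s) * pcst \<rho> ^ s) * ?V ^ t =
      (\<Sum>s\<le>t. pcst (e s) * ?V ^ (t - s) * (?W ^ s - (pcst \<rho> * ?V) ^ s))"
    unfolding q sum_distrib_right sum_subtractf[symmetric]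
  proof (rule sum.cong)
    fix s assume "s \<in> {..t}"
    then have "?V ^ t = ?V ^ (t - s) * ?V ^ s" by (simp flip: power_add)
    then show "pcst (e s) * ?V ^ (t - s) * ?W ^ s - pcst (e s) * pcst \<rho> ^ s * ?V ^ t =
        pcst (e s) * ?V ^ (t - s) * (?W ^ s - (pcst \<rho> * ?V) ^ s)"
      by (simp add: power_mult_distrib algebra_simps)
  qed simp
  finally have "?U dvd q"
    using diff_dvd_power_diff by (metis (no_types, lifting) dvd_mult dvd_sum)
  then have "emb ?U dvd emb q" by (rule ring_map_dvd[OF ring_map_emb])
  moreover have "\<not> emb ?U dvd 1"
  proof
    assume "emb ?U dvd 1"
    then have "ev3 (\<lambda>s. s) 0 0 0 (emb ?U) dvd (ev3 (\<lambda>s. s) 0 0 0 1 :: 'k)"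
      by (rule ring_map_dvd[OF ring_map_ev3[OF ring_map_id]])
    then show False using pos by (simp add: ev3_emb ring_map_id ev_id power_0_left)
  qed
  ultimately obtain \<kappa> where \<kappa>: "\<kappa> \<noteq> 0" "emb q = emb ?U * cst \<kappa>"
    using irreducible_dvd[OF irr] by blast
  then have eq: "emb q = cst (- (\<kappa> * \<rho>)) * vx ^ b' + cst \<kappa> * vy ^ a'"
    by (simp add: emb_simps emb_gens cst_simps algebra_simps)
  have "\<rho> \<noteq> 0"
  proof
    assume "\<rho> = 0"
    then have "emb q = cst \<kappa> * vy ^ a'" using eq by (simp add: cst_simps)
    then have "vy dvd emb q" using pos by (simp add: dvd_power)
    then show False using ny by blast
  qed
  then show ?thesis
    using cusp_type[of "- (\<kappa> * \<rho>)" b' \<kappa> a'] irr \<kappa>(1) pos co unfolding eq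
    by (simp add: coprime_commute)
qed

text \<open>The bracket \<open>p\<close> has weight a + b. For a = b it is a quadratic form; for a <
  b only xy and, if a divides b, x^(1+b/a) have this weight.\<close>

lemma linear_in_z_type:
  fixes p q :: "'k::{alg_closed_field, field_char_0} poly poly"
  assumes irr: "irreducible (emb q + emb p * vz)"
    and q: "\<And>i j. coeff (coeff q j) i \<noteq> 0 \<Longrightarrow> a * i + b * j = a + b + c"
    and p: "\<And>i j. coeff (coeff p j) i \<noteq> 0 \<Longrightarrow> a * i + b * j = a + b"
    and ab: "1 \<le> a" "a \<le> b"
  shows "rational_type (emb q + emb p * vz)"
proof (cases "p = 0")
  case True
  then show ?thesis
    using plane_curve_type[of q a b "a + b + c"] irr q ab unfolding rational_type_iff
    by (simp add: emb_simps)
next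
  case p0: False
  show ?thesis
  proof (cases "a = b")
    case True
    have h: "j \<le> 2 \<and> i = 2 - j" if "coeff (coeff p j) i \<noteq> 0" for i j
    proof -
      have "a * (i + j) = a * 2" using p[OF that] True by (simp add: algebra_simps)
      then have "i + j = 2" using ab by simp
      then show ?thesis by linarith
    qed
    then have "coeff (coeff p 3) i = 0" "coeff (coeff p 4) i = 0" for i by fastforce+
    then have "p = pcst (coeff (coeff p 0) 2) * px ^ 2 + pcst (coeff (coeff p 1) 1) * px * py + pcst (coeff (coeff p 2) 0) * py ^ 2"
      using binary_form[of p "\<lambda>j. 2 - j"] h by (fastforce simp: pcst_simps add_ac)
    then show ?thesis
      using linear_quadratic_type irr p0 unfolding rational_type_iff by metis
  next
    case False
    then have "a < b" using ab by simp
    \<comment> \<open>If a does not divide b, no power of x has weight a + b and the coefficient of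
      x^(n+1) is zero.\<close>
    define n where "n = b div a"
    have h: "j \<le> 1 \<and> i = (if j = 0 then Suc n else 1)" if "coeff (coeff p j) i \<noteq> 0" for i j
    proof -
      have e: "a * i + b * j = a + b" by (rule p[OF that])
      have "j < 2"
      proof (rule ccontr)
        assume "\<not> j < 2"
        then have "b * 2 \<le> b * j" by simp
        then show False using e \<open>a < b\<close> by linarith
      qed
      then consider "j = 0" | "j = 1" by linarith
      then show ?thesis
      proof cases
        case 1
        then have "a * i = a + b" using e by simp
        then have "i = (a + b) div a" using ab by (metis nonzero_mult_div_cancel_left not_one_le_zero)
        then show ?thesis using 1 ab by (simp add: n_def)
      next
        case 2
        then show ?thesis using e ab by simp
      qed
    qed
    then have "coeff (coeff p 2) i = 0" "coeff (coeff p 3) i = 0" "coeff (coeff p 4) i = 0" for i by fastforce+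
    then have "p = px * (pcst (coeff (coeff p 1) 1) * py + pcst (coeff (coeff p 0) (Suc n)) * px ^ n)"
      using binary_form[of p "\<lambda>j. if j = 0 then Suc n else 1"] h by (fastforce simp: pcst_simps algebra_simps)
    then show ?thesis
      using linear_curve_type irr p0 unfolding rational_type_iff by metis
  qed
qed

text \<open>The form \<open>g\<close> has weight 2(a + b). It is a quartic for a = b and a sextic
  for b = 2a; for all other weights its degree in y is at most 2 and x^2 divides it, which makes the
  y-axis singular.\<close>

lemma monic_quadratic_type:
  fixes g :: "'k::{alg_closed_field, field_char_0} poly poly"
  assumes irr: "irreducible (vz ^ 2 + emb g)"
    and g: "\<And>i j. coeff (coeff g j) i \<noteq> 0 \<Longrightarrow> a * i + b * j = 2 * (a + b)"
    and ab: "1 \<le> a" "a \<le> b"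
  shows "\<not> isolated_singularity (vz ^ 2 + emb g) \<Longrightarrow> rational_type (vz ^ 2 + emb g)"
    "isolated_singularity (vz ^ 2 + emb g) \<Longrightarrow> elliptic_type (vz ^ 2 + emb g)"
proof -
  consider "a = b" | "b = 2 * a" | "a < b" "b \<noteq> 2 * a" using ab by linarith
  then have "(\<not> isolated_singularity (vz ^ 2 + emb g) \<longrightarrow> rational_type (vz ^ 2 + emb g)) \<and>
    (isolated_singularity (vz ^ 2 + emb g) \<longrightarrow> elliptic_type (vz ^ 2 + emb g))"
  proof cases
    case 1
    have h: "j \<le> 4 \<and> i = 4 - j" if "coeff (coeff g j) i \<noteq> 0" for i j
    proof -
      have "a * (i + j) = a * 4" using g[OF that] 1 by (simp add: algebra_simps)
      then have "i + j = 4" using ab by simp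
      then show ?thesis by linarith
    qed
    have "vz ^ 2 + emb g = quartic (coeff (coeff g 4) 0) (coeff (coeff g 3) 1) (coeff (coeff g 2) 2)
        (coeff (coeff g 1) 3) (coeff (coeff g 0) 4)"
      using arg_cong[OF binary_form[of g "\<lambda>j. 4 - j", OF h], of emb]
      by (simp add: quartic_def emb_simps emb_gens)
    then show ?thesis using quartic_rational quartic_isolated irr by metis
  next
    case 2
    have h: "j \<le> 3 \<and> i = 6 - 2 * j" if "coeff (coeff g j) i \<noteq> 0" for i j
    proof -
      have "a * (i + 2 * j) = a * 6" using g[OF that] 2 by (simp add: algebra_simps)
      then have "i + 2 * j = 6" using ab by simp
      then show ?thesis by linarith
    qed
    then have "coeff (coeff g 4) i = 0" for i by fastforce
    then have "vz ^ 2 + emb g = sextic (coeff (coeff g 3) 0) (coeff (coeff g 2) 2)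
        (coeff (coeff g 1) 4) (coeff (coeff g 0) 6)"
      using arg_cong[OF binary_form[of g "\<lambda>j. 6 - 2 * j"], of emb] h
      by (fastforce simp: sextic_def emb_simps emb_gens cst_simps)
    then show ?thesis using sextic_rational sextic_isolated irr by metis
  next
    case 3
    have h: "(j = 2 \<and> i = 2) \<or> (j = 1 \<and> a * i = 2 * a + b) \<or> (j = 0 \<and> a * i = 2 * a + 2 * b)"
      if "coeff (coeff g j) i \<noteq> 0" for i j
    proof -
      have e: "a * i + b * j = 2 * (a + b)" by (rule g[OF that])
      \<comment> \<open>For j \<ge> 3 the weight forces i = 0; then j = 3 means b = 2a, and j \<ge>
        4 contradicts a < b.\<close>
      have "j < 3"
      proof (rule ccontr)
        assume j: "\<not> j < 3"
        then obtain k where "j = 3 + k" by (metis le_Suc_ex not_less)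
        then have "a * i + 3 * b + b * k = 2 * a + 2 * b" using e by (simp add: algebra_simps)
        then have le: "a * i + b \<le> 2 * a" by linarith
        then have "a * i < a * 1" using 3 by linarith
        then have "i = 0" by simp
        then have bj: "b * j = 2 * a + 2 * b" using e by simp
        show False
        proof (cases "j = 3")
          case True
          then show False using bj 3 by simp
        next
          case False
          then have "4 \<le> j" using j by linarith
          then obtain k where "j = 4 + k" by (metis le_Suc_ex)
          then have "4 * b + b * k = 2 * a + 2 * b" using bj by (simp add: algebra_simps)
          then show False using 3 by linarith
        qed
      qed
      then consider "j = 0" | "j = 1" | "j = 2" by linarith
      then show ?thesis using e ab by cases auto
    qed
    have z: "coeff (coeff g 3) i = 0" "coeff (coeff g 4) i = 0" for i
      using h[of 3 i] h[of 4 i] by auto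
    \<comment> \<open>The division is exact only if a divides 2b; otherwise the coefficient of
      x^(N+2) is zero.\<close>
    define N where "N = 2 * b div a"
    show ?thesis
    proof (cases "a dvd b")
      case True
      then obtain n where n: "b = a * n" by blast
      then have "n \<ge> 1" using 3 by (cases n) auto
      have "j \<le> 4 \<and> i = (if j = 0 then 2 * n + 2 else if j = 1 then n + 2 else 2)"
        if "coeff (coeff g j) i \<noteq> 0" for i j
      proof -
        have cancel: "a * i = a * k \<Longrightarrow> i = k" for k
          using ab by simp
        have "2 * a + b = a * (n + 2)" "2 * a + 2 * b = a * (2 * n + 2)"
          unfolding n by (simp_all add: algebra_simps)
        then have "a * i = 2 * a + b \<Longrightarrow> i = n + 2" "a * i = 2 * a + 2 * b \<Longrightarrow> i = 2 * n + 2"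
          using cancel by metis+
        then show ?thesis using h[OF that] by auto
      qed
      from arg_cong[where f = emb, OF binary_form[where h = g, OF this]] z
      have "vz ^ 2 + emb g = vz ^ 2 + vx ^ 2 * (cst (coeff (coeff g 2) 2) * vy ^ 2
          + cst (coeff (coeff g 1) (n + 2)) * vx ^ n * vy + cst (coeff (coeff g 0) (2 * n + 2)) * vx ^ (2 * n))"
        by (simp add: emb_simps emb_gens cst_simps power_add power2_eq_square algebra_simps)
      then show ?thesis using x_square_rational x_square_not_isolated irr \<open>n \<ge> 1\<close> by metis
    next
      case False
      have z1: "coeff (coeff g 1) i = 0" for i
      proof (rule ccontr)
        assume "coeff (coeff g 1) i \<noteq> 0"
        then have "a * i = 2 * a + b" using h by fastforce
        then have "b = a * i - a * 2" by simp
        then show False using False by simp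
      qed
      have "j \<le> 4 \<and> i = (if j = 0 then N + 2 else 2)" if "coeff (coeff g j) i \<noteq> 0" for i j
      proof -
        have "i = N + 2" if "a * i = 2 * a + 2 * b"
        proof -
          have "i = (2 * a + 2 * b) div a" using that ab by (metis nonzero_mult_div_cancel_left not_one_le_zero)
          then show ?thesis using ab by (simp add: N_def)
        qed
        moreover have "j \<noteq> 1" using that z1 by auto
        ultimately show ?thesis using h[OF that] by auto
      qed
      from arg_cong[where f = emb, OF binary_form[where h = g, OF this]] z z1
      have eq: "vz ^ 2 + emb g = vz ^ 2 + vx ^ 2 * (cst (coeff (coeff g 2) 2) * vy ^ 2 + cst (coeff (coeff g 0) (N + 2)) * vx ^ N)"
        by (simp add: emb_simps emb_gens cst_simps power_add power2_eq_square algebra_simps)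
      have ns: "\<not> isolated_singularity (vz ^ 2 + emb g)"
        unfolding eq using x_square_not_isolated[of "coeff (coeff g 2) 2" 0 0 _ N] by (simp add: cst_simps)
      have "N \<ge> 1" using 3 ab by (simp add: N_def div_greater_zero_iff Suc_le_eq)
      have "rational_type (vz ^ 2 + emb g)"
      proof (cases "coeff (coeff g 2) 2 = 0")
        case c2: False
        then show ?thesis
          using surface_conic[OF irr[unfolded eq] c2 \<open>N \<ge> 1\<close>] unfolding rational_type_iff skew_type_def eq by blast
      next
        case c2: True
        have c0: "coeff (coeff g 0) (N + 2) \<noteq> 0"
          using irr not_irreducible_even[of 0 0 0] c2 unfolding eq by (auto simp: cst_simps)
        have "a * (N + 2) = 2 * a + 2 * b" using h[OF c0] by simp
        then have N: "a * N = 2 * b" by (simp add: algebra_simps)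
        have "odd N"
        proof
          assume "even N"
          then obtain k where "N = 2 * k" by blast
          then have "a * k = b" using N by simp
          then show False using False by auto
        qed
        then obtain M where M: "N = 2 * M + 1" by (auto elim: oddE)
        have eq': "vz ^ 2 + emb g = vz ^ 2 + cst (coeff (coeff g 0) (N + 2)) * vx ^ (2 * M + 3)"
          unfolding eq using c2 by (simp add: cst_simps M algebra_simps numeral_eq_Suc)
        show ?thesis
          using surface_cylinder[OF irr[unfolded eq'] c0] unfolding rational_type_iff weyl_type_def eq' by blast
      qed
      then show ?thesis using ns by blast
    qed
  qed
  then show "\<not> isolated_singularity (vz ^ 2 + emb g) \<Longrightarrow> rational_type (vz ^ 2 + emb g)"
    "isolated_singularity (vz ^ 2 + emb g) \<Longrightarrow> elliptic_type (vz ^ 2 + emb g)" by blast+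
qed

lemma cubic_form:
  fixes f :: "'k::field poly3"
  assumes "whomogeneous a a a (a + a + a) f" "1 \<le> a"
  shows "\<exists>k l1 l0 p2 p1 p0 q3 q2 q1 q0. f = cubic k l1 l0 p2 p1 p0 q3 q2 q1 q0"
proof -
  have h: "i + j + l = 3" if "coeff (coeff (coeff f l) j) i \<noteq> 0" for i j l
  proof -
    have "a * (i + j + l) = a * 3" using whomogeneousD[OF assms(1) that] by (simp add: algebra_simps)
    then show ?thesis using assms(2) by simp
  qed
  have z: "coeff (coeff (coeff f l) j) i = 0" if "i + j + l \<noteq> 3" for i j l
    using h that by blast
  \<comment> \<open>Where the natural-number subtraction truncates, the total degree is not 3 and
    the coefficient is zero.\<close>
  define F where "F l = pcst (coeff (coeff (coeff f l) 4) (3 - l - 4)) * px ^ (3 - l - 4) * py ^ 4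
    + pcst (coeff (coeff (coeff f l) 3) (3 - l - 3)) * px ^ (3 - l - 3) * py ^ 3
    + pcst (coeff (coeff (coeff f l) 2) (3 - l - 2)) * px ^ (3 - l - 2) * py ^ 2
    + pcst (coeff (coeff (coeff f l) 1) (3 - l - 1)) * px ^ (3 - l - 1) * py
    + pcst (coeff (coeff (coeff f l) 0) (3 - l - 0)) * px ^ (3 - l - 0)" for l
  have F: "coeff f l = F l" for l
    unfolding F_def by (rule binary_form) (use h in fastforce)
  have "coeff f l = 0" if "l > 3" for l
    by (intro poly_eqI) (use that z in auto)
  then have "f = [:F 0, F 1, F 2, F 3:]"
    unfolding F[symmetric]
    by (intro poly_eqI) (auto simp: coeff_pCons numeral_eq_Suc split: nat.splits)
  also have "\<dots> = emb (F 0) + emb (F 1) * vz + emb (F 2) * vz ^ 2 + emb (F 3) * vz ^ 3"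
    by (simp add: emb_def vz_def power2_eq_square power3_eq_cube)
  also have "\<dots> = cubic (coeff (coeff (coeff f 3) 0) 0) (coeff (coeff (coeff f 2) 0) 1) (coeff (coeff (coeff f 2) 1) 0)
      (coeff (coeff (coeff f 1) 0) 2) (coeff (coeff (coeff f 1) 1) 1) (coeff (coeff (coeff f 1) 2) 0)
      (coeff (coeff (coeff f 0) 0) 3) (coeff (coeff (coeff f 0) 1) 2) (coeff (coeff (coeff f 0) 2) 1) (coeff (coeff (coeff f 0) 3) 0)"
    unfolding F_def cubic_def by (simp add: z emb_simps emb_gens pcst_simps cst_simps algebra_simps)
  finally show ?thesis by blast
qed

theorem classification:
  fixes Om :: "'k::{alg_closed_field, field_char_0} poly3"
  assumes irr: "irreducible Om" and wh: "whomogeneous a b c (a + b + c) Om" and abc: "1 \<le> a" "a \<le> b" "b \<le> c"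
  shows "\<not> isolated_singularity Om \<Longrightarrow> rational_type Om" "isolated_singularity Om \<Longrightarrow> elliptic_type Om"
proof -
  note h = whomogeneousD[OF wh]
  have "(\<not> isolated_singularity Om \<longrightarrow> rational_type Om) \<and> (isolated_singularity Om \<longrightarrow> elliptic_type Om)"
  proof (cases "b = c")
    case bc: True
    have "a = b"
    proof (rule ccontr)
      assume "a \<noteq> b"
      then have "a < b" using abc by simp
      \<comment> \<open>A monomial free of x has weight divisible by b = c, while a + 2b is not
        divisible by b when 0 < a < b.\<close>
      have "vx dvd Om"
      proof (rule vx_dvdI, rule ccontr)
        fix j l assume "coeff (coeff (coeff Om l) j) 0 \<noteq> 0"
        then have "b * (j + l) = a + b * 2" using h bc by (fastforce simp: algebra_simps)
        then have "b dvd a" by (metis dvd_add_left_iff dvd_triv_left)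
        then show False using \<open>a < b\<close> abc by (auto dest: dvd_imp_le)
      qed
      then have "a + b + c = a" using irreducible_dvd_weight[OF irr wh] by blast
      then show False using abc by simp
    qed
    then have "whomogeneous a a a (a + a + a) Om" using wh bc by simp
    from cubic_form[OF this abc(1)]
    obtain k l1 l0 p2 p1 p0 q3 q2 q1 q0 where "Om = cubic k l1 l0 p2 p1 p0 q3 q2 q1 q0"
      by blast
    then show ?thesis using cubic_rational cubic_isolated irr by blast
  next
    case False
    then have "b < c" using abc by simp
    \<comment> \<open>Since b < c, 3c exceeds a + b + c. The coefficient of z^2 has weight a + b - c
      < a, hence it is a constant and is nonzero only for c = a + b.\<close>
    have l2: "l \<le> 2" if "coeff (coeff (coeff Om l) j) i \<noteq> 0" for i j l
    proof (rule ccontr)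
      assume "\<not> l \<le> 2"
      then have "c * 3 \<le> c * l" by simp
      then show False using h[OF that] abc \<open>b < c\<close> by linarith
    qed
    have ij: "c = a + b \<and> i = 0 \<and> j = 0" if "coeff (coeff (coeff Om 2) j) i \<noteq> 0" for i j
    proof -
      have e: "a * i + b * j + c = a + b" using h[OF that] by simp
      have "a * i < a * 1" using e \<open>b < c\<close> by linarith
      moreover have "b * j < b * 1" using e \<open>b < c\<close> abc by linarith
      ultimately have "i = 0" "j = 0" by simp_all
      then show ?thesis using e by simp
    qed
    define q p \<alpha> where "q = coeff Om 0" and "p = coeff Om 1" and "\<alpha> = coeff (coeff (coeff Om 2) 0) 0"
    have "coeff Om 2 = pcst \<alpha>"
      unfolding pcst_def \<alpha>_def using ij by (intro poly_eqI) (auto simp: coeff_pCons split: nat.splits)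
    moreover have "coeff Om l = 0" if "l > 2" for l
      by (intro poly_eqI) (use that l2[of l] in fastforce)
    ultimately have "Om = [:q, p, pcst \<alpha>:]"
      by (intro poly_eqI) (auto simp: q_def p_def coeff_pCons numeral_eq_Suc split: nat.splits)
    then have Om: "Om = emb q + emb p * vz + cst \<alpha> * vz ^ 2"
      by (simp add: quadratic_pCons[symmetric] emb_gens)
    have q: "a * i + b * j = a + b + c" if "coeff (coeff q j) i \<noteq> 0" for i j
      using h[of 0] that by (fastforce simp: q_def)
    have p: "a * i + b * j = a + b" if "coeff (coeff p j) i \<noteq> 0" for i j
      using h[of 1] that by (fastforce simp: p_def)
    show ?thesis
    proof (cases "\<alpha> = 0")
      case True
      then have Om': "Om = emb q + emb p * vz" using Om by (simp add: cst_simps)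
      have "\<not> isolated_singularity Om"
        unfolding Om'
        by (rule sing_linear_in_z[of a b c "a + b + c" _ "a + b"]) (use q p abc in \<open>auto simp: whomogeneous_emb\<close>)
      moreover have "rational_type Om"
        unfolding Om' using irr q p abc(1,2) unfolding Om' by (rule linear_in_z_type)
      ultimately show ?thesis by blast
    next
      case False
      then have c: "c = a + b" using ij[of 0 0] by (simp add: \<alpha>_def)
      let ?g = "pcst \<alpha> * q - pcst (1 / 4) * p ^ 2"
      have "ev2 (\<lambda>s. s) 0 0 p = 0"
        unfolding ev_origin using p[of 0 0] abc by auto
      then have eq: "surface_equiv Om (vz ^ 2 + emb ?g)"
        unfolding Om by (rule surface_equiv_complete_square[OF False])
      have "whomogeneous a b c (2 * (a + b)) (emb q)"
        using q unfolding whomogeneous_emb c by fastforce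
      then have "whomogeneous a b c (0 + 2 * (a + b)) (cst \<alpha> * emb q)"
        by (intro whomogeneous_mult whomogeneous_gens)
      moreover have "whomogeneous a b c (0 + (a + b) * 2) (cst (1 / 4) * emb p ^ 2)"
        using p by (intro whomogeneous_mult whomogeneous_gens whomogeneous_power) (simp add: whomogeneous_emb)
      ultimately have "whomogeneous a b c (2 * (a + b)) (cst \<alpha> * emb q + - (cst (1 / 4) * emb p ^ 2))"
        by (intro whomogeneous_add whomogeneous_uminus) (simp_all add: mult.commute)
      then have "whomogeneous a b c (2 * (a + b)) (emb ?g)"
        by (simp add: emb_simps emb_gens)
      then have g: "\<And>i j. coeff (coeff ?g j) i \<noteq> 0 \<Longrightarrow> a * i + b * j = 2 * (a + b)"
        unfolding whomogeneous_emb by blast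
      have "irreducible (vz ^ 2 + emb ?g)" using eq irr surface_equiv_irreducible by blast
      note * = monic_quadratic_type[OF this g abc(1,2)]
      show ?thesis
        using * type_equiv[OF eq irr] surface_equiv_isolated[OF eq] by blast
    qed
  qed
  then show "\<not> isolated_singularity Om \<Longrightarrow> rational_type Om" "isolated_singularity Om \<Longrightarrow> elliptic_type Om"
    by blast+
qed

section \<open>The listed potentials\<close>

text \<open>One of two factors has degree 0 in z, so it divides both coefficients.\<close>

lemma irreducible_linear_in_z:
  fixes p q :: "'k::field poly poly"
  assumes "p \<noteq> 0" and co: "\<And>u. u dvd p \<Longrightarrow> u dvd q \<Longrightarrow> u dvd 1"
  shows "irreducible (emb q + emb p * vz)"
  unfolding linear_pCons
proof (rule irreducibleI)
  fix A B assume AB: "[:q, p:] = A * B"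
  then have nz: "A \<noteq> 0" "B \<noteq> 0" using assms by auto
  then have "degree A + degree B = 1"
    using arg_cong[OF AB, of degree] assms by (simp add: degree_mult_eq)
  moreover have unit: "C dvd 1" if d: "degree C = 0" and CD: "[:q, p:] = C * D" for C D
  proof -
    obtain u where u: "C = [:u:]" using d by (rule degree_eq_zeroE)
    have "u dvd coeff [:q, p:] n" for n
      by (simp add: CD u del: coeff_pCons)
    from this[of 0] this[of 1] have "u dvd 1" by (intro co) simp_all
    then show ?thesis using u by (simp add: is_unit_const_poly_iff)
  qed
  ultimately have "degree A = 0 \<or> degree B = 0" by linarith
  then show "A dvd 1 \<or> B dvd 1" using unit AB by (metis mult.commute)
qed (use assms in \<open>auto simp: is_unit_poly_iff\<close>)

lemma prime_py: "prime_elem (py :: 'k::field poly poly)"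
proof -
  have dvd: "py dvd u \<longleftrightarrow> coeff u 0 = 0" for u :: "'k poly poly"
    by (cases u) (auto simp: py_def dvd_def)
  show ?thesis
    by (auto simp: prime_elem_def dvd coeff_mult_0)
qed

lemma prime_px: "prime_elem (px :: 'k::field poly poly)"
proof -
  let ?f = "map_poly (\<lambda>h :: 'k poly. coeff h 0)"
  have f: "ring_map ?f"
    by (intro ring_map_map_poly) (simp add: ring_map_def coeff_mult_0)
  have "[:0, 1:] dvd h \<longleftrightarrow> coeff h 0 = 0" for h :: "'k poly"
    by (cases h) (auto simp: dvd_def)
  then have dvd: "px dvd u \<longleftrightarrow> ?f u = 0" for u :: "'k poly poly"
    by (simp add: px_def const_poly_dvd_iff poly_eq_iff coeff_map_poly)
  show ?thesis
    by (simp add: prime_elem_def dvd ring_map_simps[OF f])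
qed

lemma dvd_prime_power_unit:
  fixes u :: "'a::idom"
  assumes "prime_elem \<pi>" "\<not> \<pi> dvd u"
  shows "u dvd \<pi> ^ m * v \<Longrightarrow> u dvd v"
proof (induction m)
  case (Suc m)
  from Suc.prems obtain w where w: "\<pi> ^ Suc m * v = u * w" by (rule dvdE)
  then have "\<pi> dvd u * w" by (metis dvd_mult2 dvd_triv_left power_Suc)
  then obtain w' where "w = \<pi> * w'"
    using assms prime_elem_dvd_mult_iff by (metis dvdE)
  then have "\<pi> * (\<pi> ^ m * v) = \<pi> * (u * w')" using w by (simp add: mult_ac)
  then have "\<pi> ^ m * v = u * w'" using assms by (auto simp: prime_elem_def)
  then show ?case using Suc by simp
qed simp

lemma not_px_dvd: "ev2 (\<lambda>s. s) 0 1 q \<noteq> 0 \<Longrightarrow> \<not> px dvd q"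
  using ring_map_dvd[OF ring_map_ev2[OF ring_map_id], of px q 0 1] by (auto simp: ev_id)

lemma not_py_dvd: "ev2 (\<lambda>s. s) 1 0 q \<noteq> 0 \<Longrightarrow> \<not> py dvd q"
  using ring_map_dvd[OF ring_map_ev2[OF ring_map_id], of py q 1 0] by (auto simp: ev_id)

lemma coprime_px_power:
  assumes "ev2 (\<lambda>s. s) 0 1 q \<noteq> 0" "u dvd px ^ m" "u dvd q"
  shows "u dvd 1"
proof (rule dvd_prime_power_unit[OF prime_px])
  show "\<not> px dvd u" using not_px_dvd[OF assms(1)] assms(3) by (metis dvd_trans)
qed (use assms in simp)

lemma coprime_py_power:
  assumes "ev2 (\<lambda>s. s) 1 0 q \<noteq> 0" "u dvd py ^ m" "u dvd q"
  shows "u dvd 1"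
proof (rule dvd_prime_power_unit[OF prime_py])
  show "\<not> py dvd u" using not_py_dvd[OF assms(1)] assms(3) by (metis dvd_trans)
qed (use assms in simp)

text \<open>Here \<open>g\<close> vanishes to order exactly one along y = 0, whereas a square
  vanishes to even order.\<close>

lemma irreducible_monic_simple_zero:
  assumes "coeff g 0 = 0" "coeff g 1 \<noteq> 0"
  shows "irreducible (vz ^ 2 + emb g)"
  unfolding monic_pCons irreducible_monic_quadratic
proof (intro allI notI)
  fix b assume g: "g = - (b ^ 2)"
  then have "coeff b 0 = 0" using assms(1) by (simp add: coeff_0_power)
  then obtain t where "b = [:0, 1:] * t" by (cases b) auto
  then have "g = [:0, 1:] * ([:0, 1:] * (- (t ^ 2)))" using g by (simp add: power2_eq_square)
  then have "coeff g 1 = 0" by simp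
  then show False using assms by simp
qed

text \<open>Restriction to y = 0 preserves squares and leaves a polynomial of odd degree in
  x.\<close>

lemma irreducible_monic_odd_coeff:
  fixes g :: "'k::field poly poly"
  assumes "odd (degree (coeff g 0))"
  shows "irreducible (vz ^ 2 + emb g)"
  unfolding monic_pCons irreducible_monic_quadratic
proof (intro allI notI)
  fix b assume "g = - (b ^ 2)"
  then have "coeff g 0 = - ((coeff b 0) ^ 2)" by (simp add: coeff_0_power)
  then show False using not_minus_square_odd assms by blast
qed

section \<open>Families of potentials common to several list entries\<close>

lemma px_py_type:
  fixes m n :: nat
  assumes "m \<ge> 1" "n \<ge> 1"
  defines "Om \<equiv> vx * vy * vz + vx ^ m + vy ^ n :: 'k::{alg_closed_field, field_char_0} poly3"
  shows "irreducible Om" "skew_type Om"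
proof -
  let ?p = "px * (pcst 1 * py + pcst 0 * px ^ 0)" and ?q = "px ^ m + py ^ n"
  have Om: "Om = emb ?q + emb ?p * vz"
    by (simp add: Om_def emb_simps emb_gens pcst_simps algebra_simps)
  show irr: "irreducible Om"
    unfolding Om
  proof (rule irreducible_linear_in_z)
    fix u :: "'k poly poly" assume u: "u dvd ?p" "u dvd ?q"
    have "\<not> px dvd u"
      using not_px_dvd[of ?q] dvd_trans[OF _ u(2)] assms by (auto simp: ev_id power_0_left)
    then have "u dvd py ^ 1"
      using dvd_prime_power_unit[OF prime_px, of u 1 "py ^ 1"] u(1) by (simp add: pcst_simps)
    then show "u dvd 1"
      using coprime_py_power[of ?q u 1] u(2) assms by (simp add: ev_id power_0_left)
  qed (simp add: pcst_simps)
  show "skew_type Om"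
    using irr unfolding Om by (intro linear_curve_type(1)) (simp_all add: pcst_simps)
qed

lemma px_power_type:
  fixes q :: "'k::{alg_closed_field, field_char_0} poly poly"
  assumes "m \<ge> 1" "ev2 (\<lambda>s. s) 0 1 q \<noteq> 0"
  shows "irreducible (emb q + emb (px ^ m) * vz)" "weyl_type (emb q + emb (px ^ m) * vz)"
proof -
  show irr: "irreducible (emb q + emb (px ^ m) * vz)"
    by (rule irreducible_linear_in_z) (use coprime_px_power[OF assms(2)] in auto)
  have "poisson_Q (emb q + emb (px ^ m) * vz) \<simeq>\<^sub>P plane_frac (pcst 1 * px ^ m)"
    using surface_linear[OF irr] by (simp add: pcst_simps)
  then show "weyl_type (emb q + emb (px ^ m) * vz)"
    unfolding weyl_type_def using is_poisson_iso_trans plane_monomial[of 1 m] by (metis zero_neq_one)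
qed

lemma x_square_y_type:
  fixes n :: nat
  assumes "n \<ge> 1"
  shows "irreducible (vz ^ 2 + vx ^ 2 * vy ^ 2 + vx ^ (2 + n) * vy :: 'k::{alg_closed_field, field_char_0} poly3)"
    "skew_type (vz ^ 2 + vx ^ 2 * vy ^ 2 + vx ^ (2 + n) * vy :: 'k poly3)"
    "irreducible (vz ^ 2 + vx ^ (2 + n) * vy :: 'k poly3)"
    "weyl_type (vz ^ 2 + vx ^ (2 + n) * vy :: 'k poly3)"
proof -
  have g: "pcst a4 * px ^ 0 * py ^ 4 + pcst 0 * px ^ 0 * py ^ 3 + pcst a * px ^ 2 * py ^ 2 + pcst 1 * px ^ (2 + n) * py + pcst 0 * px ^ 0
      = [:0, monom 1 (2 + n), monom a 2, 0, monom a4 0:]" for a4 a :: 'k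
    unfolding binary_pCons by simp
  have irr: "irreducible (vz ^ 2 + emb (pcst 0 * px ^ 0 * py ^ 4 + pcst 0 * px ^ 0 * py ^ 3 + pcst a * px ^ 2 * py ^ 2
      + pcst 1 * px ^ (2 + n) * py + pcst 0 * px ^ 0))" for a :: 'k
    by (rule irreducible_monic_simple_zero) (simp_all only: g, simp_all)
  show 1: "irreducible (vz ^ 2 + vx ^ 2 * vy ^ 2 + vx ^ (2 + n) * vy :: 'k poly3)"
    using irr[of 1] by (simp add: emb_simps emb_gens pcst_simps cst_simps add.assoc)
  show 2: "irreducible (vz ^ 2 + vx ^ (2 + n) * vy :: 'k poly3)"
    using irr[of 0] by (simp add: emb_simps emb_gens pcst_simps cst_simps add.assoc)
  have eq1: "vz ^ 2 + vx ^ 2 * vy ^ 2 + vx ^ (2 + n) * vy =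
      vz ^ 2 + vx ^ 2 * (cst 1 * vy ^ 2 + cst 1 * vx ^ n * vy + cst 0 * vx ^ (2 * n) :: 'k poly3)"
    by (simp add: cst_simps power_add algebra_simps power2_eq_square)
  show "skew_type (vz ^ 2 + vx ^ 2 * vy ^ 2 + vx ^ (2 + n) * vy :: 'k poly3)"
    using 1 assms unfolding eq1 by (intro x_square_skew) simp_all
  have eq2: "vz ^ 2 + vx ^ (2 + n) * vy =
      vz ^ 2 + vx ^ 2 * (cst 1 * vx ^ n * vy + cst 0 * vx ^ (2 * n) :: 'k poly3)"
    by (simp add: cst_simps power_add algebra_simps power2_eq_square)
  show "weyl_type (vz ^ 2 + vx ^ (2 + n) * vy :: 'k poly3)"
    using 2 unfolding eq2 by (intro x_square_weyl) simp_all
qed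

lemma x_odd_type:
  fixes M :: nat
  shows "irreducible (vz ^ 2 + vx ^ 2 * vy ^ 2 + vx ^ (2 * M + 3) :: 'k::{alg_closed_field, field_char_0} poly3)"
    "skew_type (vz ^ 2 + vx ^ 2 * vy ^ 2 + vx ^ (2 * M + 3) :: 'k poly3)"
    "irreducible (vz ^ 2 + vx ^ (2 * M + 3) :: 'k poly3)"
    "weyl_type (vz ^ 2 + vx ^ (2 * M + 3) :: 'k poly3)"
proof -
  have g: "pcst 0 * px ^ 0 * py ^ 4 + pcst 0 * px ^ 0 * py ^ 3 + pcst a * px ^ 2 * py ^ 2 + pcst 0 * px ^ 0 * py + pcst 1 * px ^ (2 * M + 3)
      = [:monom 1 (2 * M + 3), 0, monom a 2, 0, 0:]" for a :: 'k
    unfolding binary_pCons by simp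
  have irr: "irreducible (vz ^ 2 + emb (pcst 0 * px ^ 0 * py ^ 4 + pcst 0 * px ^ 0 * py ^ 3 + pcst a * px ^ 2 * py ^ 2
      + pcst 0 * px ^ 0 * py + pcst 1 * px ^ (2 * M + 3)))" for a :: 'k
    by (rule irreducible_monic_odd_coeff) (simp only: g, simp add: degree_monom_eq)
  show 1: "irreducible (vz ^ 2 + vx ^ 2 * vy ^ 2 + vx ^ (2 * M + 3) :: 'k poly3)"
    using irr[of 1] by (simp add: emb_simps emb_gens pcst_simps cst_simps add.assoc)
  show 2: "irreducible (vz ^ 2 + vx ^ (2 * M + 3) :: 'k poly3)"
    using irr[of 0] by (simp add: emb_simps emb_gens pcst_simps cst_simps add.assoc)
  have eq1: "vz ^ 2 + vx ^ 2 * vy ^ 2 + vx ^ (2 * M + 3) =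
      vz ^ 2 + vx ^ 2 * (cst 1 * vy ^ 2 + cst 1 * vx ^ (2 * M + 1) :: 'k poly3)"
    by (simp add: cst_simps algebra_simps numeral_eq_Suc)
  show "skew_type (vz ^ 2 + vx ^ 2 * vy ^ 2 + vx ^ (2 * M + 3) :: 'k poly3)"
    unfolding skew_type_def eq1 by (rule surface_conic[OF 1[unfolded eq1]]) simp_all
  have eq2: "vz ^ 2 + vx ^ (2 * M + 3) = vz ^ 2 + cst 1 * (vx ^ (2 * M + 3) :: 'k poly3)"
    by (simp add: cst_simps)
  show "weyl_type (vz ^ 2 + vx ^ (2 * M + 3) :: 'k poly3)"
    unfolding weyl_type_def eq2 by (rule surface_cylinder[OF 2[unfolded eq2]]) simp
qed

text \<open>
  Substituting \<open>x = s\<^sup>n\<close>, \<open>y = cs\<^sup>m\<close> in \<open>A\<close> with \<open>deg\<^sub>y A < n\<close>, the terms \<open>A\<^sub>j(s\<^sup>n)c\<^sup>js\<^sup>m\<^sup>j\<close> have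
  degrees in different classes modulo \<open>n\<close>, so they cannot cancel.
\<close>

lemma binomial_curve_kernel:
  fixes A :: "'k::field poly poly"
  assumes mn: "coprime m n" "n \<ge> 1" and c: "c \<noteq> 0"
  shows "A \<noteq> 0 \<Longrightarrow> degree A < n \<Longrightarrow> ev2 (\<lambda>s. [:s:]) (monom 1 n) (monom c m) A \<noteq> 0 \<and>
    (\<exists>j\<le>degree A. degree (ev2 (\<lambda>s. [:s:]) (monom 1 n) (monom c m) A) mod n = (m * j) mod n)"
proof (induction A)
  case (pCons a A)
  let ?\<phi> = "ev2 (\<lambda>s :: 'k. [:s:]) (monom 1 n) (monom c m)"
  have rm: "ring_map (\<lambda>s :: 'k. [:s:])" by (simp add: ring_map_def one_pCons)
  have "?\<phi> (pCons a A) = subst_hom (\<lambda>s. [:s:]) (monom 1 n) a + monom c m * ?\<phi> A"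
    by (simp add: ev2_def subst_hom_pCons ring_map_subst_hom rm)
  then have phi: "?\<phi> (pCons a A) = pcompose a (monom 1 n) + monom c m * ?\<phi> A"
    by (simp add: subst_hom_def pcompose_altdef)
  have da: "degree (pcompose a (monom 1 n)) = degree a * n"
    by (simp add: degree_pcompose degree_monom_eq)
  have a0: "pcompose a (monom 1 n) \<noteq> 0" if "a \<noteq> 0"
    using that mn pcompose_eq_0[of a "monom 1 n"] by (auto simp: degree_monom_eq)
  show ?case
  proof (cases "A = 0")
    case True
    then have "?\<phi> (pCons a A) = pcompose a (monom 1 n)"
      using phi by (simp add: ring_map_zero[OF ring_map_ev2[OF rm]])
    then show ?thesis using a0 pCons.prems True da by (auto intro!: exI[of _ 0])
  next
    case False
    then have "degree A < n" using pCons.prems by simp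
    then obtain j where ph: "?\<phi> A \<noteq> 0" and j: "j \<le> degree A" "degree (?\<phi> A) mod n = (m * j) mod n"
      using pCons.IH False by blast
    have t0: "monom c m * ?\<phi> A \<noteq> 0" using ph c by simp
    have dt: "degree (monom c m * ?\<phi> A) = m + degree (?\<phi> A)"
      using ph c by (simp add: degree_mult_eq degree_monom_eq)
    have tj: "degree (monom c m * ?\<phi> A) mod n = (m * Suc j) mod n"
      unfolding dt using j(2) by (metis mod_add_right_eq mult_Suc_right)
    have dA: "degree (pCons a A) = Suc (degree A)" using False by simp
    show ?thesis
    proof (cases "a = 0")
      case True
      then have "?\<phi> (pCons a A) = monom c m * ?\<phi> A" using phi by simp
      then show ?thesis using t0 tj j(1) dA by (intro conjI exI[of _ "Suc j"]) auto
    next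
      case a: False
      \<comment> \<open>The constant term in y contributes a degree in class 0 modulo n. The rest
        lies in class m(j + 1), which is nonzero because 0 < j + 1 < n and m is coprime to
        n.\<close>
      have "\<not> n dvd m * Suc j"
      proof
        assume "n dvd m * Suc j"
        then have "n dvd Suc j" using mn by (metis coprime_commute coprime_dvd_mult_right_iff)
        then have "n \<le> Suc j" by (rule dvd_imp_le) simp
        then show False using j(1) pCons.prems(2) dA by linarith
      qed
      then have "degree (monom c m * ?\<phi> A) mod n \<noteq> 0" using tj by (simp add: dvd_eq_mod_eq_0)
      moreover have "degree (pcompose a (monom 1 n)) mod n = 0" using da by simp
      ultimately have "degree (pcompose a (monom 1 n)) \<noteq> degree (monom c m * ?\<phi> A)" by metis
      then consider "degree (pcompose a (monom 1 n)) < degree (monom c m * ?\<phi> A)"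
        | "degree (monom c m * ?\<phi> A) < degree (pcompose a (monom 1 n))" by linarith
      then show ?thesis
      proof cases
        case 1
        then have d: "degree (?\<phi> (pCons a A)) = degree (monom c m * ?\<phi> A)"
          unfolding phi by (rule degree_add_eq_right)
        then have "?\<phi> (pCons a A) \<noteq> 0" using 1 by auto
        then show ?thesis using d tj j(1) dA by (intro conjI exI[of _ "Suc j"]) auto
      next
        case 2
        then have d: "degree (?\<phi> (pCons a A)) = degree (pcompose a (monom 1 n))"
          unfolding phi by (rule degree_add_eq_left)
        then have "?\<phi> (pCons a A) \<noteq> 0" using 2 by auto
        then show ?thesis using d da by (intro conjI exI[of _ 0]) auto
      qed
    qed
  qed
qed simp

text \<open>The curve is parametrized by (s^n, c s^m) with c^n = -1. One of two factors vanishes on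
  it and therefore has the full degree n in y, so the other is free of y; comparing leading
  coefficients shows it to be a unit.\<close>

lemma irreducible_binomial:
  assumes mn: "coprime m n" "n \<ge> 1"
  shows "irreducible (vx ^ m + vy ^ n :: 'k::alg_closed_field poly3)"
proof -
  let ?h = "px ^ m + py ^ n :: 'k poly poly"
  have pyn: "py ^ n = (monom 1 n :: 'k poly poly)"
    by (simp add: py_def monom_altdef)
  have coeffn: "coeff ?h n = 1"
    using mn unfolding pyn px_power by (cases n) simp_all
  then have h0: "?h \<noteq> 0" by (metis coeff_0 zero_neq_one)
  have deg: "degree ?h = n"
    unfolding pyn px_power using mn by (subst degree_add_eq_right) (simp_all add: degree_monom_eq)
  obtain c :: 'k where c: "c ^ n = - 1" using nth_root_exists[of n "- 1"] mn by auto
  then have c0: "c \<noteq> 0" using mn by (auto simp: power_0_left)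
  let ?\<phi> = "ev2 (\<lambda>s :: 'k. [:s:]) (monom 1 n) (monom c m)"
  have rm: "ring_map (\<lambda>s :: 'k. [:s:])" by (simp add: ring_map_def one_pCons)
  have "?\<phi> ?h = 0"
    by (simp add: ev2_simps[OF rm] monom_power c mult.commute flip: add_monom)
      (simp add: mult.commute add_monom)
  then have zero: "?\<phi> A = 0 \<or> ?\<phi> B = 0" if "?h = A * B" for A B
    using that by (simp add: ring_map_mult[OF ring_map_ev2[OF rm]])
  have unit: "B dvd 1" if AB: "?h = A * B" and A: "?\<phi> A = 0" for A B
  proof -
    have nz: "A \<noteq> 0" "B \<noteq> 0" using AB h0 by auto
    then have "degree A \<ge> n" using binomial_curve_kernel[OF mn c0] A by (metis not_less)
    moreover have "degree A + degree B = n" using arg_cong[OF AB, of degree] nz deg by (simp add: degree_mult_eq)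
    ultimately have B: "degree B = 0" by simp
    have "lead_coeff A * lead_coeff B = 1"
      using arg_cong[OF AB, of lead_coeff] deg coeffn by (simp add: lead_coeff_mult)
    then have "lead_coeff B dvd 1" by (metis dvd_triv_right)
    then show ?thesis using B by (auto elim!: degree_eq_zeroE simp: is_unit_const_poly_iff)
  qed
  have irr: "irreducible ?h"
  proof (rule irreducibleI)
    show "?h \<noteq> 0" by (rule h0)
    show "\<not> ?h dvd 1"
    proof
      assume "?h dvd 1"
      then have "?\<phi> ?h dvd ?\<phi> 1" by (rule ring_map_dvd[OF ring_map_ev2[OF rm]])
      then show False unfolding \<open>?\<phi> ?h = 0\<close> by (simp add: ev2_simps[OF rm])
    qed
    fix A B assume "?h = A * B"
    then show "A dvd 1 \<or> B dvd 1" using zero unit by (metis mult.commute)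
  qed
  have "irreducible (emb ?h)"
    unfolding emb_def
  proof (rule irreducibleI)
    show "[:?h:] \<noteq> 0" "\<not> [:?h:] dvd 1"
      using irr by (auto simp: irreducible_def is_unit_const_poly_iff)
    fix A B assume AB: "[:?h:] = A * B"
    then have "A \<noteq> 0" "B \<noteq> 0" using h0 by auto
    then have "degree A = 0" "degree B = 0"
      using arg_cong[OF AB, of degree] by (simp_all add: degree_mult_eq)
    then obtain a b where "A = [:a:]" "B = [:b:]" by (auto elim!: degree_eq_zeroE)
    then show "A dvd 1 \<or> B dvd 1"
      using AB irr by (auto simp: irreducible_def is_unit_const_poly_iff)
  qed
  then show ?thesis by (simp add: emb_simps emb_gens)
qed

lemma whomogeneousI: "whomogeneous a b c e f \<Longrightarrow> e = d \<Longrightarrow> whomogeneous a b c d f"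
  by simp

lemmas whomogeneous_intros = whomogeneous_mult whomogeneous_power whomogeneous_gens

lemmas fold_vars = cst_def[symmetric] vx_def[symmetric] vy_def[symmetric] vz_def[symmetric]

text \<open>A nonzero double root satisfies \<rho>^2 + r\<rho> + 1 = 0 and the derivative equation;
  together they give \<rho>^2 = 1, hence r = 2 or r = -2.\<close>

lemma no_double_root:
  fixes r :: "'k::field"
  assumes "r \<noteq> 2" "r \<noteq> - 2"
  shows "\<not> double_root 1 r 1 0 \<rho>"
proof
  assume *: "double_root 1 r 1 0 \<rho>"
  then have "\<rho> \<noteq> 0" by (auto simp: double_root_def)
  moreover have "\<rho> * (\<rho> ^ 2 + r * \<rho> + 1) = 0"
    using * by (simp add: double_root_def algebra_simps power2_eq_square power3_eq_cube)
  ultimately have 0: "\<rho> ^ 2 + r * \<rho> + 1 = 0" by simp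
  have 1: "3 * \<rho> ^ 2 + 2 * r * \<rho> + 1 = 0" using * by (simp add: double_root_def)
  have "\<rho> ^ 2 - 1 = (3 * \<rho> ^ 2 + 2 * r * \<rho> + 1) - 2 * (\<rho> ^ 2 + r * \<rho> + 1)"
    by (simp add: algebra_simps)
  then have "\<rho> ^ 2 = 1" unfolding 0 1 by simp
  then consider "\<rho> = 1" | "\<rho> = - 1" by (auto simp: power2_eq_1_iff)
  then show False
  proof cases
    case 1
    then have "r + 2 = 0" using 0 by (simp add: algebra_simps)
    then show False using assms by (simp add: eq_neg_iff_add_eq_0)
  next
    case 2
    then have "r = 2" using 0 by (simp add: algebra_simps)
    then show False using assms by simp
  qed
qed

section \<open>Verification of the three lists\<close>

lemma S_list_type:
  fixes Om :: "'k::{alg_closed_field, field_char_0} poly3"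
  assumes "S_list a b c Om"
  shows "irreducible Om \<and> whomogeneous a b c (a + b + c) Om \<and> elliptic_type Om"
  using assms
proof cases
  case (1 r)
  have eq: "Om = hesse 1 (3 * r)"
    unfolding 1 fold_vars by (simp add: hesse_def cst_simps)
  have ne: "(3 * r) ^ 3 \<noteq> - (3 ^ 3) * 1 ^ 3"
  proof
    assume "(3 * r) ^ 3 = - (3 ^ 3) * 1 ^ 3"
    then have "27 * (r ^ 3 + 1) = 0" by (simp add: power_mult_distrib)
    then have "r ^ 3 + 1 = 0" by (rule numeral_mult_eq_0)
    then show False using 1 by (simp add: eq_neg_iff_add_eq_0)
  qed
  have "elliptic_type Om"
    unfolding elliptic_type_def poisson_S_eq eq
    by (rule exI[of _ 1], rule exI[of _ "3 * r"]) (use ne is_poisson_iso_refl in simp)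
  moreover have "whomogeneous a b c (a + b + c) Om"
    unfolding 1 fold_vars
    by (intro whomogeneous_add; rule whomogeneousI, (rule whomogeneous_intros)+, simp)
  ultimately show ?thesis using hesse_irreducible[OF _ ne] unfolding eq by simp
next
  case (2 r)
  have eq: "Om = quartic 0 1 r 1 0"
    unfolding 2 fold_vars by (simp add: quartic_def cst_simps algebra_simps)
  note nr = no_double_root[OF 2(5,6)]
  have "whomogeneous a b c (a + b + c) Om"
    unfolding 2 fold_vars
    by (intro whomogeneous_add; rule whomogeneousI, (rule whomogeneous_intros)+, simp)
  then show ?thesis using elliptic_from_weierstrass(3,4)[OF _ nr] unfolding eq by simp
next
  case (3 r)
  have eq: "Om = sextic 1 r 1 0"
    unfolding 3 fold_vars by (simp add: sextic_def cst_simps algebra_simps)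
  note nr = no_double_root[OF 3(5,6)]
  have "whomogeneous a b c (a + b + c) Om"
    unfolding 3 fold_vars
    by (intro whomogeneous_add; rule whomogeneousI, (rule whomogeneous_intros)+, simp)
  then show ?thesis using elliptic_from_weierstrass(1,2)[OF _ nr] unfolding eq by simp
qed

lemma double_root_plus_minus:
  fixes r \<epsilon> :: "'k::field"
  assumes "\<epsilon> ^ 2 = 1" "r = 2 * \<epsilon>"
  shows "double_root 1 r 1 0 (- \<epsilon>)"
proof -
  have "\<epsilon> ^ 3 = \<epsilon>" using assms(1) by (simp add: power3_eq_cube power2_eq_square)
  then show ?thesis
    using assms by (simp add: double_root_def power2_eq_square power3_eq_cube)
qed

text \<open>For r = 2\<epsilon> with \<epsilon>^2 = 1 the binary quartic is xy(y + \<epsilon>x)^2.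
  Replacing x by x - \<epsilon>y turns the double factor into x^2 and leaves the cofactor xy -
  \<epsilon>y^2.\<close>

lemma quartic_skew:
  fixes r :: "'k::{alg_closed_field, field_char_0}"
  assumes "r = 2 \<or> r = - 2"
  shows "irreducible (quartic 0 1 r 1 0)" "skew_type (quartic 0 1 r 1 0)"
proof -
  obtain \<epsilon> :: 'k where \<epsilon>: "\<epsilon> ^ 2 = 1" "r = 2 * \<epsilon>"
    using assms that[of 1] that[of "- 1"] by auto
  then have \<epsilon>0: "\<epsilon> \<noteq> 0" and \<epsilon>3: "\<epsilon> ^ 3 = \<epsilon>"
    by (auto simp: power3_eq_cube power2_eq_square)
  show irr: "irreducible (quartic 0 1 r 1 0)"
    unfolding quartic_eq by (intro irreducible_monic_odd) simp
  have eq: "surface_equiv (quartic 0 1 r 1 0) (quartic 0 0 (- \<epsilon>) 1 0)"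
    using quartic_shift[of 0 1 r 1 0 "- \<epsilon>"] \<epsilon> \<epsilon>3 by (simp add: power2_eq_square mult.assoc)
  then have "irreducible (quartic 0 0 (- \<epsilon>) 1 0)" using irr surface_equiv_irreducible by blast
  then have "skew_type (quartic 0 0 (- \<epsilon>) 1 0)"
    using \<epsilon>0 unfolding quartic_x_square by (intro x_square_skew) simp_all
  then show "skew_type (quartic 0 1 r 1 0)" using type_equiv[OF eq irr] by blast
qed

lemma sextic_irreducible: "\<alpha> \<noteq> 0 \<Longrightarrow> irreducible (sextic \<alpha> \<beta> \<gamma> \<delta>)"
  unfolding sextic_eq by (intro irreducible_monic_odd) simp

lemma sextic_skew:
  fixes r :: "'k::{alg_closed_field, field_char_0}"
  assumes "r = 2 \<or> r = - 2"
  shows "skew_type (sextic 1 r 1 0)"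
proof -
  obtain \<epsilon> :: 'k where \<epsilon>: "\<epsilon> ^ 2 = 1" "r = 2 * \<epsilon>"
    using assms that[of 1] that[of "- 1"] by auto
  \<comment> \<open>The double root -\<epsilon> is not triple, since -3\<epsilon> + 2\<epsilon> =
    -\<epsilon> is nonzero.\<close>
  then have "3 * 1 * (- \<epsilon>) + r \<noteq> 0" by auto
  then show ?thesis
    using sextic_double_root[OF sextic_irreducible _ double_root_plus_minus[OF \<epsilon>]] by simp
qed

lemma odd_quotient:
  fixes a b :: nat
  assumes "1 \<le> a" "a < b" "\<not> a dvd b" "a dvd 2 * b"
  obtains M where "2 + (2 * b) div a = 2 * M + 3" "a * (2 * M + 3) = 2 * a + 2 * b"
proof -
  obtain N where N: "2 * b = a * N" using assms(4) by (rule dvdE)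
  have "odd N"
  proof
    assume "even N"
    then obtain k where "N = 2 * k" by (rule evenE)
    then have "b = a * k" using N by simp
    then show False using assms(3) by simp
  qed
  then obtain M where M: "N = 2 * M + 1" by (rule oddE)
  have "(2 * b) div a = N" using N assms(1) by simp
  then have "2 + (2 * b) div a = 2 * M + 3" using M by simp
  moreover have "a * (2 * M + 3) = 2 * a + 2 * b"
    unfolding N M by (simp add: algebra_simps)
  ultimately show ?thesis by (rule that)
qed

lemma K_skew_list_type:
  fixes Om :: "'k::{alg_closed_field, field_char_0} poly3"
  assumes "K_skew_list a b c Om"
  shows "irreducible Om \<and> whomogeneous a b c (a + b + c) Om \<and> skew_type Om"
  using assms
proof cases
  case 1
  let ?p = "pcst 1 * px ^ 2 + pcst 0 * px * py + pcst 1 * py ^ 2 :: 'k poly poly"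
  have eq: "Om = emb (px ^ 3) + emb ?p * vz"
    unfolding 1 fold_vars by (simp add: emb_simps emb_gens cst_simps algebra_simps)
  have "ev2 (\<lambda>s. s) 0 1 ?p \<noteq> 0" by (simp add: ev_id)
  then have p0: "?p \<noteq> 0" and co: "\<And>u. u dvd ?p \<Longrightarrow> u dvd px ^ 3 \<Longrightarrow> u dvd 1"
    using not_px_dvd[of ?p] coprime_px_power[of ?p] by (metis dvd_0_right, blast)
  have irr: "irreducible Om" unfolding eq using p0 co by (rule irreducible_linear_in_z)
  have "skew_type Om" using irr p0 unfolding eq by (rule linear_quadratic_type(1)) simp
  moreover have "whomogeneous a b c (a + b + c) Om"
    unfolding 1 fold_vars
    by (intro whomogeneous_add; rule whomogeneousI, (rule whomogeneous_intros)+, simp)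
  ultimately show ?thesis using irr by simp
next
  case 2
  have "whomogeneous a b c (a + b + c) Om"
    unfolding 2 fold_vars
    by (intro whomogeneous_add; rule whomogeneousI, (rule whomogeneous_intros)+, simp)
  then show ?thesis using x_square_y_type(1,2)[of 1] unfolding 2 fold_vars by simp
next
  case (3 r)
  have eq: "Om = quartic 0 1 r 1 0"
    unfolding 3(1-4) fold_vars by (simp add: quartic_def cst_simps algebra_simps)
  have "whomogeneous a b c (a + b + c) Om"
    unfolding 3(1-4) fold_vars
    by (intro whomogeneous_add; rule whomogeneousI, (rule whomogeneous_intros)+, simp)
  then show ?thesis using quartic_skew[OF 3(5)] unfolding eq by simp
next
  case 4
  have "whomogeneous a b c (a + b + c) Om"
    unfolding 4 fold_vars
    by (intro whomogeneous_add; rule whomogeneousI, (rule whomogeneous_intros)+, simp)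
  then show ?thesis using px_py_type[of 4 4] unfolding 4 fold_vars by simp
next
  case (5 k)
  have "whomogeneous a b c (a + b + c) Om"
    unfolding 5(1-3) fold_vars
    by (intro whomogeneous_add; rule whomogeneousI, (rule whomogeneous_intros)+, simp add: algebra_simps)
  then show ?thesis using px_py_type[of "k + 2" "k + 2"] unfolding 5(3) fold_vars by simp
next
  case 6
  have eq: "Om = sextic 1 1 0 0"
    unfolding 6 fold_vars by (simp add: sextic_def cst_simps algebra_simps)
  have irr: "irreducible (sextic 1 1 0 0 :: 'k poly3)" by (rule sextic_irreducible) simp
  have "skew_type (sextic 1 1 0 0 :: 'k poly3)"
    using sextic_double_root[OF irr, of 0] by (simp add: double_root_def)
  moreover have "whomogeneous a b c (a + b + c) Om"
    unfolding 6 fold_vars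
    by (intro whomogeneous_add; rule whomogeneousI, (rule whomogeneous_intros)+, simp)
  ultimately show ?thesis using irr unfolding eq by simp
next
  case (7 r)
  have eq: "Om = sextic 1 r 1 0"
    unfolding 7(1-4) fold_vars by (simp add: sextic_def cst_simps algebra_simps)
  have "whomogeneous a b c (a + b + c) Om"
    unfolding 7(1-4) fold_vars
    by (intro whomogeneous_add; rule whomogeneousI, (rule whomogeneous_intros)+, simp)
  then show ?thesis using sextic_skew[OF 7(5)] sextic_irreducible[of 1] unfolding eq by simp
next
  case 8
  have "whomogeneous a b c (a + b + c) Om"
    unfolding 8 fold_vars
    by (intro whomogeneous_add; rule whomogeneousI, (rule whomogeneous_intros)+, simp)
  then show ?thesis using x_square_y_type(1,2)[of 2] unfolding 8 fold_vars by simp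
next
  case 9
  have "whomogeneous a b c (a + b + c) Om"
    unfolding 9 fold_vars
    by (intro whomogeneous_add; rule whomogeneousI, (rule whomogeneous_intros)+, simp)
  then show ?thesis using px_py_type[of 6 3] unfolding 9 fold_vars by simp
next
  case 10
  obtain M where M: "2 + (2 * b) div a = 2 * M + 3" "a * (2 * M + 3) = 2 * a + 2 * b"
    using odd_quotient 10(2-6) by blast
  have "whomogeneous a b c (a + b + c) Om"
    unfolding 10(1,4) M(1) fold_vars
    by (intro whomogeneous_add; rule whomogeneousI, (rule whomogeneous_intros)+, use M(2) in simp)
  then show ?thesis using x_odd_type(1,2)[of M] unfolding 10(1) M(1) fold_vars by simp
next
  case 11
  obtain n where n: "b = a * n" using 11 by (elim dvdE)
  then have "b div a = n" "n \<ge> 1" using 11 by (auto intro: Suc_leI gr0I)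
  moreover have "whomogeneous a b c (a + b + c) (vz ^ 2 + vx ^ 2 * vy ^ 2 + vx ^ (2 + n) * vy :: 'k poly3)"
    unfolding 11(4)
    by (intro whomogeneous_add; rule whomogeneousI, (rule whomogeneous_intros)+, simp add: n algebra_simps)
  ultimately show ?thesis using x_square_y_type(1,2)[of n] unfolding 11(1) fold_vars by simp
next
  case 12
  have "a dvd a + b + c" "b dvd a + b + c"
    using 12 dvd_add_triv_left_iff[of a "b + c"] dvd_add_triv_left_iff[of b "a + c"]
    by (simp_all only: add_ac)
  then have 1: "a * ((a + b + c) div a) = a + b + c" "b * ((a + b + c) div b) = a + b + c"
    by simp_all
  then have "(a + b + c) div a \<noteq> 0" "(a + b + c) div b \<noteq> 0" using 12 by (metis add_is_0 mult_0_right not_one_le_zero)+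
  moreover have "whomogeneous a b c (a + b + c) Om"
    unfolding 12(1) fold_vars
    by (intro whomogeneous_add; rule whomogeneousI, (rule whomogeneous_intros)+, simp add: 1)
  ultimately show ?thesis
    using px_py_type[of "(a + b + c) div a" "(a + b + c) div b"] unfolding 12(1) fold_vars by simp
qed

lemma px_power_type':
  fixes q :: "'k::{alg_closed_field, field_char_0} poly poly"
  assumes "Om = emb q + emb (px ^ m) * vz" "m \<ge> 1" "ev2 (\<lambda>s. s) 0 1 q \<noteq> 0"
  shows "irreducible Om \<and> weyl_type Om"
  using px_power_type[OF assms(2,3)] assms(1) by simp

lemma K_Weyl_list_type:
  fixes Om :: "'k::{alg_closed_field, field_char_0} poly3"
  assumes "K_Weyl_list a b c Om"
  shows "irreducible Om \<and> whomogeneous a b c (a + b + c) Om \<and> weyl_type Om"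
  using assms
proof cases
  case 1
  let ?p = "pcst 0 * px ^ 2 + pcst 0 * px * py + pcst 1 * py ^ 2 :: 'k poly poly"
  have eq: "Om = emb (px ^ 3) + emb ?p * vz"
    unfolding 1 fold_vars by (simp add: emb_simps emb_gens cst_simps algebra_simps)
  have "ev2 (\<lambda>s. s) 0 1 ?p \<noteq> 0" by (simp add: ev_id)
  then have p0: "?p \<noteq> 0" and co: "\<And>u. u dvd ?p \<Longrightarrow> u dvd px ^ 3 \<Longrightarrow> u dvd 1"
    using not_px_dvd[of ?p] coprime_px_power[of ?p] by (metis dvd_0_right, blast)
  have irr: "irreducible Om" unfolding eq using p0 co by (rule irreducible_linear_in_z)
  have "weyl_type Om" using irr p0 unfolding eq by (rule linear_quadratic_type(2)) simp
  moreover have "whomogeneous a b c (a + b + c) Om"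
    unfolding 1 fold_vars
    by (intro whomogeneous_add; rule whomogeneousI, (rule whomogeneous_intros)+, simp)
  ultimately show ?thesis using irr by simp
next
  case 2
  have "whomogeneous a b c (a + b + c) Om"
    unfolding 2 fold_vars
    by (intro whomogeneous_add; rule whomogeneousI, (rule whomogeneous_intros)+, simp)
  then show ?thesis using x_square_y_type(3,4)[of 1] unfolding 2 fold_vars by simp
next
  case 3
  have "whomogeneous a b c (a + b + c) Om"
    unfolding 3 fold_vars
    by (intro whomogeneous_add; rule whomogeneousI, (rule whomogeneous_intros)+, simp)
  moreover have "irreducible Om \<and> weyl_type Om"
    by (rule px_power_type'[of _ "py ^ 4" 2]) (unfold 3 fold_vars, simp_all add: emb_simps emb_gens ev_id)
  ultimately show ?thesis by simp
next
  case 4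
  have "whomogeneous a b c (a + b + c) Om"
    unfolding 4 fold_vars
    by (intro whomogeneous_add; rule whomogeneousI, (rule whomogeneous_intros)+, simp)
  moreover have "irreducible Om \<and> weyl_type Om"
    by (rule px_power_type'[of _ "px * py ^ 3 + py ^ 4" 2])
      (unfold 4 fold_vars, simp_all add: emb_simps emb_gens ev_id)
  ultimately show ?thesis by simp
next
  case (5 k)
  have "whomogeneous a b c (a + b + c) Om"
    unfolding 5(1-3) fold_vars
    by (intro whomogeneous_add; rule whomogeneousI, (rule whomogeneous_intros)+, simp add: algebra_simps)
  moreover have "irreducible Om \<and> weyl_type Om"
    by (rule px_power_type'[of _ "px * py ^ (k + 1) + py ^ (k + 2)" 2])
      (unfold 5(3) fold_vars, simp_all add: emb_simps emb_gens ev_id)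
  ultimately show ?thesis by simp
next
  case (6 k)
  have "whomogeneous a b c (a + b + c) Om"
    unfolding 6(1-3) fold_vars
    by (intro whomogeneous_add; rule whomogeneousI, (rule whomogeneous_intros)+, simp add: algebra_simps)
  moreover have "irreducible Om \<and> weyl_type Om"
    by (rule px_power_type'[of _ "py ^ (k + 2)" 2])
      (unfold 6(3) fold_vars, simp_all add: emb_simps emb_gens ev_id)
  ultimately show ?thesis by simp
next
  case 7
  have eq: "Om = sextic 1 0 0 0"
    unfolding 7 fold_vars by (simp add: sextic_def cst_simps)
  have irr: "irreducible (sextic 1 0 0 0 :: 'k poly3)" by (rule sextic_irreducible) simp
  have "weyl_type (sextic 1 0 0 0 :: 'k poly3)"
    using sextic_double_root[OF irr, of 0] by (simp add: double_root_def)
  moreover have "whomogeneous a b c (a + b + c) Om"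
    unfolding 7 fold_vars
    by (intro whomogeneous_add; rule whomogeneousI, (rule whomogeneous_intros)+, simp)
  ultimately show ?thesis using irr unfolding eq by simp
next
  case 8
  have "whomogeneous a b c (a + b + c) Om"
    unfolding 8 fold_vars
    by (intro whomogeneous_add; rule whomogeneousI, (rule whomogeneous_intros)+, simp)
  then show ?thesis using x_square_y_type(3,4)[of 2] unfolding 8 fold_vars by simp
next
  case 9
  have "whomogeneous a b c (a + b + c) Om"
    unfolding 9 fold_vars
    by (intro whomogeneous_add; rule whomogeneousI, (rule whomogeneous_intros)+, simp)
  moreover have "irreducible Om \<and> weyl_type Om"
    by (rule px_power_type'[of _ "py ^ 3 + px ^ 2 * py ^ 2" 3])
      (unfold 9 fold_vars, simp_all add: emb_simps emb_gens ev_id)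
  ultimately show ?thesis by simp
next
  case 10
  have "whomogeneous a b c (a + b + c) Om"
    unfolding 10 fold_vars
    by (intro whomogeneous_add; rule whomogeneousI, (rule whomogeneous_intros)+, simp)
  moreover have "irreducible Om \<and> weyl_type Om"
    by (rule px_power_type'[of _ "py ^ 3" 3]) (unfold 10 fold_vars, simp_all add: emb_simps emb_gens ev_id)
  ultimately show ?thesis by simp
next
  case 11
  obtain M where M: "2 + (2 * b) div a = 2 * M + 3" "a * (2 * M + 3) = 2 * a + 2 * b"
    using odd_quotient 11(2-6) by blast
  have "whomogeneous a b c (a + b + c) Om"
    unfolding 11(1,4) M(1) fold_vars
    by (intro whomogeneous_add; rule whomogeneousI, (rule whomogeneous_intros)+, use M(2) in simp)
  then show ?thesis using x_odd_type(3,4)[of M] unfolding 11(1) M(1) fold_vars by simp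
next
  case 12
  obtain n where n: "b = a * n" using 12 by (elim dvdE)
  then have "b div a = n" "n \<ge> 1" using 12 by (auto intro: Suc_leI gr0I)
  moreover have "whomogeneous a b c (a + b + c) (vz ^ 2 + vx ^ (2 + n) * vy :: 'k poly3)"
    unfolding 12(4)
    by (intro whomogeneous_add; rule whomogeneousI, (rule whomogeneous_intros)+, simp add: n algebra_simps)
  ultimately show ?thesis using x_square_y_type(3,4)[of n] unfolding 12(1) fold_vars by simp
next
  case 13
  define g where "g = gcd a b"
  have g: "a = a div g * g" "b = b div g * g" by (simp_all add: g_def)
  have co: "coprime (b div g) (a div g)"
    using 13(2) unfolding g_def by (metis coprime_commute div_gcd_coprime not_one_le_zero)
  have pos: "b div g \<ge> 1" "a div g \<ge> 1" using g 13(2,3) by (auto intro!: Suc_leI gr0I)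
  have g0: "g > 0" using 13(2) by (simp add: g_def)
  have "a * b div g = a * (b div g)" "b * a div g = b * (a div g)"
    by (simp_all add: g_def div_mult_swap)
  then have deg: "a * (b div g) = a + b + c" "b * (a div g) = a + b + c"
    using 13(5) unfolding g_def by (simp_all add: mult.commute[of b])
  have Om: "Om = vx ^ (b div g) + vy ^ (a div g)"
    unfolding 13(1) fold_vars g_def ..
  have irr: "irreducible Om" unfolding Om by (rule irreducible_binomial[OF co pos(2)])
  have "weyl_type Om"
    using cusp_type[of 1 "b div g" 1 "a div g"] irr co pos unfolding Om by (simp add: cst_simps)
  moreover have "whomogeneous a b c (a + b + c) Om"
    unfolding Om
    by (intro whomogeneous_add; rule whomogeneousI, (rule whomogeneous_intros)+, simp add: deg)
  ultimately show ?thesis using irr by simp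
next
  case 14
  obtain n where n: "b = a * n" using 14 by (elim dvdE)
  then have bn: "b div a = n" using 14 by simp
  have "b dvd a + b + c"
    using 14 dvd_add_triv_left_iff[of b "a + c"] by (simp only: add_ac)
  then have N: "b * ((a + b + c) div b) = a + b + c" by simp
  have "whomogeneous a b c (a + b + c) (vx ^ (1 + n) * vz :: 'k poly3)"
    by (rule whomogeneousI, (rule whomogeneous_intros)+) (simp add: n algebra_simps)
  moreover have "whomogeneous a b c (a + b + c) (vy ^ ((a + b + c) div b) :: 'k poly3)"
    by (rule whomogeneousI, (rule whomogeneous_intros)+) (use N in simp)
  ultimately have "whomogeneous a b c (a + b + c) Om"
    unfolding 14(1) bn fold_vars by (intro whomogeneous_add)
  moreover have "irreducible Om \<and> weyl_type Om"
    by (rule px_power_type'[of _ "py ^ ((a + b + c) div b)" "1 + b div a"])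
      (unfold 14(1) fold_vars, simp_all add: emb_simps emb_gens ev_id)
  ultimately show ?thesis by simp
next
  case 15
  obtain n where n: "b = a * n" using 15 by (elim dvdE)
  then have bn: "b div a = n" using 15 by simp
  have "b dvd a + b + c"
    using 15 dvd_add_triv_left_iff[of b "a + c"] by (simp only: add_ac)
  then have N: "b * ((a + b + c) div b) = a + b + c" "b * ((a + c) div b) = a + c"
    using 15 by simp_all
  have n0: "n \<noteq> 0" using n 15 by auto
  have "whomogeneous a b c (a + b + c) (vx ^ (1 + n) * vz :: 'k poly3)"
    by (rule whomogeneousI, (rule whomogeneous_intros)+) (simp add: n algebra_simps)
  moreover have "whomogeneous a b c (a + b + c) (vx ^ n * vy ^ ((a + c) div b) :: 'k poly3)"
    by (rule whomogeneousI, (rule whomogeneous_intros)+) (use N n in simp)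
  moreover have "whomogeneous a b c (a + b + c) (vy ^ ((a + b + c) div b) :: 'k poly3)"
    by (rule whomogeneousI, (rule whomogeneous_intros)+) (use N in simp)
  ultimately have "whomogeneous a b c (a + b + c) Om"
    unfolding 15(1) bn fold_vars by (intro whomogeneous_add)
  moreover have "irreducible Om \<and> weyl_type Om"
    by (rule px_power_type'[of _ "px ^ n * py ^ ((a + c) div b) + py ^ ((a + b + c) div b)" "1 + n"])
      (unfold 15(1) bn fold_vars, use n0 in \<open>simp_all add: emb_simps emb_gens ev_id power_0_left\<close>)
  ultimately show ?thesis by simp
qed

theorem theorem3p6:
  fixes Om :: "'k :: {alg_closed_field, field_char_0} poly3"
    and a b c :: nat
  assumes "1 \<le> a" "a \<le> b" "b \<le> c"
  shows
    "(irreducible Om \<and> whomogeneous a b c (a + b + c) Om \<longrightarrow>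
        (\<not> isolated_singularity Om \<longrightarrow>
           poisson_Q Om \<simeq>\<^sub>P (K_Weyl :: ('k, _) poisson) \<or> (\<exists>q. q \<noteq> 0 \<and> poisson_Q Om \<simeq>\<^sub>P K_skew q)) \<and>
        (isolated_singularity Om \<longrightarrow>
           (\<exists>\<zeta> l. \<zeta> \<noteq> 0 \<and> l ^ 3 \<noteq> - (3 ^ 3) * \<zeta> ^ 3 \<and> poisson_Q Om \<simeq>\<^sub>P poisson_S \<zeta> l)))
     \<and> (S_list a b c Om \<or> K_skew_list a b c Om \<or> K_Weyl_list a b c Om \<longrightarrow>
          irreducible Om \<and> whomogeneous a b c (a + b + c) Om)
     \<and> (S_list a b c Om \<longrightarrow>
          (\<exists>\<zeta> l. \<zeta> \<noteq> 0 \<and> l ^ 3 \<noteq> - (3 ^ 3) * \<zeta> ^ 3 \<and> poisson_Q Om \<simeq>\<^sub>P poisson_S \<zeta> l))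
     \<and> (K_skew_list a b c Om \<longrightarrow> (\<exists>q. q \<noteq> 0 \<and> poisson_Q Om \<simeq>\<^sub>P K_skew q))
     \<and> (K_Weyl_list a b c Om \<longrightarrow> poisson_Q Om \<simeq>\<^sub>P (K_Weyl :: ('k, _) poisson))"
  unfolding rational_type_def[symmetric] skew_type_def[symmetric] weyl_type_def[symmetric]
    elliptic_type_def[symmetric]
  using classification[OF _ _ assms, of Om] S_list_type[of a b c Om] K_skew_list_type[of a b c Om]
    K_Weyl_list_type[of a b c Om] rational_type_iff[of Om]
  by blast

end
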